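(* Let $f:\mathbb{R}\to\mathbb{R}$ satisfy assumptions (A1) and (A2) stated in the context, and let $S:\mathbb{R}\times\mathbb{R}_+\to\mathbb{R}$, $(x_0,t)\mapsto S_t x_0$, be a deterministic semigroup compatible with the ODE $\dot x=f(x)$. Then there exists a sequence of smooth functions $(f_n)_{n\ge 1}$, $f_n:\mathbb{R}\to\mathbb{R}$, converging to $f$ in the sense of the graph, such that the following holds. For each $x_0\in\mathbb{R}$, denoting by $t\mapsto S^n_t x_0$ the unique solution of the Cauchy problem $\dot x=f_n(x)$, $x(0)=x_0$, one has $$\lim_{n\to\infty}\ \sup_{t\ge 0}\ \bigl|S^n_t x_0-S_t x_0\bigr|=0 .$$
   Context: Assumptions on $f$: (A1) $f:\mathbb{R}\to\mathbb{R}$ is bounded and regulated, i.e. it admits left and right limits $f(x-)$, $f(x+)$ at every point $x$, and $M:=\sup_x|f(x)|<+\infty$. (A2) If $y$ is a point where either $f(y-)\cdot f(y+)=0$ or $f(y-)>0>f(y+)$, then $f(y)=0$. A Carathéodory solution of $\dot x=f(x)$, $x(0)=x_0$ is a map $t\mapsto x(t)$ with $x(t)=x_0+\int_0^t f(x(s))\,ds$ for all $t\ge0$. A deterministic semigroup compatible with the ODE $\dot x=f(x)$ is a map $S:\mathbb{R}\times\mathbb{R}_+\to\mathbb{R}$ such that (i) $S_t(S_s(x_0))=S_{t+s}(x_0)$ and $S_0(x_0)=x_0$ for all $x_0\in\mathbb{R}$, $s,t\ge0$; (ii) for each $x_0\in\mathbb{R}$, the map $t\mapsto S_tx_0$ is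 a Carathéodory solution of $\dot x=f(x)$, $x(0)=x_0$. No continuity of $S$ with respect to $x_0$ is required. Convergence in the sense of the graph: let $F(x):=\mathrm{co}\{f(x),f(x+),f(x-)\}$ (convex closure), a multifunction with graph $\mathrm{Graph}(F)=\{(x,y): y\in F(x)\}$. For a set $V$, $B(V,r)=\{x: d(x,V)<r\}$ is the open $r$-neighborhood of $V$. A sequence of smooth functions $f_n$ converges to $f$ in the sense of the graph if for every $\varepsilon>0$ and $N>0$ one has $\mathrm{Graph}\bigl(f_n|_{[-N,N]}\bigr)\subset B(\mathrm{Graph}(F),\varepsilon)$ for all $n$ sufficiently large. *)

theory Defs
  imports "HOL-Analysis.Analysis"
begin

definition regulated :: "(real \<Rightarrow> real) \<Rightarrow> bool" where
  "regulated f \<longleftrightarrow>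
     (\<forall>x. (\<exists>l. (f \<longlongrightarrow> l) (at_left x)) \<and> (\<exists>r. (f \<longlongrightarrow> r) (at_right x)))"

text \<open>The one-sided limits \<open>f(x-)\<close> and \<open>f(x+)\<close>; meaningful only where they exist, e.g. for
  regulated \<open>f\<close>.\<close>

definition llim :: "(real \<Rightarrow> real) \<Rightarrow> real \<Rightarrow> real" where
  "llim f x = Lim (at_left x) f"

definition rlim :: "(real \<Rightarrow> real) \<Rightarrow> real \<Rightarrow> real" where
  "rlim f x = Lim (at_right x) f"

definition assumption_A1 :: "(real \<Rightarrow> real) \<Rightarrow> bool" where
  "assumption_A1 f \<longleftrightarrow> bounded (range f) \<and> regulated f"

definition assumption_A2 :: "(real \<Rightarrow> real) \<Rightarrow> bool" where
  "assumption_A2 f \<longleftrightarrow>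
     (\<forall>y. llim f y * rlim f y = 0 \<or> (llim f y > 0 \<and> 0 > rlim f y) \<longrightarrow> f y = 0)"

text \<open>Only the values \<open>x t\<close> with \<open>t \<ge> 0\<close> matter. Integrability is stated separately because the
  Bochner integral of a non-integrable function is \<open>0\<close> by convention.\<close>

definition caratheodory_solution ::
  "(real \<Rightarrow> real) \<Rightarrow> real \<Rightarrow> (real \<Rightarrow> real) \<Rightarrow> bool" where
  "caratheodory_solution f x0 x \<longleftrightarrow>
     (\<forall>t\<ge>0. set_integrable lebesgue {0..t} (\<lambda>s. f (x s)) \<and>
            x t = x0 + (LINT s:{0..t}|lebesgue. f (x s)))"

definition unique_solution ::
  "(real \<Rightarrow> real) \<Rightarrow> real \<Rightarrow> (real \<Rightarrow> real) \<Rightarrow> bool" where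
  "unique_solution f x0 x \<longleftrightarrow>
     caratheodory_solution f x0 x \<and>
     (\<forall>y. caratheodory_solution f x0 y \<longrightarrow> (\<forall>t\<ge>0. y t = x t))"

text \<open>\<open>S t x0\<close> stands for \<open>S\<^sub>t x\<^sub>0\<close>; its values for \<open>t < 0\<close> are irrelevant.\<close>

definition deterministic_semigroup ::
  "(real \<Rightarrow> real) \<Rightarrow> (real \<Rightarrow> real \<Rightarrow> real) \<Rightarrow> bool" where
  "deterministic_semigroup f S \<longleftrightarrow>
     (\<forall>x0. S 0 x0 = x0 \<and> (\<forall>s\<ge>0. \<forall>t\<ge>0. S t (S s x0) = S (t + s) x0)) \<and>
     (\<forall>x0. caratheodory_solution f x0 (\<lambda>t. S t x0))"

definition smooth :: "(real \<Rightarrow> real) \<Rightarrow> bool" where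
  "smooth g \<longleftrightarrow> (\<forall>k. (deriv ^^ k) g differentiable_on UNIV)"

definition convexification :: "(real \<Rightarrow> real) \<Rightarrow> real \<Rightarrow> real set" where
  "convexification f x = convex hull {f x, rlim f x, llim f x}"

definition multigraph :: "(real \<Rightarrow> real set) \<Rightarrow> (real \<times> real) set" where
  "multigraph F = {(x, y). y \<in> F x}"

text \<open>For nonempty \<open>V\<close>, \<open>infdist p V\<close> is the usual distance (Euclidean on \<open>real \<times> real\<close>); the
  convention \<open>infdist p {} = 0\<close> does not matter, as the graphs below are nonempty.\<close>

definition nbhd :: "(real \<times> real) set \<Rightarrow> real \<Rightarrow> (real \<times> real) set" where
  "nbhd V r = {p. infdist p V < r}"

definition graph_converges ::
  "(nat \<Rightarrow> real \<Rightarrow> real) \<Rightarrow> (real \<Rightarrow> real) \<Rightarrow> bool" where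
  "graph_converges fn f \<longleftrightarrow>
     (\<forall>\<epsilon>>0. \<forall>N>0. \<forall>\<^sub>F n in sequentially.
        (\<lambda>x. (x, fn n x)) ` {-N..N} \<subseteq> nbhd (multigraph (convexification f)) \<epsilon>)"

end

theory Submission
  imports Defs
begin

text \<open>The semigroup law makes every orbit monotone: it moves strictly in one direction until it
  stalls, because a return to an earlier position would create arbitrarily small periods. Averages of
  \<open>f\<close> along orbits are difference quotients of orbits, so a field whose values are such quotients is
  automatically close to the graph of the convexification of \<open>f\<close>.

  An orbit is therefore smoothed in time: interpolating its difference quotients gives a smooth
  diffeomorphism \<open>q\<close> of the line, uniformly close to the orbit for all times, and \<open>q' \<circ> q\<inverse>\<close> is a
  smooth field that follows the orbit. It is cut off just before the end point of the orbit and just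
  behind its starting point. Finitely many disjoint orbits, extended by the zero field, give
  \<open>f\<^sub>n\<close>; the zero value is allowed wherever the chosen orbits leave a gap, because near a stationary
  point, near the limit of an orbit, or between opposite motions, \<open>f\<close> takes values of both signs up to
  a small error. The starting points are taken from the rationals and from the countably many
  points that move but are not reached from any other point.\<close>

section \<open>Smooth functions of one variable\<close>

text \<open>Convolving f in space would fail twice: among several Caratheodory solutions it need not
  single out the one that S selects, and small errors in the field accumulate as t grows. Following
  S itself removes the first defect; the second disappears because increments of the smoothed curve
  telescope. S need not be continuous in the starting point, so no uniformity in x0 is sought. The
  delicate case is a stationary x0: the cutoff behind a source covers a short interval and may drag
  x0 along. In the limit this is harmless, since given any length, all sources close enough to a
  stationary point have orbits no longer than that. The cutoffs also cost accuracy in the graph, as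
  there the field is only a fraction k v of an admissible value v. Either 0 is admissible at y, and
  then k v is too; or all points around y move the same way, and then a chosen orbit passes y uncut,
  with some distance still to go. Only rightward motion is studied directly: -S_t(-x) is a flow of
  the same kind for the field -f(-x).\<close>

primrec ck :: "nat \<Rightarrow> (real \<Rightarrow> real) \<Rightarrow> bool" where
  "ck 0 g \<longleftrightarrow> continuous_on UNIV g"
| "ck (Suc k) g \<longleftrightarrow> (\<exists>g'. (\<forall>x. (g has_real_derivative g' x) (at x)) \<and> ck k g')"

lemma ck_SucI:
  assumes "\<And>x. (g has_real_derivative g' x) (at x)" and "ck k g'"
  shows "ck (Suc k) g"
  using assms by auto

lemma ck_Suc_imp: "ck (Suc k) g \<Longrightarrow> ck k g"
proof (induction k arbitrary: g)
  case 0
  then obtain g' where "\<And>x. (g has_real_derivative g' x) (at x)" by auto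
  then have "isCont g x" for x by (rule DERIV_isCont)
  then show ?case by (simp add: continuous_at_imp_continuous_on)
next
  case (Suc k)
  then show ?case by (metis ck.simps(2))
qed

lemma ck_const [simp]: "ck k (\<lambda>_. c)"
proof (induction k arbitrary: c)
  case (Suc k)
  show ?case by (rule ck_SucI[where g' = "\<lambda>_. 0"]) (simp_all del: ck.simps add: Suc)
qed simp

lemma ck_ident: "ck k (\<lambda>x. x)"
proof (cases k)
  case (Suc m)
  show ?thesis unfolding Suc
    by (rule ck_SucI[OF DERIV_ident ck_const])
qed simp

lemma ck_add: "ck k g \<Longrightarrow> ck k h \<Longrightarrow> ck k (\<lambda>x. g x + h x)"
proof (induction k arbitrary: g h)
  case 0
  then show ?case by (auto intro!: continuous_on_add continuous_on_mult continuous_on_inverse)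
next
  case (Suc k)
  then obtain g' h' where *: "\<And>x. (g has_real_derivative g' x) (at x)" "ck k g'"
    "\<And>x. (h has_real_derivative h' x) (at x)" "ck k h'" by auto
  show ?case
    by (rule ck_SucI[OF DERIV_add[OF *(1,3)] Suc.IH[OF *(2,4)]])
qed

lemma ck_mult: "ck k g \<Longrightarrow> ck k h \<Longrightarrow> ck k (\<lambda>x. g x * h x)"
proof (induction k arbitrary: g h)
  case 0
  then show ?case by (auto intro!: continuous_on_add continuous_on_mult continuous_on_inverse)
next
  case (Suc k)
  then obtain g' h' where *: "\<And>x. (g has_real_derivative g' x) (at x)" "ck k g'"
    "\<And>x. (h has_real_derivative h' x) (at x)" "ck k h'" by auto
  show ?case
  proof (rule ck_SucI[where g' = "\<lambda>x. g' x * h x + h' x * g x"])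
    show "((\<lambda>x. g x * h x) has_real_derivative g' x * h x + h' x * g x) (at x)" for x
      by (rule DERIV_mult[OF *(1,3)])
    show "ck k (\<lambda>x. g' x * h x + h' x * g x)"
      by (intro ck_add Suc.IH * Suc.prems[THEN ck_Suc_imp])
  qed
qed

lemma ck_compose: "ck k g \<Longrightarrow> ck k h \<Longrightarrow> ck k (\<lambda>x. g (h x))"
proof (induction k arbitrary: g h)
  case 0
  then show ?case using continuous_on_compose2[of UNIV g UNIV h] by simp
next
  case (Suc k)
  then obtain g' h' where *: "\<And>x. (g has_real_derivative g' x) (at x)" "ck k g'"
    "\<And>x. (h has_real_derivative h' x) (at x)" "ck k h'" by auto
  show ?case
  proof (rule ck_SucI[where g' = "\<lambda>x. g' (h x) * h' x"])
    show "((\<lambda>x. g (h x)) has_real_derivative g' (h x) * h' x) (at x)" for x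
      by (rule DERIV_chain2[OF *(1,3)])
    show "ck k (\<lambda>x. g' (h x) * h' x)"
      by (rule ck_mult[OF Suc.IH[OF *(2) ck_Suc_imp[OF Suc.prems(2)]] *(4)])
  qed
qed

lemma ck_inverse: "ck k g \<Longrightarrow> (\<And>x. g x \<noteq> 0) \<Longrightarrow> ck k (\<lambda>x. inverse (g x))"
proof (induction k arbitrary: g)
  case 0
  then show ?case by (auto intro!: continuous_on_add continuous_on_mult continuous_on_inverse)
next
  case (Suc k)
  then obtain g' where *: "\<And>x. (g has_real_derivative g' x) (at x)" "ck k g'" by auto
  have k: "ck k (\<lambda>x. inverse (g x))"
    by (rule Suc.IH[OF ck_Suc_imp[OF Suc.prems(1)] Suc.prems(2)])
  show ?case
  proof (rule ck_SucI[where g' = "\<lambda>x. (-1) * (g' x * (inverse (g x) * inverse (g x)))"])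
    show "((\<lambda>x. inverse (g x)) has_real_derivative
        (-1) * (g' x * (inverse (g x) * inverse (g x)))) (at x)" for x
      using DERIV_inverse_fun[OF *(1) Suc.prems(2)] by (simp add: power2_eq_square mult_ac)
    show "ck k (\<lambda>x. (-1) * (g' x * (inverse (g x) * inverse (g x))))"
      by (intro ck_mult k *(2) ck_const)
  qed
qed

text \<open>The derivative of the inverse is \<open>inverse (G (Q x))\<close>, so each order of
  smoothness already known for \<open>Q\<close> yields the next one.\<close>

lemma ck_inv_fun:
  assumes q: "\<And>x. (q has_real_derivative G x) (at x)" and G: "\<And>x. G x > 0" "ck k G"
    and Q: "\<And>y. q (Q y) = y" "\<And>x. Q (q x) = x" "continuous_on UNIV Q"
  shows "ck k Q"
  using G(2)
proof (induction k)
  case 0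
  then show ?case using Q by auto
next
  case (Suc k)
  have k: "ck k Q" by (rule Suc.IH[OF ck_Suc_imp[OF Suc.prems]])
  show ?case
  proof (rule ck_SucI[where g' = "\<lambda>x. inverse (G (Q x))"])
    show "(Q has_real_derivative inverse (G (Q x))) (at x)" for x
    proof (rule has_field_derivative_inverse_basic[where f = q and t = UNIV])
      show "(q has_real_derivative G (Q x)) (at (Q x))" by (rule q)
      show "G (Q x) \<noteq> 0" using G(1)[of "Q x"] by simp
      show "isCont Q x" using Q(3) by (simp add: continuous_on_eq_continuous_at)
    qed (use Q in auto)
    show "ck k (\<lambda>x. inverse (G (Q x)))"
      by (rule ck_inverse[OF ck_compose[OF ck_Suc_imp[OF Suc.prems] k]
            less_imp_neq[OF G(1), symmetric]])
  qed
qed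

lemma ck_local:
  assumes "\<And>x. \<exists>h. ck k h \<and> (\<forall>\<^sub>F y in nhds x. g y = h y)"
  shows "ck k g"
  using assms
proof (induction k arbitrary: g)
  case 0
  have "isCont g x" for x
  proof -
    obtain h where h: "ck 0 h" "\<forall>\<^sub>F y in nhds x. g y = h y" using 0 by blast
    then show "isCont g x" using isCont_cong[OF h(2)]
      by (auto simp: continuous_on_eq_continuous_at)
  qed
  then show ?case by (simp add: continuous_at_imp_continuous_on)
next
  case (Suc k)
  have *: "\<exists>h h'. (\<forall>x. (h has_real_derivative h' x) (at x)) \<and> ck k h' \<and>
      (\<forall>\<^sub>F y in nhds x. g y = h y)" for x
    using Suc.prems[of x] by auto
  have D: "\<exists>h'. ck k h' \<and> (\<forall>\<^sub>F y in nhds x. (g has_real_derivative h' y) (at y))" for x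
  proof -
    obtain h h' where h: "\<And>x. (h has_real_derivative h' x) (at x)" "ck k h'"
      "\<forall>\<^sub>F y in nhds x. g y = h y" using * by blast
    have "\<forall>\<^sub>F z in nhds x. \<forall>\<^sub>F y in nhds z. g y = h y" using h(3) by (simp add: eventually_eventually)
    then have "\<forall>\<^sub>F z in nhds x. (g has_real_derivative h' z) (at z)"
    proof eventually_elim
      case (elim z)
      then show ?case using h(1)[of z] DERIV_cong_ev[of z z g h "h' z" "h' z"] by auto
    qed
    then show ?thesis using h by blast
  qed
  show ?case
  proof (rule ck_SucI[where g' = "deriv g"])
    show "(g has_real_derivative deriv g x) (at x)" for x
      using D[of x] by (metis DERIV_deriv_iff_has_field_derivative eventually_nhds_x_imp_x)
    show "ck k (deriv g)"
    proof (rule Suc.IH)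
      fix x
      obtain h' where h: "ck k h'" "\<forall>\<^sub>F y in nhds x. (g has_real_derivative h' y) (at y)"
        using D by blast
      from h(2) have "\<forall>\<^sub>F y in nhds x. deriv g y = h' y"
        by eventually_elim (rule DERIV_imp_deriv)
      with h show "\<exists>h. ck k h \<and> (\<forall>\<^sub>F y in nhds x. deriv g y = h y)" by blast
    qed
  qed
qed

text \<open>\<open>smooth\<close> iterates \<open>deriv\<close>, which is awkward under products and
  compositions. \<open>ck\<close> asserts the existence of successive derivatives instead, so
  closure properties become inductions on the order; \<open>cinf_imp_smooth\<close> translates
  back.\<close>

definition cinf :: "(real \<Rightarrow> real) \<Rightarrow> bool" where
  "cinf g \<longleftrightarrow> (\<forall>k. ck k g)"

lemma cinf_imp_smooth: "cinf g \<Longrightarrow> smooth g"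
proof -
  have "ck (Suc k) g \<Longrightarrow> (deriv ^^ k) g differentiable_on UNIV" for k
  proof (induction k arbitrary: g)
    case 0
    then show ?case
      by (auto simp: differentiable_on_def real_differentiable_def)
  next
    case (Suc k)
    then obtain g' where g': "\<And>x. (g has_real_derivative g' x) (at x)" "ck (Suc k) g'"
      by (meson ck.simps(2))
    then have "deriv g = g'" by (auto intro: DERIV_imp_deriv)
    then show ?case using Suc.IH[OF g'(2)] by (simp add: funpow_swap1)
  qed
  then show "cinf g \<Longrightarrow> smooth g" by (auto simp: cinf_def smooth_def)
qed

lemma cinf_const [simp]: "cinf (\<lambda>_. c)"
  and cinf_ident: "cinf (\<lambda>x. x)"
  and cinf_add: "cinf g \<Longrightarrow> cinf h \<Longrightarrow> cinf (\<lambda>x. g x + h x)"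
  and cinf_mult: "cinf g \<Longrightarrow> cinf h \<Longrightarrow> cinf (\<lambda>x. g x * h x)"
  and cinf_compose: "cinf g \<Longrightarrow> cinf h \<Longrightarrow> cinf (\<lambda>x. g (h x))"
  and cinf_inverse: "cinf g \<Longrightarrow> (\<And>x. g x \<noteq> 0) \<Longrightarrow> cinf (\<lambda>x. inverse (g x))"
  by (simp_all add: cinf_def ck_ident ck_add ck_mult ck_compose ck_inverse)

lemma cinf_affine: "cinf (\<lambda>x. a + b * x)"
  by (intro cinf_add cinf_mult cinf_const cinf_ident)

lemma cinf_sum: "(\<And>i. i \<in> I \<Longrightarrow> cinf (g i)) \<Longrightarrow> cinf (\<lambda>x. \<Sum>i\<in>I. g i x)"
  by (induction I rule: infinite_finite_induct) (auto intro: cinf_add)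

lemma cinf_continuous: "cinf g \<Longrightarrow> continuous_on A g"
  unfolding cinf_def by (metis continuous_on_subset ck.simps(1) subset_UNIV)

lemma cinf_C1:
  assumes "cinf g"
  obtains g' where "\<And>x. (g has_real_derivative g' x) (at x)" "continuous_on UNIV g'"
proof -
  have "ck (Suc 0) g" using assms by (simp add: cinf_def)
  then show ?thesis using that by auto
qed

lemma cinf_local:
  assumes "\<And>x. \<exists>h. cinf h \<and> (\<forall>\<^sub>F y in nhds x. g y = h y)"
  shows "cinf g"
  unfolding cinf_def
proof
  show "ck k g" for k
    by (rule ck_local) (use assms in \<open>auto simp: cinf_def\<close>)
qed

section \<open>A smooth step function built from exp (-1/x)\<close>

definition flat :: "nat \<Rightarrow> real \<Rightarrow> real" where
  "flat m x = (if x > 0 then inverse x ^ m * exp (- inverse x) else 0)"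

lemma flat_lim: "((\<lambda>x. flat m x) \<longlongrightarrow> 0) (at 0)"
proof -
  have r: "((\<lambda>x. flat m x) \<longlongrightarrow> 0) (at_right 0)"
  proof -
    have "((\<lambda>y::real. y ^ m / exp y) \<longlongrightarrow> 0) at_top" by (rule tendsto_power_div_exp_0)
    then have "((\<lambda>x::real. inverse x ^ m / exp (inverse x)) \<longlongrightarrow> 0) (at_right 0)"
      by (rule filterlim_compose[OF _ filterlim_inverse_at_top_right])
    then show ?thesis
      by (rule tendsto_cong[THEN iffD1, rotated])
        (auto simp: flat_def exp_minus field_simps eventually_at_right_field intro!: exI[of _ 1])
  qed
  have l: "((\<lambda>x. flat m x) \<longlongrightarrow> 0) (at_left 0)"
    by (rule tendsto_eventually) (auto simp: flat_def eventually_at_left_field intro!: exI[of _ "-1"])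
  show ?thesis using l r by (simp add: filterlim_split_at)
qed

text \<open>The powers \<open>inverse x ^ m\<close> are there to close the family under
  differentiation: a derivative combines members with larger \<open>m\<close>, so one induction for
  all \<open>m\<close> at once gives smoothness.\<close>

lemma flat_deriv:
  "(flat m has_real_derivative flat (m + 2) x - real m * flat (m + 1) x) (at x)"
proof -
  consider "x > 0" | "x < 0" | "x = 0" by linarith
  then show ?thesis
  proof cases
    case 1
    have "((\<lambda>x. inverse x ^ m * exp (- inverse x)) has_real_derivative
        flat (m + 2) x - real m * flat (m + 1) x) (at x)"
    proof -
      have "((\<lambda>x. inverse x ^ m * exp (- inverse x)) has_real_derivative
          inverse x ^ m * (exp (- inverse x) * inverse x ^ 2) +
          real m * (- (inverse x ^ 2)) * inverse x ^ (m - 1) * exp (- inverse x)) (at x)"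
        using 1 by (auto intro!: derivative_eq_intros simp: power2_eq_square)
      also have "inverse x ^ m * (exp (- inverse x) * inverse x ^ 2) +
          real m * (- (inverse x ^ 2)) * inverse x ^ (m - 1) * exp (- inverse x) =
          flat (m + 2) x - real m * flat (m + 1) x"
        using 1 by (cases m) (simp_all add: flat_def power2_eq_square algebra_simps)
      finally show ?thesis .
    qed
    then show ?thesis
    proof (rule has_field_derivative_transform_within_open[where S = "{0<..}"])
    qed (use 1 in \<open>auto simp: flat_def\<close>)
  next
    case 2
    have "((\<lambda>_. 0) has_real_derivative flat (m + 2) x - real m * flat (m + 1) x) (at x)"
      using 2 by (simp add: flat_def)
    then show ?thesis
    proof (rule has_field_derivative_transform_within_open[where S = "{..<0}"])
    qed (use 2 in \<open>auto simp: flat_def\<close>)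
  next
    case 3
    have "((\<lambda>h. (flat m (0 + h) - flat m 0) / h) \<longlongrightarrow> 0) (at 0)"
      using flat_lim[of "Suc m"]
      by (rule tendsto_cong[THEN iffD1, rotated])
        (auto simp: flat_def field_simps eventually_at intro!: exI[of _ 1])
    then show ?thesis using 3 by (simp add: DERIV_def flat_def)
  qed
qed

lemma cinf_flat: "cinf (flat m)"
proof -
  have "ck k (flat m)" for k
  proof (induction k arbitrary: m)
    case 0
    show ?case
      by (simp add: continuous_at_imp_continuous_on DERIV_isCont[OF flat_deriv])
  next
    case (Suc k)
    have "ck k (\<lambda>x. flat (m + 2) x + (- real m) * flat (m + 1) x)"
      by (intro ck_add ck_mult ck_const Suc)
    then show ?case
      by (intro ck_SucI[where g' = "\<lambda>x. flat (m + 2) x - real m * flat (m + 1) x"] flat_deriv)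
        simp
  qed
  then show ?thesis by (simp add: cinf_def)
qed

text \<open>The standard smooth transition from 0 to 1 on [0,1]. The reflected argument is written
  \<open>1 + (-1) * x\<close> to match \<open>cinf_affine\<close>.\<close>

definition step :: "real \<Rightarrow> real" where
  "step x = flat 0 x * inverse (flat 0 x + flat 0 (1 + (-1) * x))"

lemma step_denom: "flat 0 x + flat 0 (1 + (-1) * x) > 0"
  by (auto simp: flat_def add_pos_nonneg)

lemma cinf_step: "cinf step"
proof -
  have "cinf (\<lambda>x. flat 0 x * inverse (flat 0 x + flat 0 (1 + (-1) * x)))"
    by (rule cinf_mult[OF cinf_flat cinf_inverse[OF cinf_add[OF cinf_flat cinf_compose[OF cinf_flat cinf_affine]]
            less_imp_neq[OF step_denom, symmetric]]])
  then show ?thesis by (simp add: step_def[abs_def])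
qed

lemma step_0: "x \<le> 0 \<Longrightarrow> step x = 0"
  and step_1: "x \<ge> 1 \<Longrightarrow> step x = 1"
  and step_ge_0: "0 \<le> step x"
  and step_le_1: "step x \<le> 1"
  using step_denom[of x] by (auto simp: step_def flat_def field_simps)

text \<open>The derivative is bounded on the compact [0,1]. Outside, the function is constant, so
  arguments may be clamped to [0,1], which does not increase their distance.\<close>

lemma step_lipschitz: "\<exists>L\<ge>0. \<forall>x y. \<bar>step x - step y\<bar> \<le> L * \<bar>x - y\<bar>"
proof -
  obtain g' where g': "\<And>x. (step has_real_derivative g' x) (at x)" "continuous_on UNIV g'"
    using cinf_C1[OF cinf_step] by blast
  have "compact (g' ` {0..1})"
    by (rule compact_continuous_image[OF continuous_on_subset[OF g'(2)]]) auto
  then obtain L where L: "\<And>x. x \<in> {0..1} \<Longrightarrow> norm (g' x) \<le> L"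
    by (meson compact_imp_bounded bounded_iff imageI)
  have L0: "L \<ge> 0" using L[of 0] by force
  have *: "norm (step x - step y) \<le> L * norm (x - y)" if "x \<in> {0..1}" "y \<in> {0..1}" for x y
    by (rule field_differentiable_bound[where S = "{0..1}" and f' = g'])
      (use that L g'(1) in \<open>auto intro: has_field_derivative_at_within\<close>)
  define c where "c x = max 0 (min 1 x)" for x :: real
  have c: "step (c x) = step x" "c x \<in> {0..1}" for x
    by (auto simp: c_def max_def min_def step_0 step_1)
  have "\<bar>step x - step y\<bar> \<le> L * \<bar>x - y\<bar>" for x y
  proof -
    have "\<bar>step x - step y\<bar> \<le> L * \<bar>c x - c y\<bar>"
      using *[OF c(2) c(2), of x y] by (simp add: c(1))
    also have "\<dots> \<le> L * \<bar>x - y\<bar>"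
      by (intro mult_left_mono L0) (auto simp: c_def max_def min_def)
    finally show ?thesis .
  qed
  then show ?thesis using L0 by blast
qed

section \<open>Solutions in the sense of Caratheodory\<close>

lemma caratheodory_integrable:
  assumes "caratheodory_solution f x0 x" "0 \<le> s" "s \<le> t"
  shows "(\<lambda>u. f (x u)) integrable_on {s..t}"
    and "x t - x s = integral {s..t} (\<lambda>u. f (x u))"
proof -
  have i: "(\<lambda>u. f (x u)) integrable_on {0..t}" and t: "x t = x0 + integral {0..t} (\<lambda>u. f (x u))"
    and s: "x s = x0 + integral {0..s} (\<lambda>u. f (x u))"
    using assms by (auto simp: caratheodory_solution_def set_lebesgue_integral_eq_integral)
  show "(\<lambda>u. f (x u)) integrable_on {s..t}"
    by (rule integrable_subinterval_real[OF i]) (use assms in auto)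
  show "x t - x s = integral {s..t} (\<lambda>u. f (x u))"
    using Henstock_Kurzweil_Integration.integral_combine[OF assms(2,3) i] t s by simp
qed

lemma caratheodory_0: "caratheodory_solution f x0 x \<Longrightarrow> x 0 = x0"
  unfolding caratheodory_solution_def
  by (drule spec[of _ 0]) (auto simp: set_lebesgue_integral_eq_integral)

lemma caratheodory_continuous: "caratheodory_solution f x0 x \<Longrightarrow> continuous_on {0..T} x"
proof (rule continuous_on_eq)
  assume x: "caratheodory_solution f x0 x"
  show "x0 + integral {0..t} (\<lambda>u. f (x u)) = x t" if "t \<in> {0..T}" for t
    using caratheodory_integrable(2)[OF x, of 0 t] caratheodory_0[OF x] that by auto
  show "continuous_on {0..T} (\<lambda>t. x0 + integral {0..t} (\<lambda>u. f (x u)))"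
  proof (cases "0 \<le> T")
    case True
    then show ?thesis
      by (intro continuous_intros indefinite_integral_continuous_1 caratheodory_integrable(1)[OF x]) auto
  qed auto
qed

lemma caratheodory_lipschitz:
  assumes "caratheodory_solution f x0 x" "\<And>y. \<bar>f y\<bar> \<le> M" "0 \<le> s" "s \<le> t"
  shows "\<bar>x t - x s\<bar> \<le> M * (t - s)"
proof -
  have "norm (integral {s..t} (\<lambda>u. f (x u))) \<le> integral {s..t} (\<lambda>_. M)"
    by (rule integral_norm_bound_integral[OF caratheodory_integrable(1)[OF assms(1,3,4)]])
      (use assms(2) in auto)
  then show ?thesis
    using caratheodory_integrable(2)[OF assms(1,3,4)] assms(4) by (simp add: mult.commute)
qed

text \<open>A substitute for the mean value theorem: the velocity \<open>f (x u)\<close> may be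
  discontinuous, so the average speed is only trapped between two samples of it. Because of the
  slack \<open>e\<close>, a failure contradicts the value of the integral at once.\<close>

lemma caratheodory_average:
  assumes x: "caratheodory_solution f x0 x" and st: "0 \<le> s" "s < t" and "0 < e"
  shows "\<exists>u\<in>{s..t}. f (x u) - e \<le> (x t - x s) / (t - s)"
    and "\<exists>u\<in>{s..t}. (x t - x s) / (t - s) \<le> f (x u) + e"
proof -
  note i = caratheodory_integrable[OF x st(1) less_imp_le[OF st(2)]]
  define a where "a = (x t - x s) / (t - s)"
  have a: "x t - x s = a * (t - s)" using st by (simp add: a_def)
  show "\<exists>u\<in>{s..t}. f (x u) - e \<le> (x t - x s) / (t - s)"
  proof (rule ccontr)
    assume "\<not> ?thesis"
    then have "\<And>u. u \<in> {s..t} \<Longrightarrow> a + e \<le> f (x u)" by (force simp: a_def)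
    then have "integral {s..t} (\<lambda>_. a + e) \<le> integral {s..t} (\<lambda>u. f (x u))"
      by (intro integral_le i) auto
    then have "(a + e) * (t - s) \<le> a * (t - s)"
      using i(2) a st by (simp add: mult.commute)
    then show False using st \<open>0 < e\<close> by simp
  qed
  show "\<exists>u\<in>{s..t}. (x t - x s) / (t - s) \<le> f (x u) + e"
  proof (rule ccontr)
    assume "\<not> ?thesis"
    then have "\<And>u. u \<in> {s..t} \<Longrightarrow> f (x u) \<le> a - e" by (force simp: a_def)
    then have "integral {s..t} (\<lambda>u. f (x u)) \<le> integral {s..t} (\<lambda>_. a - e)"
      by (intro integral_le i) auto
    then have "a * (t - s) \<le> (a - e) * (t - s)"
      using i(2) a st by (simp add: mult.commute)
    then show False using st \<open>0 < e\<close> by simp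
  qed
qed

lemma caratheodory_of_deriv:
  assumes "\<And>t. t \<ge> 0 \<Longrightarrow> (x has_real_derivative g (x t)) (at t within {0..})"
    and "continuous_on UNIV g"
  shows "caratheodory_solution g (x 0) x"
  unfolding caratheodory_solution_def
proof (intro allI impI conjI)
  fix t :: real assume t: "0 \<le> t"
  have d: "(x has_real_derivative g (x s)) (at s within {0..t})" if "s \<in> {0..t}" for s
    by (rule has_field_derivative_subset[OF assms(1)]) (use that in auto)
  have "continuous_on {0..t} x"
    using d by (meson DERIV_continuous continuous_on_eq_continuous_within)
  then have c: "continuous_on {0..t} (\<lambda>s. g (x s))"
    by (intro continuous_on_compose2[OF assms(2)]) auto
  show i: "set_integrable lebesgue {0..t} (\<lambda>s. g (x s))"
    by (rule absolutely_integrable_continuous_real[OF c])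
  have "((\<lambda>s. g (x s)) has_integral x t - x 0) {0..t}"
    by (rule fundamental_theorem_of_calculus[OF t])
      (use d in \<open>simp add: has_real_derivative_iff_has_vector_derivative\<close>)
  then show "x t = x 0 + (LINT s:{0..t}|lebesgue. g (x s))"
    by (simp add: set_lebesgue_integral_eq_integral[OF i] integral_unique)
qed

lemma caratheodory_const: "g x0 = 0 \<Longrightarrow> caratheodory_solution g x0 (\<lambda>_. x0)"
  by (auto simp: caratheodory_solution_def set_integrable_def)

lemma caratheodory_cong:
  assumes "caratheodory_solution g x0 x" "\<And>t. t \<ge> 0 \<Longrightarrow> h (x t) = g (x t)"
  shows "caratheodory_solution h x0 x"
  unfolding caratheodory_solution_def
proof (intro allI impI conjI)
  fix t :: real assume t: "0 \<le> t"
  have *: "indicator {0..t} s *\<^sub>R h (x s) = indicator {0..t} s *\<^sub>R g (x s)" for s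
    using assms(2) by (auto simp: indicator_def)
  have "set_integrable lebesgue {0..t} (\<lambda>s. g (x s))"
    "x t = x0 + (LINT s:{0..t}|lebesgue. g (x s))"
    using assms(1) t by (auto simp: caratheodory_solution_def)
  then show "set_integrable lebesgue {0..t} (\<lambda>s. h (x s))"
    "x t = x0 + (LINT s:{0..t}|lebesgue. h (x s))"
    unfolding set_integrable_def set_lebesgue_integral_def * .
qed

text \<open>The integral of \<open>d\<close>, weighted by exp (-L t), is nonincreasing and starts at
  0.\<close>

lemma gronwall_zero:
  fixes d :: "real \<Rightarrow> real"
  assumes c: "continuous_on {0..T} d" and d0: "\<And>t. t \<in> {0..T} \<Longrightarrow> 0 \<le> d t"
    and le: "\<And>t. t \<in> {0..T} \<Longrightarrow> d t \<le> L * integral {0..t} d"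
    and L: "0 \<le> L" and t: "t \<in> {0..T}"
  shows "d t = 0"
proof -
  define W where "W t = exp (- L * t) * integral {0..t} d" for t
  have "W t \<le> W 0"
  proof (rule DERIV_nonpos_imp_decreasing_open[of 0 t W])
    show "0 \<le> t" using t by simp
    show "\<exists>y. (W has_real_derivative y) (at s) \<and> y \<le> 0" if s: "0 < s" "s < t" for s
    proof -
      have "((\<lambda>u. integral {0..u} d) has_real_derivative d s) (at s within {0..T})"
        by (rule integral_has_real_derivative[OF c]) (use s t in auto)
      then have "((\<lambda>u. integral {0..u} d) has_real_derivative d s) (at s)"
        using s t by (simp add: at_within_Icc_at)
      then have "(W has_real_derivative (- L * exp (- L * s)) * integral {0..s} d
          + d s * exp (- L * s)) (at s)"
        unfolding W_def by (auto intro!: derivative_eq_intros)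
      moreover have "(- L * exp (- L * s)) * integral {0..s} d + d s * exp (- L * s)
          = exp (- L * s) * (d s - L * integral {0..s} d)" by (simp add: algebra_simps)
      moreover have "\<dots> \<le> 0" using le[of s] s t by (simp add: mult_nonneg_nonpos)
      ultimately show ?thesis by metis
    qed
    show "continuous_on {0..t} W" unfolding W_def
      by (intro continuous_intros indefinite_integral_continuous_1 integrable_continuous_real
          continuous_on_subset[OF c]) (use t in auto)
  qed
  then have "integral {0..t} d \<le> 0" by (simp add: W_def mult_le_0_iff)
  then have "d t \<le> 0" using le[OF t] L by (meson mult_nonneg_nonpos order_trans)
  then show ?thesis using d0[OF t] by simp
qed

text \<open>A smooth field is only locally Lipschitz, but up to time T both trajectories stay in a
  compact interval [-R, R], on which the derivative of g is bounded.\<close>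

lemma caratheodory_unique:
  assumes g: "cinf g" and x: "caratheodory_solution g x0 x" and y: "caratheodory_solution g x0 y"
    and T: "0 \<le> T"
  shows "x T = y T"
proof -
  obtain g' where g': "\<And>x. (g has_real_derivative g' x) (at x)" "continuous_on UNIV g'"
    using cinf_C1[OF g] by blast
  have cx: "continuous_on {0..T} x" and cy: "continuous_on {0..T} y"
    using x y by (auto intro: caratheodory_continuous)
  have "bounded (x ` {0..T} \<union> y ` {0..T})"
    using compact_continuous_image[OF cx] compact_continuous_image[OF cy]
    by (simp add: compact_imp_bounded)
  then obtain R where R: "\<And>z. z \<in> x ` {0..T} \<union> y ` {0..T} \<Longrightarrow> norm z \<le> R"
    by (auto simp: bounded_iff)
  have "compact (g' ` {-R..R})"
    by (rule compact_continuous_image[OF continuous_on_subset[OF g'(2)]]) auto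
  then obtain L where L: "\<And>z. z \<in> {-R..R} \<Longrightarrow> norm (g' z) \<le> L"
    by (meson compact_imp_bounded bounded_iff imageI)
  have lip: "norm (g a - g b) \<le> L * norm (a - b)" if "a \<in> {-R..R}" "b \<in> {-R..R}" for a b
    by (rule field_differentiable_bound[where S = "{-R..R}" and f' = g'])
      (use that L g'(1) in \<open>auto intro: has_field_derivative_at_within\<close>)
  have "x 0 \<in> {-R..R}" using R[of "x 0"] T by (auto simp: abs_le_iff)
  then have L0: "0 \<le> L" using L[of "x 0"] norm_ge_zero order_trans by blast
  define d where "d t = \<bar>x t - y t\<bar>" for t
  have "d T = 0"
  proof (rule gronwall_zero[where d = d and T = T and L = L])
    show cd: "continuous_on {0..T} d" unfolding d_def by (intro continuous_intros cx cy)
    show "d t \<le> L * integral {0..t} d" if t: "t \<in> {0..T}" for t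
    proof -
      have t0: "0 \<le> t" using t by simp
      note ix = caratheodory_integrable[OF x order_refl t0] and iy = caratheodory_integrable[OF y order_refl t0]
      have "x t - y t = integral {0..t} (\<lambda>u. g (x u) - g (y u))"
        using ix iy caratheodory_0[OF x] caratheodory_0[OF y] by (simp add: Henstock_Kurzweil_Integration.integral_diff)
      moreover have "norm (integral {0..t} (\<lambda>u. g (x u) - g (y u)))
          \<le> integral {0..t} (\<lambda>u. L * d u)"
      proof (rule integral_norm_bound_integral)
        show "(\<lambda>u. g (x u) - g (y u)) integrable_on {0..t}"
          by (intro Henstock_Kurzweil_Integration.integrable_diff ix iy)
        show "(\<lambda>u. L * d u) integrable_on {0..t}"
          by (intro integrable_continuous_real continuous_intros continuous_on_subset[OF cd])
            (use t in auto)
        fix u assume "u \<in> {0..t}"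
        then have "norm (x u) \<le> R" "norm (y u) \<le> R" using R t by auto
        then show "norm (g (x u) - g (y u)) \<le> L * d u"
          using lip[of "x u" "y u"] by (auto simp: d_def abs_le_iff)
      qed
      ultimately show ?thesis by (simp add: d_def[abs_def])
    qed
  qed (use T L0 in \<open>auto simp: d_def\<close>)
  then show ?thesis by (simp add: d_def)
qed

lemma antiderivative:
  fixes h :: "real \<Rightarrow> real"
  assumes "continuous_on UNIV h"
  obtains F where "F 0 = c" "\<And>x. (F has_real_derivative h x) (at x)"
proof -
  have "\<exists>F. \<forall>x::real. -\<infinity> < ereal x \<longrightarrow> ereal x < \<infinity> \<longrightarrow> (F has_vector_derivative h x) (at x)"
    by (rule einterval_antiderivative)
      (use assms in \<open>auto simp: continuous_on_eq_continuous_at\<close>)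
  then obtain F where F: "\<And>x. (F has_vector_derivative h x) (at x)" by auto
  show ?thesis
    by (rule that[of "\<lambda>x. F x - F 0 + c"])
      (use F in \<open>auto simp: has_real_derivative_iff_has_vector_derivative
        intro!: derivative_eq_intros\<close>)
qed

lemma deriv_bound_diff:
  fixes F H :: "real \<Rightarrow> real"
  assumes "\<And>x. x \<ge> 0 \<Longrightarrow> (F has_real_derivative F' x) (at x)"
    and "\<And>x. x \<ge> 0 \<Longrightarrow> (H has_real_derivative H' x) (at x)"
    and "\<And>x. x \<ge> 0 \<Longrightarrow> \<bar>F' x\<bar> \<le> H' x" and "t \<ge> 0"
  shows "\<bar>F t - F 0\<bar> \<le> H t - H 0"
proof -
  have "H 0 - F 0 \<le> H t - F t"
  proof (rule DERIV_nonneg_imp_nondecreasing[OF assms(4)])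
    fix x :: real assume x: "0 \<le> x" "x \<le> t"
    then have "0 \<le> H' x - F' x" using assms(3)[of x] by (auto simp: abs_le_iff)
    with x show "\<exists>y. ((\<lambda>a. H a - F a) has_real_derivative y) (at x) \<and> 0 \<le> y"
      using DERIV_diff[OF assms(2)[of x] assms(1)[of x]] by blast
  qed
  moreover have "H 0 + F 0 \<le> H t + F t"
  proof (rule DERIV_nonneg_imp_nondecreasing[OF assms(4)])
    fix x :: real assume x: "0 \<le> x" "x \<le> t"
    then have "0 \<le> H' x + F' x" using assms(3)[of x] by (auto simp: abs_le_iff)
    with x show "\<exists>y. ((\<lambda>a. H a + F a) has_real_derivative y) (at x) \<and> 0 \<le> y"
      using DERIV_add[OF assms(2)[of x] assms(1)[of x]] by blast
  qed
  ultimately show ?thesis by (simp add: abs_le_iff)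
qed

text \<open>Picard iteration on the whole half line at once: the weight \<open>exp (2 L t)\<close> turns the
  integral operator into a contraction.\<close>

lemma picard:
  fixes k :: "real \<Rightarrow> real"
  assumes lip: "\<And>x y. \<bar>k x - k y\<bar> \<le> L * \<bar>x - y\<bar>" and L: "L > 0" and B: "\<And>x. \<bar>k x\<bar> \<le> B"
  shows "\<exists>\<theta>. \<theta> 0 = a \<and> (\<forall>t\<ge>0. (\<theta> has_real_derivative k (\<theta> t)) (at t within {0..}))"
proof -
  have ck: "continuous_on UNIV k"
    by (rule lipschitz_on_continuous_on[of L]) (use lip L in \<open>auto simp: lipschitz_on_def dist_real_def\<close>)
  \<comment> \<open>The unknown w stands for exp (-2 L t) times the solution. A solution grows at
    most linearly, so with this weight it becomes a bounded continuous function.\<close>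
  define h where "h w s = k (exp (2 * L * s) * apply_bcontfun w s)" for w :: "real \<Rightarrow>\<^sub>C real" and s
  have ch: "continuous_on UNIV (h w)" for w unfolding h_def
    by (rule continuous_on_compose2[OF ck]) (auto intro!: continuous_intros)
  define F where "F w = (SOME F. F 0 = a \<and> (\<forall>x. (F has_real_derivative h w x) (at x)))" for w
  have F: "F w 0 = a" "(F w has_real_derivative h w x) (at x)" for w x
  proof -
    have "\<exists>F. F 0 = a \<and> (\<forall>x. (F has_real_derivative h w x) (at x))"
      using antiderivative[OF ch] by metis
    from someI_ex[OF this] show "F w 0 = a" "(F w has_real_derivative h w x) (at x)"
      unfolding F_def by auto
  qed
  have B0: "B \<ge> 0" using B[of 0] by linarith
  have Fb: "\<bar>F w t\<bar> \<le> \<bar>a\<bar> + B * t" if "t \<ge> 0" for w t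
  proof -
    have "\<bar>F w t - F w 0\<bar> \<le> B * t - B * 0"
      by (rule deriv_bound_diff[where F' = "h w" and H' = "\<lambda>_. B" and H = "\<lambda>t. B * t"])
        (use that F B in \<open>auto simp: h_def intro!: derivative_eq_intros\<close>)
    then show ?thesis using F(1)[of w] by linarith
  qed
  \<comment> \<open>Elements of the function space live on the whole line; negative times are filled
    with the value at 0.\<close>
  define \<Phi> where "\<Phi> w t = exp (- (2 * L * max 0 t)) * F w (max 0 t)" for w t
  have b: "\<Phi> w \<in> bcontfun" for w
  proof (rule bcontfun_normI)
    have "continuous_on UNIV (F w)"
      using F(2) by (meson DERIV_isCont continuous_at_imp_continuous_on)
    then show "continuous_on UNIV (\<Phi> w)" unfolding \<Phi>_def
      by (auto intro!: continuous_on_mult continuous_on_compose2[where g = "F w" and t = UNIV] continuous_intros)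
    fix t :: real
    define s where "s = max 0 t"
    have s: "s \<ge> 0" by (simp add: s_def)
    have "exp (- (2 * L * s)) * \<bar>F w s\<bar> \<le> exp (- (2 * L * s)) * (\<bar>a\<bar> + B * s)"
      using Fb[OF s] by (intro mult_left_mono) auto
    also have "\<dots> = exp (- (2 * L * s)) * \<bar>a\<bar> + B * (s * exp (- (2 * L * s)))"
      by (simp add: algebra_simps)
    also have "\<dots> \<le> 1 * \<bar>a\<bar> + B * (1 / (2 * L))"
    proof (intro add_mono mult_right_mono mult_left_mono B0)
      show "exp (- (2 * L * s)) \<le> 1" using s L by simp
      have "2 * L * s \<le> exp (2 * L * s)" using exp_ge_add_one_self[of "2 * L * s"] by linarith
      then show "s * exp (- (2 * L * s)) \<le> 1 / (2 * L)"
        using L by (simp add: exp_minus field_simps)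
    qed auto
    finally show "norm (\<Phi> w t) \<le> \<bar>a\<bar> + B * (1 / (2 * L))"
      by (simp add: \<Phi>_def s_def abs_mult)
  qed
  have ap: "apply_bcontfun (Bcontfun (\<Phi> w)) = \<Phi> w" for w
    by (rule Bcontfun_inverse[OF b])
  have "\<forall>v w. dist (Bcontfun (\<Phi> v)) (Bcontfun (\<Phi> w)) \<le> 1 / 2 * dist v w"
  proof (intro allI dist_bound)
    fix v w :: "real \<Rightarrow>\<^sub>C real" and t :: real
    define D where "D = dist v w"
    have D: "\<bar>v s - w s\<bar> \<le> D" for s
      using dist_bounded[of v s w] by (simp add: D_def dist_real_def)
    define s where "s = max 0 t"
    \<comment> \<open>L D exp (2 L x) has the primitive D/2 exp (2 L x): the 2 in the weight is what
      leaves the contraction factor 1/2.\<close>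
    have "\<bar>(F v s - F w s) - (F v 0 - F w 0)\<bar> \<le> D / 2 * exp (2 * L * s) - D / 2 * exp (2 * L * 0)"
    proof (rule deriv_bound_diff[where F' = "\<lambda>s. h v s - h w s"
          and H' = "\<lambda>s. L * (exp (2 * L * s) * D)"])
      fix x :: real
      show "((\<lambda>a. F v a - F w a) has_real_derivative h v x - h w x) (at x)"
        by (intro derivative_intros F)
      show "((\<lambda>a. D / 2 * exp (2 * L * a)) has_real_derivative L * (exp (2 * L * x) * D)) (at x)"
        by (auto intro!: derivative_eq_intros)
      have "\<bar>h v x - h w x\<bar> \<le> L * \<bar>exp (2 * L * x) * v x - exp (2 * L * x) * w x\<bar>"
        unfolding h_def by (rule lip)
      also have "\<bar>exp (2 * L * x) * v x - exp (2 * L * x) * w x\<bar> = exp (2 * L * x) * \<bar>v x - w x\<bar>"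
        by (simp add: right_diff_distrib[symmetric] abs_mult)
      also have "L * (exp (2 * L * x) * \<bar>v x - w x\<bar>) \<le> L * (exp (2 * L * x) * D)"
        using D L by simp
      finally show "\<bar>h v x - h w x\<bar> \<le> L * (exp (2 * L * x) * D)" .
    qed (simp add: s_def)
    moreover have "0 \<le> D" by (simp add: D_def)
    ultimately have "\<bar>F v s - F w s\<bar> \<le> D / 2 * exp (2 * L * s)"
      unfolding F(1) by simp
    then have "exp (- (2 * L * s)) * \<bar>F v s - F w s\<bar>
        \<le> exp (- (2 * L * s)) * (D / 2 * exp (2 * L * s))"
      by (intro mult_left_mono) auto
    also have "\<dots> = D / 2" by (simp add: exp_minus)
    finally show "dist (Bcontfun (\<Phi> v) t) (Bcontfun (\<Phi> w) t) \<le> 1 / 2 * dist v w"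
      by (simp add: ap \<Phi>_def dist_real_def D_def s_def right_diff_distrib[symmetric] abs_mult)
  qed
  then have "\<exists>!w. Bcontfun (\<Phi> w) = w" by (rule banach_fix_type[rotated 2]) auto
  then obtain w where "Bcontfun (\<Phi> w) = w" by blast
  then have w: "w t = \<Phi> w t" for t using ap[of w] by simp
  have e: "exp (2 * L * t) * w t = F w t" if "t \<ge> 0" for t
    using that unfolding w[of t] by (simp add: \<Phi>_def exp_minus)
  have "(F w has_real_derivative k (F w t)) (at t within {0..})" if "t \<ge> 0" for t
    using F(2)[of w t] e[OF that] by (simp add: h_def has_field_derivative_at_within)
  then show ?thesis using F(1) by blast
qed

section \<open>Orbits of the semigroup\<close>

definition reach :: "(real \<Rightarrow> real \<Rightarrow> real) \<Rightarrow> real \<Rightarrow> real \<Rightarrow> bool" where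
  "reach S x y \<longleftrightarrow> (\<exists>t\<ge>0. S t x = y)"

definition moving :: "(real \<Rightarrow> real \<Rightarrow> real) \<Rightarrow> real \<Rightarrow> bool" where
  "moving S x \<longleftrightarrow> (\<exists>t\<ge>0. S t x \<noteq> x)"

definition source :: "(real \<Rightarrow> real \<Rightarrow> real) \<Rightarrow> real \<Rightarrow> bool" where
  "source S x \<longleftrightarrow> moving S x \<and> (\<forall>y. reach S y x \<longrightarrow> y = x)"

text \<open>\<open>near0 f y e\<close> says that the value \<open>0\<close> at \<open>y\<close> is admissible for graph convergence up to \<open>e\<close>;
  \<open>near\<close> below says the same of an arbitrary value.\<close>

definition near0 :: "(real \<Rightarrow> real) \<Rightarrow> real \<Rightarrow> real \<Rightarrow> bool" where
  "near0 f y e \<longleftrightarrow>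
     (\<exists>y1 y2. \<bar>y1 - y\<bar> < e \<and> \<bar>y2 - y\<bar> < e \<and> f y1 \<le> e \<and> - e \<le> f y2)"

definition rightward :: "(real \<Rightarrow> real \<Rightarrow> real) \<Rightarrow> real \<Rightarrow> bool" where
  "rightward S x \<longleftrightarrow> (\<exists>t\<ge>0. S t x > x)"

abbreviation mirror :: "(real \<Rightarrow> real \<Rightarrow> real) \<Rightarrow> real \<Rightarrow> real \<Rightarrow> real" where
  "mirror S \<equiv> \<lambda>t x. - S t (- x)"

text \<open>What the study of orbits takes from the differential equation: a Lipschitz bound in
  time, and samples of f on either side of every average speed. In this form it passes to the
  mirrored flow without touching integrals.\<close>

locale flow =
  fixes f :: "real \<Rightarrow> real" and S :: "real \<Rightarrow> real \<Rightarrow> real" and M :: real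
  assumes S0 [simp]: "S 0 x = x"
    and SS: "0 \<le> s \<Longrightarrow> 0 \<le> t \<Longrightarrow> S t (S s x) = S (s + t) x"
    and lip: "0 \<le> s \<Longrightarrow> s \<le> t \<Longrightarrow> \<bar>S t x - S s x\<bar> \<le> M * (t - s)"
    and avg_le: "0 \<le> s \<Longrightarrow> s < t \<Longrightarrow> 0 < e \<Longrightarrow> \<exists>u\<in>{s..t}. f (S u x) - e \<le> (S t x - S s x) / (t - s)"
    and avg_ge: "0 \<le> s \<Longrightarrow> s < t \<Longrightarrow> 0 < e \<Longrightarrow> \<exists>u\<in>{s..t}. (S t x - S s x) / (t - s) \<le> f (S u x) + e"
begin

section \<open>Periods, stalls and monotonicity of a single orbit\<close>

lemma M_ge_0: "M \<ge> 0"
  using lip[of 0 1 0] by simp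

lemma cont: "continuous_on {0..} (\<lambda>t. S t x)"
proof (rule lipschitz_on_continuous_on[of M])
  have "dist (S t x) (S s x) \<le> M * dist t s" if "0 \<le> s" "0 \<le> t" for s t
    using lip[of s t x] lip[of t s x] that
    by (cases "s \<le> t") (auto simp: dist_real_def abs_minus_commute)
  then show "M-lipschitz_on {0..} (\<lambda>t. S t x)"
    using M_ge_0 by (auto simp: lipschitz_on_def)
qed

lemma ivt_time:
  assumes "0 \<le> s" "s \<le> t" "S s x \<le> y \<and> y \<le> S t x \<or> S t x \<le> y \<and> y \<le> S s x"
  shows "\<exists>u. s \<le> u \<and> u \<le> t \<and> S u x = y"
proof -
  have "continuous_on {s..t} (\<lambda>t. S t x)"
    by (rule continuous_on_subset[OF cont]) (use assms in auto)
  then show ?thesis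
    using IVT'[of "\<lambda>t. S t x" s y t] IVT2'[of "\<lambda>t. S t x" t y s] assms by blast
qed

text \<open>Comparing \<open>S (t + T / 2) y\<close> with \<open>S t y\<close> at \<open>t = 0\<close> and \<open>t = T / 2\<close>, the intermediate value
  theorem gives a point of the orbit with period \<open>T / 2\<close>, and \<open>y\<close> is reached from it.\<close>

lemma halve_period:
  assumes "T > 0" "S T y = y"
  shows "S (T / 2) y = y"
proof -
  define g where "g t = S (t + T / 2) y - S t y" for t
  have "continuous_on {0..} (\<lambda>t. S (t + T / 2) y)"
    by (rule continuous_on_compose2[OF cont[of y]]) (use assms in \<open>auto intro!: continuous_intros\<close>)
  then have cg: "continuous_on {0..T/2} g" unfolding g_def
    by (intro continuous_intros) (auto intro: continuous_on_subset cont)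
  have "g (T/2) = - g 0" using assms by (simp add: g_def)
  then have "\<exists>c. 0 \<le> c \<and> c \<le> T/2 \<and> g c = 0"
    using IVT'[of g 0 0 "T/2"] IVT2'[of g "T/2" 0 0] cg assms by (cases "g 0 \<le> 0") auto
  then obtain c where c: "0 \<le> c" "c \<le> T/2" "S (c + T / 2) y = S c y" by (auto simp: g_def)
  have "S (T / 2) y = S (T / 2) (S T y)" using assms by simp
  also have "\<dots> = S (T + T / 2) y" by (rule SS) (use assms in auto)
  also have "\<dots> = S ((c + T / 2) + (T - c)) y" by simp
  also have "\<dots> = S (T - c) (S (c + T / 2) y)" using c assms by (subst SS) auto
  also have "\<dots> = S T y" unfolding c(3) using c assms by (subst SS) auto
  finally show ?thesis using assms by simp
qed

text \<open>Halving gives the periods T / 2^n and all their multiples. Any t exceeds such a multiple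
  by less than T / 2^n, and the Lipschitz bound controls the rest.\<close>

lemma periodic_const:
  assumes T: "T > 0" and y: "S T y = y" and t: "t \<ge> 0"
  shows "S t y = y"
proof -
  have p: "S (T / 2 ^ n) y = y" for n
  proof (induction n)
    case (Suc n)
    show ?case using halve_period[OF _ Suc] T by (simp add: field_simps)
  qed (simp add: y)
  have m: "S (real m * (T / 2 ^ n)) y = y" for m n
  proof (induction m)
    case (Suc m)
    have "S (real (Suc m) * (T / 2 ^ n)) y = S (T / 2 ^ n) (S (real m * (T / 2 ^ n)) y)"
      using T by (subst SS) (auto simp: algebra_simps add_divide_distrib)
    then show ?case using Suc p by simp
  qed simp
  have "\<bar>S t y - y\<bar> \<le> M * T * (1 / 2) ^ n" for n
  proof -
    define \<tau> where "\<tau> = T / 2 ^ n"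
    have \<tau>: "\<tau> > 0" using T by (simp add: \<tau>_def)
    define k where "k = nat \<lfloor>t / \<tau>\<rfloor>"
    have "real k = of_int \<lfloor>t / \<tau>\<rfloor>" using t \<tau> by (simp add: k_def)
    then have "real k \<le> t / \<tau>" "t / \<tau> < real k + 1" by linarith+
    then have k: "real k * \<tau> \<le> t" "t < (real k + 1) * \<tau>"
      using \<tau> by (simp_all add: field_simps)
    have "S (real k * \<tau>) y = y" using m by (simp add: \<tau>_def)
    then have "\<bar>S t y - y\<bar> \<le> M * (t - real k * \<tau>)"
      using lip[of "real k * \<tau>" t y] k \<tau> by simp
    also have "\<dots> \<le> M * \<tau>"
      using k by (intro mult_left_mono M_ge_0) (simp add: algebra_simps)
    finally show ?thesis by (simp add: \<tau>_def power_divide)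
  qed
  moreover have "(\<lambda>n. M * T * (1 / 2) ^ n) \<longlonglongrightarrow> M * T * 0"
    by (intro tendsto_intros LIMSEQ_power_zero) auto
  ultimately have "\<bar>S t y - y\<bar> \<le> M * T * 0"
    by (intro LIMSEQ_le_const) auto
  then show ?thesis by simp
qed

text \<open>The position at time a recurs after time b - a, so it is a periodic point.\<close>

lemma stall:
  assumes "0 \<le> a" "a < b" "S a x = S b x" "a \<le> t"
  shows "S t x = S a x"
proof -
  have "S (b - a) (S a x) = S a x" using SS[of a "b - a" x] assms by simp
  then have "S (t - a) (S a x) = S a x"
    by (rule periodic_const[rotated]) (use assms in auto)
  then show ?thesis using SS[of a "t - a" x] assms by simp
qed

lemma not_moving: "\<not> moving S x \<Longrightarrow> 0 \<le> t \<Longrightarrow> S t x = x"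
  by (auto simp: moving_def)

text \<open>A level c strictly below the peak is attained both before and after it. By
  \<open>stall\<close> the orbit then remains at c from the first of these times on, although the
  peak comes later.\<close>

lemma no_peak:
  assumes "0 \<le> u" "u < v" "v < w" "S v x > S u x" "S v x > S w x"
  shows False
proof -
  define c where "c = (max (S u x) (S w x) + S v x) / 2"
  have c: "S u x < c" "S w x < c" "c < S v x" using assms by (auto simp: c_def max_def)
  obtain a where a: "u \<le> a" "a \<le> v" "S a x = c" using ivt_time[of u v x c] assms c by auto
  obtain b where b: "v \<le> b" "b \<le> w" "S b x = c" using ivt_time[of v w x c] assms c by auto
  have "a \<noteq> v" using a c by auto
  then have "S v x = S a x" using stall[of a b x v] a b assms by auto
  then show False using a c by simp
qed

lemma no_valley:
  assumes "0 \<le> u" "u < v" "v < w" "S v x < S u x" "S v x < S w x"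
  shows False
proof -
  define c where "c = (min (S u x) (S w x) + S v x) / 2"
  have c: "S u x > c" "S w x > c" "c > S v x" using assms by (auto simp: c_def min_def)
  obtain a where a: "u \<le> a" "a \<le> v" "S a x = c" using ivt_time[of u v x c] assms c by auto
  obtain b where b: "v \<le> b" "b \<le> w" "S b x = c" using ivt_time[of v w x c] assms c by auto
  have "a \<noteq> v" using a c by auto
  then have "S v x = S a x" using stall[of a b x v] a b assms by auto
  then show False using a c by simp
qed

lemma mono:
  assumes "rightward S x" "0 \<le> s" "s \<le> t"
  shows "S s x \<le> S t x"
proof -
  obtain r where r: "r \<ge> 0" "S r x > x" using assms by (auto simp: rightward_def)
  then have "r > 0" by (cases "r = 0") auto
  \<comment> \<open>At time r the orbit is above x. Being below x earlier would make a valley, being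
    below x later a peak.\<close>
  have ge: "x \<le> S t x" if "t \<ge> 0" for t
  proof (rule ccontr)
    assume t: "\<not> x \<le> S t x"
    then have "t \<noteq> r" "t \<noteq> 0" using r by auto
    then consider "t < r" | "r < t" by linarith
    then show False
      by cases (use no_valley[of 0 t r x] no_peak[of 0 r t x] that t r \<open>t \<noteq> 0\<close> \<open>r > 0\<close> in auto)
  qed
  show ?thesis
  proof (rule ccontr)
    assume n: "\<not> ?thesis"
    then have "s \<noteq> 0" "s < t" using ge[of t] assms by (auto simp: less_le)
    moreover have "x \<le> S t x" using ge assms by auto
    ultimately show False using no_peak[of 0 s t x] n assms by auto
  qed
qed

lemma strict:
  assumes "rightward S x" "0 \<le> s" "s < t" "moving S (S s x)"
  shows "S s x < S t x"
proof (rule ccontr)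
  assume "\<not> ?thesis"
  then have e: "S s x = S t x" using mono[of x s t] assms by auto
  obtain r where r: "r \<ge> 0" "S r (S s x) \<noteq> S s x" using assms by (auto simp: moving_def)
  then show False using stall[of s t x "t + r"] SS[of t r x] e assms by simp
qed

lemma right_moving: "rightward S x \<Longrightarrow> moving S x"
  by (auto simp: rightward_def moving_def)

lemma right_orbit:
  assumes "rightward S x" "0 \<le> s" "moving S (S s x)"
  shows "rightward S (S s x)"
  using strict[of x s "s + 1"] assms unfolding rightward_def
  by (auto simp: SS intro!: exI[of _ 1])

section \<open>Reachability as a partial order\<close>

lemma reach_refl [simp]: "reach S x x"
  unfolding reach_def by (rule exI[of _ 0]) simp

lemma reach_trans: "reach S x y \<Longrightarrow> reach S y z \<Longrightarrow> reach S x z"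
  unfolding reach_def by (metis SS add_nonneg_nonneg)

lemma reach_orbit [simp]: "0 \<le> t \<Longrightarrow> reach S x (S t x)"
  by (auto simp: reach_def)

lemma reach_not_moving: "reach S x y \<Longrightarrow> \<not> moving S x \<Longrightarrow> y = x"
  by (auto simp: reach_def moving_def)

lemma reach_moving: "reach S x y \<Longrightarrow> moving S y \<Longrightarrow> moving S x"
  using reach_not_moving by blast

lemma reach_neq_moving: "reach S x y \<Longrightarrow> x \<noteq> y \<Longrightarrow> moving S x"
  using reach_not_moving by blast

text \<open>A round trip is a period, and periodic points do not move.\<close>

lemma reach_antisym:
  assumes "reach S x y" "reach S y x"
  shows "x = y"
proof -
  obtain s t where st: "s \<ge> 0" "S s x = y" "t \<ge> 0" "S t y = x"
    using assms by (auto simp: reach_def)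
  show ?thesis
  proof (cases "s = 0")
    case False
    then have "S (s + t) x = x" using st SS[of s t x] by simp
    then have "S s x = x" using periodic_const[of "s + t" x s] st False by simp
    then show ?thesis using st by simp
  qed (use st in simp)
qed

lemma right_reach_le: "rightward S x \<Longrightarrow> reach S x y \<Longrightarrow> x \<le> y"
  using mono[of x 0] by (auto simp: reach_def)

lemma right_reach_right: "rightward S x \<Longrightarrow> reach S x y \<Longrightarrow> moving S y \<Longrightarrow> rightward S y"
  using right_orbit by (auto simp: reach_def)

lemma right_between:
  assumes "rightward S x" "reach S x z" "x \<le> y" "y \<le> z"
  shows "reach S x y" and "reach S y z"
proof -
  obtain t where t: "t \<ge> 0" "S t x = z" using assms by (auto simp: reach_def)
  then obtain s where s: "0 \<le> s" "s \<le> t" "S s x = y" using ivt_time[of 0 t x y] assms by auto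
  then show "reach S x y" by (auto simp: reach_def)
  have "S (t - s) y = z" using SS[of s "t - s" x] s t by simp
  then show "reach S y z" unfolding reach_def using s by (intro exI[of _ "t - s"]) auto
qed

text \<open>Statements on leftward orbits are obtained by applying their rightward versions to this
  mirrored instance.\<close>

lemma reflect: "flow (\<lambda>x. - f (- x)) (mirror S) M"
proof
  fix s t e x :: real assume *: "0 \<le> s" "s < t" "0 < e"
  obtain u where u: "u \<in> {s..t}" "(S t (-x) - S s (-x)) / (t - s) \<le> f (S u (-x)) + e"
    using avg_ge[OF *] by blast
  have "- S t (- x) - - S s (- x) = - (S t (-x) - S s (-x))" by simp
  then have "(- S t (- x) - - S s (- x)) / (t - s) = - ((S t (-x) - S s (-x)) / (t - s))"
    by (metis minus_divide_left)
  with u show "\<exists>u\<in>{s..t}. - f (- (- S u (- x))) - e \<le> (- S t (- x) - - S s (- x)) / (t - s)"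
    by (intro bexI[of _ u]) auto
  obtain v where v: "v \<in> {s..t}" "f (S v (-x)) - e \<le> (S t (-x) - S s (-x)) / (t - s)"
    using avg_le[OF *] by blast
  have "- S t (- x) - - S s (- x) = - (S t (-x) - S s (-x))" by simp
  then have "(- S t (- x) - - S s (- x)) / (t - s) = - ((S t (-x) - S s (-x)) / (t - s))"
    by (metis minus_divide_left)
  with v show "\<exists>u\<in>{s..t}. (- S t (- x) - - S s (- x)) / (t - s) \<le> - f (- (- S u (- x))) + e"
    by (intro bexI[of _ v]) auto
next
  fix s t x :: real assume "0 \<le> s" "s \<le> t"
  then show "\<bar>- S t (- x) - - S s (- x)\<bar> \<le> M * (t - s)" using lip[of s t "-x"] by auto
qed (auto simp: SS)

lemma reach_reflect: "reach (mirror S) x y \<longleftrightarrow> reach S (- x) (- y)"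
  by (auto simp: reach_def equation_minus_iff)

lemma moving_reflect: "moving (mirror S) x \<longleftrightarrow> moving S (- x)"
  by (auto simp: moving_def equation_minus_iff)

lemma source_reflect: "source (mirror S) x \<longleftrightarrow> source S (- x)"
  unfolding source_def reach_reflect moving_reflect by (metis minus_minus)

lemma near0_reflect: "near0 (\<lambda>x. - f (- x)) y e \<longleftrightarrow> near0 f (- y) e"
proof -
  have "near0 (\<lambda>x. - g (- x)) y e" if n: "near0 g (- y) e" for g :: "real \<Rightarrow> real" and y
  proof -
    obtain y1 y2 where "\<bar>y1 - - y\<bar> < e" "\<bar>y2 - - y\<bar> < e" "g y1 \<le> e" "- e \<le> g y2"
      using n by (auto simp: near0_def)
    then show ?thesis unfolding near0_def
      by (intro exI[of _ "- y2"] exI[of _ "- y1"]) auto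
  qed
  from this[of f y] this[of "\<lambda>x. - f (- x)" "- y"] show ?thesis by auto
qed

lemma moving_cases:
  assumes "moving S x"
  obtains "rightward S x" | "rightward (mirror S) (- x)"
proof -
  obtain t where "t \<ge> 0" "S t x \<noteq> x" using assms by (auto simp: moving_def)
  then consider "S t x > x" | "- S t (- (- x)) > - x" by fastforce
  then show ?thesis
    by cases (use that \<open>t \<ge> 0\<close> in \<open>auto simp: rightward_def\<close>)
qed

lemma not_both: "rightward S x \<Longrightarrow> \<not> rightward (mirror S) (- x)"
  using mono[of x 0] by (force simp: rightward_def)

text \<open>Every orbit through z shares the direction of z, starts to its left and sweeps the whole
  interval up to z; so the one starting further left passes the start of the other. At a stationary
  z two orbits could arrive from opposite sides.\<close>

lemma reach_merge_rightward:
  assumes z: "moving S z" "rightward S z" and xz: "reach S x z" and yz: "reach S y z"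
  shows "reach S x y \<or> reach S y x"
proof -
  have r: "rightward S x" if "reach S x z" for x
  proof -
    have "moving S x" using that reach_moving z by blast
    then show ?thesis
    proof (cases rule: moving_cases)
      case 2
      have "rightward (mirror S) (- z)"
        by (rule flow.right_reach_right[OF reflect 2])
          (use that z in \<open>auto simp: reach_reflect moving_reflect\<close>)
      then show ?thesis using not_both[OF z(2)] by blast
    qed
  qed
  have "x \<le> z" "y \<le> z" using r xz yz right_reach_le by blast+
  then show ?thesis
    using right_between[OF r[OF xz] xz, of y] right_between[OF r[OF yz] yz, of x]
    by linarith
qed

lemma reach_merge:
  assumes "reach S x z" "reach S y z" "moving S z"
  shows "reach S x y \<or> reach S y x"
proof -
  show ?thesis using assms(3)
  proof (cases rule: moving_cases)
    case 1
    then show ?thesis using reach_merge_rightward[OF assms(3) 1 assms(1,2)] by blast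
  next
    case 2
    then show ?thesis using flow.reach_merge_rightward[OF reflect _ 2, of "-x" "-y"] assms
      by (simp add: reach_reflect moving_reflect)
  qed
qed

section \<open>Countably many starting points suffice\<close>

lemma moving_rational_rightward:
  assumes "rightward S x"
  shows "\<exists>r\<in>\<rat>. reach S x r \<and> moving S r"
proof -
  obtain t where t: "t \<ge> 0" "S t x > x" using assms by (auto simp: rightward_def)
  \<comment> \<open>A rational strictly inside the swept interval still has \<open>S t x\<close>
    ahead and therefore moves.\<close>
  obtain r where r: "r \<in> \<rat>" "x < r" "r < S t x" using Rats_dense_in_real[OF t(2)] by blast
  have "reach S x r" "reach S r (S t x)"
    using right_between[OF assms, of "S t x" r] t r by auto
  then show ?thesis using r reach_neq_moving by blast
qed

lemma moving_rational:
  assumes "moving S x"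
  shows "\<exists>r\<in>\<rat>. reach S x r \<and> moving S r"
proof -
  show ?thesis using assms(1)
  proof (cases rule: moving_cases)
    case 1
    then show ?thesis by (rule moving_rational_rightward)
  next
    case 2
    then obtain r where "r \<in> \<rat>" "reach S x (- r) \<and> moving S (- r)"
      using flow.moving_rational_rightward[OF reflect 2] by (auto simp: reach_reflect moving_reflect)
    then show ?thesis by (intro bexI[of _ "-r"]) auto
  qed
qed

text \<open>Each source is assigned a moving rational on its orbit. Two sources with the same
  rational are comparable by \<open>reach_merge\<close>, and nothing but itself reaches a
  source.\<close>

lemma countable_source: "countable {x. source S x}"
proof -
  have "\<forall>x\<in>{x. source S x}. \<exists>r\<in>\<rat>. reach S x r \<and> moving S r"
    using moving_rational by (auto simp: source_def)
  then obtain r where r: "\<And>x. source S x \<Longrightarrow> r x \<in> \<rat> \<and> reach S x (r x) \<and> moving S (r x)"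
    by (metis mem_Collect_eq)
  have "inj_on r {x. source S x}"
  proof (rule inj_onI)
    fix x y assume *: "x \<in> {x. source S x}" "y \<in> {x. source S x}" "r x = r y"
    then have "reach S x y \<or> reach S y x"
      using r[of x] r[of y] reach_merge[of x "r x" y] by auto
    with * show "x = y" by (auto simp: source_def)
  qed
  then show ?thesis
    by (rule countable_image_inj_on[rotated])
      (rule countable_subset[OF _ countable_rat], use r in auto)
qed

lemma not_source_rational_rightward:
  assumes "rightward S y" "reach S y x" "y \<noteq> x"
  shows "\<exists>r\<in>\<rat>. reach S r x \<and> r \<noteq> x"
proof -
  have "y < x" using right_reach_le assms by fastforce
  then obtain r where r: "r \<in> \<rat>" "y < r" "r < x" using Rats_dense_in_real by blast
  then show ?thesis using right_between[OF assms(1,2), of r] by auto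
qed

lemma not_source_rational:
  assumes "moving S x" "\<not> source S x"
  shows "\<exists>r\<in>\<rat>. reach S r x \<and> r \<noteq> x"
proof -
  obtain y where y: "reach S y x" "y \<noteq> x" using assms by (auto simp: source_def)
  have "moving S y" using y reach_neq_moving by blast
  then show ?thesis
  proof (cases rule: moving_cases)
    case 1
    then show ?thesis using not_source_rational_rightward[OF 1 y] by blast
  next
    case 2
    then obtain r where "r \<in> \<rat>" "reach S (- r) x \<and> r \<noteq> - x"
      using flow.not_source_rational_rightward[OF reflect 2, of "- x"] y by (auto simp: reach_reflect)
    then show ?thesis by (intro bexI[of _ "-r"]) auto
  qed
qed

text \<open>With a predecessor y, the point x is interior to an interval swept by the orbit of y. A
  source, in contrast, may have stationary points right behind it.\<close>

lemma moving_ball_rightward: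
  assumes "rightward S y" "reach S y x" "y \<noteq> x" "moving S x"
  shows "\<exists>r>0. \<forall>z. \<bar>z - x\<bar> < r \<longrightarrow> moving S z"
proof -
  have yx: "y < x" using right_reach_le assms by fastforce
  obtain t where t: "t \<ge> 0" "S t x > x"
    using right_reach_right[OF assms(1,2,4)] by (auto simp: rightward_def)
  show ?thesis
  proof (intro exI conjI allI impI)
    show "0 < min (x - y) (S t x - x)" using yx t by simp
    fix z assume "\<bar>z - x\<bar> < min (x - y) (S t x - x)"
    then have z: "y < z" "z < S t x" by (auto simp: abs_less_iff)
    have "reach S y (S t x)" using reach_trans[OF assms(2)] t by simp
    then have "reach S z (S t x)"
      using right_between(2)[OF assms(1), of "S t x" z] z by simp
    then show "moving S z" by (rule reach_neq_moving) (use z in simp)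
  qed
qed

lemma moving_ball:
  assumes "moving S x" "\<not> source S x"
  shows "\<exists>r>0. \<forall>z. \<bar>z - x\<bar> < r \<longrightarrow> moving S z"
proof -
  obtain y where y: "reach S y x" "y \<noteq> x" using assms by (auto simp: source_def)
  have "moving S y" using y reach_neq_moving by blast
  then show ?thesis
  proof (cases rule: moving_cases)
    case 1
    then show ?thesis using moving_ball_rightward[OF 1 y] assms by blast
  next
    case 2
    then obtain r where r: "r > 0" "\<And>z. \<bar>z - (- x)\<bar> < r \<Longrightarrow> moving S (- z)"
      using flow.moving_ball_rightward[OF reflect 2, of "- x"] y assms by (auto simp: reach_reflect moving_reflect)
    have "moving S z" if "\<bar>z - x\<bar> < r" for z
      using r(2)[of "-z"] that by (simp add: abs_minus_commute)
    then show ?thesis using r(1) by meson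
  qed
qed

text \<open>The orbits of two distinct sources on the same side of \<open>x0\<close> are disjoint, so at most one
  of them that starts within distance \<open>e\<close> of \<open>x0\<close> has length at least \<open>e\<close>.\<close>

lemma short_source_orbits_rightward:
  assumes x0: "\<not> moving S x0" and e: "e > 0"
  shows "\<exists>r>0. \<forall>x y. source S x \<longrightarrow> rightward S x \<longrightarrow> \<bar>x - x0\<bar> < r \<longrightarrow> reach S x y \<longrightarrow> \<bar>y - x\<bar> \<le> e"
proof -
  \<comment> \<open>An orbit starting to the left of x0 cannot pass it: at x0 it would stay for
    ever.\<close>
  have below: "y \<le> x0" if "rightward S x" "x < x0" "reach S x y" for x y
  proof (rule ccontr)
    assume "\<not> y \<le> x0"
    then have "reach S x0 y" using right_between[OF that(1,3), of x0] that by auto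
    then show False using reach_not_moving x0 \<open>\<not> y \<le> x0\<close> by fastforce
  qed
  show ?thesis
  proof (cases "\<exists>x1 y1. source S x1 \<and> rightward S x1 \<and> x0 < x1 \<and> x1 < x0 + e \<and> reach S x1 y1 \<and> y1 - x1 > e")
    case True
    then obtain x1 y1 where 1: "source S x1" "rightward S x1" "x0 < x1" "x1 < x0 + e" "reach S x1 y1"
      "y1 - x1 > e" by blast
    \<comment> \<open>With radius x1 - x0, an orbit starting between x0 and x1 has to stop before
      the source x1, which lies within e of x0.\<close>
    show ?thesis
    proof (intro exI[of _ "x1 - x0"] conjI allI impI)
      fix x y assume 2: "source S x" "rightward S x" "\<bar>x - x0\<bar> < x1 - x0" "reach S x y"
      have le: "x \<le> y" using right_reach_le 2 by blast
      have "x \<noteq> x0" using 2 x0 by (auto simp: source_def)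
      then consider "x < x0" | "x0 < x" by linarith
      then have "y - x \<le> e"
      proof cases
        case 1
        then show ?thesis using below[of x y] 2 \<open>x1 < x0 + e\<close> by linarith
      next
        case 2
        have "x < x1" using \<open>\<bar>x - x0\<bar> < x1 - x0\<close> by linarith
        have "y < x1"
        proof (rule ccontr)
          assume "\<not> y < x1"
          then have "reach S x x1"
            using right_between[OF \<open>rightward S x\<close> \<open>reach S x y\<close>, of x1] \<open>x < x1\<close> by auto
          then show False using \<open>source S x1\<close> \<open>x < x1\<close> by (auto simp: source_def)
        qed
        then show ?thesis using 2 \<open>x1 < x0 + e\<close> by linarith
      qed
      then show "\<bar>y - x\<bar> \<le> e" using le by simp
    qed (use 1 in simp)
  next
    case False
    show ?thesis
    proof (intro exI[of _ e] conjI allI impI)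
      fix x y assume 2: "source S x" "rightward S x" "\<bar>x - x0\<bar> < e" "reach S x y"
      have le: "x \<le> y" using right_reach_le 2 by blast
      have "x \<noteq> x0" using 2 x0 by (auto simp: source_def)
      then have "y - x \<le> e" using False below[of x y] 2 by (cases "x < x0") force+
      then show "\<bar>y - x\<bar> \<le> e" using le by simp
    qed (rule e)
  qed
qed

lemma short_source_orbits:
  assumes x0: "\<not> moving S x0" and e: "e > 0"
  shows "\<exists>r>0. \<forall>x y. source S x \<longrightarrow> \<bar>x - x0\<bar> < r \<longrightarrow> reach S x y \<longrightarrow> \<bar>y - x\<bar> \<le> e"
proof -
  obtain r1 where r1: "r1 > 0" "\<And>x y. source S x \<Longrightarrow> rightward S x \<Longrightarrow> \<bar>x - x0\<bar> < r1 \<Longrightarrow> reach S x y \<Longrightarrow> \<bar>y - x\<bar> \<le> e"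
    using short_source_orbits_rightward[OF x0 e] by blast
  have "\<not> moving (mirror S) (- x0)" using x0 by (simp add: moving_reflect)
  from flow.short_source_orbits_rightward[OF reflect this e] obtain r2 where r2: "r2 > 0"
    "\<And>x y. source S (- x) \<Longrightarrow> rightward (mirror S) x \<Longrightarrow> \<bar>x - - x0\<bar> < r2 \<Longrightarrow>
      reach S (- x) (- y) \<Longrightarrow> \<bar>y - x\<bar> \<le> e"
    by (auto simp: source_reflect reach_reflect)
  show ?thesis
  proof (intro exI[of _ "min r1 r2"] conjI allI impI)
    fix x y assume a: "source S x" "\<bar>x - x0\<bar> < min r1 r2" "reach S x y"
    have "moving S x" using a by (simp add: source_def)
    then show "\<bar>y - x\<bar> \<le> e"
    proof (cases rule: moving_cases)
      case 2
      then show ?thesis using r2(2)[of "-x" "-y"] a by (simp add: abs_minus_commute)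
    qed (use r1 a in auto)
  qed (use r1 r2 in simp)
qed

text \<open>The radius must not depend on x, because the chosen start in front of z changes from
  stage to stage. Strict growth through x0 turns closeness in position into closeness in time:
  \<open>S \<delta> x0\<close> bounds t1 from above, a point of the orbit of z shortly before x0
  bounds it from below. If z is x0 itself, being a source forces x = x0.\<close>

lemma orbit_sync_rightward:
  assumes "rightward S z" "moving S x0" "reach S z x0" "z = x0 \<longrightarrow> source S x0" "\<delta> > 0"
  shows "\<exists>\<rho>>0. \<forall>x t1. reach S x z \<longrightarrow> 0 \<le> t1 \<longrightarrow> \<bar>S t1 x - x0\<bar> < \<rho> \<longrightarrow>
    (\<forall>t\<ge>0. \<bar>S (t1 + t) x - S t x0\<bar> \<le> M * \<delta>)"
proof -
  have rx0: "rightward S x0" using right_reach_right assms by blast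
  have up: "x0 < S \<delta> x0" using strict[OF rx0, of 0 \<delta>] assms by simp
  have sync: "\<bar>S (t1 + t) x - S (\<tau> + t) x\<bar> \<le> M * \<delta>"
    if "0 \<le> t1" "0 \<le> \<tau>" "0 \<le> t" "\<bar>t1 - \<tau>\<bar> \<le> \<delta>" for t1 \<tau> t x
  proof -
    have "\<bar>S (t1 + t) x - S (\<tau> + t) x\<bar> \<le> M * \<bar>t1 - \<tau>\<bar>"
      using lip[of "t1 + t" "\<tau> + t" x] lip[of "\<tau> + t" "t1 + t" x] that
      by (cases "t1 \<le> \<tau>") (auto simp: abs_minus_commute)
    also have "\<dots> \<le> M * \<delta>" using that M_ge_0 by (intro mult_left_mono)
    finally show ?thesis .
  qed
  show ?thesis
  proof (cases "z = x0")
    case True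
    show ?thesis
    proof (intro exI[of _ "S \<delta> x0 - x0"] conjI allI impI)
      fix x t1 t :: real
      assume a: "reach S x z" "0 \<le> t1" "\<bar>S t1 x - x0\<bar> < S \<delta> x0 - x0" "0 \<le> t"
      have x: "x = x0" using a True assms(4) by (simp add: source_def)
      have "t1 \<le> \<delta>"
      proof (rule ccontr)
        assume "\<not> t1 \<le> \<delta>"
        then have "S \<delta> x0 \<le> S t1 x0" using mono[OF rx0, of \<delta> t1] \<open>\<delta> > 0\<close> by simp
        then show False using a x by simp
      qed
      then show "\<bar>S (t1 + t) x - S t x0\<bar> \<le> M * \<delta>"
        using sync[of t1 0 t x] a x by simp
    qed (use up in simp)
  next
    case False
    obtain r where r: "r \<ge> 0" "S r z = x0" using assms by (auto simp: reach_def)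
    define r' where "r' = max (r - \<delta>) 0"
    have "r \<noteq> 0" using r False by auto
    then have r': "0 \<le> r'" "r' < r" "r - \<delta> \<le> r'" using r \<open>\<delta> > 0\<close> by (auto simp: r'_def)
    have "reach S (S r' z) x0" unfolding reach_def
      using r' r SS[of r' "r - r'" z] by (intro exI[of _ "r - r'"]) auto
    then have "moving S (S r' z)" using reach_moving assms by blast
    then have low: "S r' z < x0" using strict[OF assms(1) r'(1,2)] r by simp
    show ?thesis
    proof (intro exI[of _ "min (S \<delta> x0 - x0) (x0 - S r' z)"] conjI allI impI)
      fix x t1 t :: real
      assume a: "reach S x z" "0 \<le> t1" "\<bar>S t1 x - x0\<bar> < min (S \<delta> x0 - x0) (x0 - S r' z)" "0 \<le> t"
      obtain a' where a': "a' \<ge> 0" "S a' x = z" using a by (auto simp: reach_def)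
      have rx: "rightward S x"
      proof -
        have "moving S z" using assms right_moving by blast
        then have "moving S x" using reach_moving a by blast
        then show ?thesis
        proof (cases rule: moving_cases)
          case 2
          have "rightward (mirror S) (- z)"
            by (rule flow.right_reach_right[OF reflect 2])
              (use a \<open>moving S z\<close> in \<open>auto simp: reach_reflect moving_reflect\<close>)
          then show ?thesis using not_both[OF assms(1)] by blast
        qed
      qed
      have zx: "S u z = S (a' + u) x" if "u \<ge> 0" for u using SS[of a' u x] a' that by simp
      have x0x: "S u x0 = S (a' + r + u) x" if "u \<ge> 0" for u
        using SS[of "a' + r" u x] zx[of r] r a' that by simp
      have "t1 \<le> a' + r + \<delta>"
      proof (rule ccontr)
        assume "\<not> ?thesis"
        then have "S (a' + r + \<delta>) x \<le> S t1 x"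
          using mono[OF rx, of "a' + r + \<delta>" t1] a' r \<open>\<delta> > 0\<close> by simp
        then have "S \<delta> x0 \<le> S t1 x" using x0x[of \<delta>] \<open>\<delta> > 0\<close> by simp
        moreover have "\<bar>S t1 x - x0\<bar> < S \<delta> x0 - x0" using a by simp
        ultimately show False by linarith
      qed
      moreover have "a' + r' \<le> t1"
      proof (rule ccontr)
        assume "\<not> ?thesis"
        then have "S t1 x \<le> S (a' + r') x"
          using mono[OF rx, of t1 "a' + r'"] a by simp
        then show False using a zx[of r'] r' by (auto simp: abs_less_iff)
      qed
      ultimately have "\<bar>t1 - (a' + r)\<bar> \<le> \<delta>" using r' by (auto simp: abs_le_iff)
      then show "\<bar>S (t1 + t) x - S t x0\<bar> \<le> M * \<delta>"
        using sync[of t1 "a' + r" t x] a a' r x0x[of t] by simp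
    qed (use up low in simp)
  qed
qed

lemma orbit_sync:
  assumes "moving S x0" "reach S z x0" "z = x0 \<longrightarrow> source S x0" "\<delta> > 0"
  shows "\<exists>\<rho>>0. \<forall>x t1. reach S x z \<longrightarrow> 0 \<le> t1 \<longrightarrow> \<bar>S t1 x - x0\<bar> < \<rho> \<longrightarrow>
    (\<forall>t\<ge>0. \<bar>S (t1 + t) x - S t x0\<bar> \<le> M * \<delta>)"
proof -
  have "moving S z" using reach_moving assms by blast
  then show ?thesis
  proof (cases rule: moving_cases)
    case 1
    then show ?thesis using orbit_sync_rightward[OF 1 assms] by blast
  next
    case 2
    have "\<exists>\<rho>>0. \<forall>x t1. reach (mirror S) x (- z) \<longrightarrow> 0 \<le> t1 \<longrightarrow>
        \<bar>- S t1 (- x) - - x0\<bar> < \<rho> \<longrightarrow>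
        (\<forall>t\<ge>0. \<bar>- S (t1 + t) (- x) - - S t (- (- x0))\<bar> \<le> M * \<delta>)"
      by (rule flow.orbit_sync_rightward[OF reflect 2]) (use assms in \<open>auto simp: reach_reflect moving_reflect source_reflect\<close>)
    then obtain \<rho> where \<rho>: "\<rho> > 0" "\<And>x t1 t. reach S (- x) z \<Longrightarrow> 0 \<le> t1 \<Longrightarrow>
        \<bar>- S t1 (- x) - - x0\<bar> < \<rho> \<Longrightarrow> t \<ge> 0 \<Longrightarrow> \<bar>- S (t1 + t) (- x) - - S t x0\<bar> \<le> M * \<delta>"
      by (auto simp: reach_reflect)
    show ?thesis
    proof (intro exI[of _ \<rho>] conjI allI impI)
      fix x t1 t :: real
      assume "reach S x z" "0 \<le> t1" "\<bar>S t1 x - x0\<bar> < \<rho>" "0 \<le> t"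
      then show "\<bar>S (t1 + t) x - S t x0\<bar> \<le> M * \<delta>"
        using \<rho>(2)[of "-x" t1 t] by (simp add: abs_minus_commute)
    qed (rule \<rho>(1))
  qed
qed

section \<open>Admissibility of the value 0, and what happens where it fails\<close>

lemma endpoint_near0:
  assumes "rightward S x" and "\<And>t. t \<ge> 0 \<Longrightarrow> S t x \<le> c" and "e > 0"
  shows "\<exists>b y1 y2. x \<le> b \<and> b \<le> c \<and> \<bar>y1 - b\<bar> < e \<and> \<bar>y2 - b\<bar> < e \<and> f y1 \<le> e \<and> - e \<le> f y2"
proof -
  define p where "p n = S (real n) x" for n
  have inc: "incseq p" unfolding p_def by (intro incseq_SucI mono[OF assms(1)]) auto
  have "\<And>n. p n \<le> c" using assms(2) by (auto simp: p_def)
  with inc obtain b where b: "p \<longlonglongrightarrow> b" "\<And>n. p n \<le> b" using incseq_convergent by blast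
  have "b \<le> c" by (rule LIMSEQ_le_const2[OF b(1)]) (use \<open>\<And>n. p n \<le> c\<close> in auto)
  have "x \<le> b" using b(2)[of 0] by (simp add: p_def)
  have "\<forall>\<^sub>F n in sequentially. p n > b - e / 2"
    using b(1) assms(3) by (intro order_tendstoD) auto
  then obtain n where n: "p n > b - e / 2" by (meson eventually_sequentially order_refl)
  have st: "0 \<le> real n" "real n < real n + 1" by auto
  have d: "S (real n + 1) x = p (Suc n)" by (simp add: p_def add.commute)
  have near: "\<bar>S u x - b\<bar> < e" if "u \<in> {real n..real n + 1}" for u
    using mono[OF assms(1), of "real n" u] mono[OF assms(1), of u "real n + 1"] that d
      b(2)[of "Suc n"] n assms(3) by (auto simp: p_def)
  \<comment> \<open>Close to the limit b of the orbit, the displacement during one unit of time lies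
    between 0 and e/2. It is also the average speed, so f has a sample below e and one above -e near
    b.\<close>
  have dn: "0 \<le> S (real n + 1) x - S (real n) x" "S (real n + 1) x - S (real n) x \<le> e / 2"
    using d b(2)[of "Suc n"] n mono[OF assms(1), of "real n" "real n + 1"] by (auto simp: p_def)
  obtain u where "u \<in> {real n..real n + 1}" "f (S u x) \<le> e"
    using avg_le[OF st, of "e/2" x] dn assms(3) by auto
  moreover obtain v where "v \<in> {real n..real n + 1}" "- e \<le> f (S v x)"
    using avg_ge[OF st, of e x] dn assms(3) by force
  ultimately show ?thesis using near \<open>b \<le> c\<close> \<open>x \<le> b\<close> by blast
qed

lemma right_pos:
  assumes "rightward S x" "d > 0" "e > 0"
  shows "\<exists>y. \<bar>y - x\<bar> < d \<and> - e \<le> f y"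
proof -
  \<comment> \<open>During time h the orbit travels at most M h < d; M + 1 avoids a division by
    0.\<close>
  define h where "h = d / (M + 1) / 2"
  have h: "h > 0" using assms M_ge_0 by (simp add: h_def)
  have "x \<le> S h x" using mono[OF assms(1), of 0 h] h by simp
  then have "0 \<le> (S h x - x) / h" using h by simp
  moreover obtain u where u: "u \<in> {0..h}" "(S h x - x) / h \<le> f (S u x) + e"
    using avg_ge[of 0 h e x] h assms(3) by auto
  ultimately have u: "u \<in> {0..h}" "- e \<le> f (S u x)" by auto
  have "\<bar>S u x - x\<bar> \<le> M * u" using lip[of 0 u x] u by auto
  also have "\<dots> \<le> M * h" using u M_ge_0 by (intro mult_left_mono) auto
  also have "\<dots> < (M + 1) * h * 2" using h M_ge_0 by (simp add: algebra_simps add_nonneg_pos)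
  also have "\<dots> = d" using M_ge_0 by (simp add: h_def field_simps)
  finally show ?thesis using u by blast
qed

text \<open>At a stationary point f vanishes, since the average speed there is 0; opposite motions
  produce samples above -e and below e. Either would make 0 admissible, so the whole neighbourhood
  moves one way.\<close>

lemma not_near0_right:
  assumes "\<not> near0 f y e" "e > 0"
  shows "(\<forall>x. \<bar>x - y\<bar> < e \<longrightarrow> rightward S x) \<or>
    (\<forall>x. \<bar>x - y\<bar> < e \<longrightarrow> rightward (mirror S) (- x))"
proof -
  have fz: "f x = 0" if "\<not> moving S x" for x
  proof -
    have "S u x = x" if "0 \<le> u" for u using not_moving that \<open>\<not> moving S x\<close> by blast
    then have "\<bar>f x\<bar> \<le> e" if "e > 0" for e
      using avg_le[of 0 1 e x] avg_ge[of 0 1 e x] that by (auto simp: abs_le_iff)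
    then show ?thesis using field_le_epsilon[of "\<bar>f x\<bar>" 0] by auto
  qed
  have m: "moving S x" if "\<bar>x - y\<bar> < e" for x
    using fz[of x] assms that unfolding near0_def by (metis less_le neg_le_0_iff_le)
  have "\<not> (\<exists>x1 x2. \<bar>x1 - y\<bar> < e \<and> \<bar>x2 - y\<bar> < e \<and> rightward S x1 \<and>
      rightward (mirror S) (- x2))"
  proof safe
    fix x1 x2 assume *: "\<bar>x1 - y\<bar> < e" "\<bar>x2 - y\<bar> < e" "rightward S x1"
      "rightward (mirror S) (- x2)"
    obtain z1 where z1: "\<bar>z1 - x1\<bar> < e - \<bar>x1 - y\<bar>" "- e \<le> f z1"
      using right_pos[OF *(3), of "e - \<bar>x1 - y\<bar>" e] * assms by auto
    obtain z2 where z2: "\<bar>z2 - (- x2)\<bar> < e - \<bar>x2 - y\<bar>" "- e \<le> - f (- z2)"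
      using flow.right_pos[OF reflect *(4), of "e - \<bar>x2 - y\<bar>" e] * assms by auto
    have "\<bar>z1 - y\<bar> < e" "\<bar>- z2 - y\<bar> < e" using z1 z2 by linarith+
    then show False using z1 z2 assms unfolding near0_def by force
  qed
  then show ?thesis using m moving_cases by meson
qed

text \<open>If the orbit of q never exceeded y + e/2, its limit would lie in the e-neighbourhood of
  y and 0 would be admissible by \<open>endpoint_near0\<close>. Hence it passes y and goes on for at
  least e/2.\<close>

lemma plateau_rightward:
  assumes n: "\<not> near0 f y e" and "e > 0"
    and r: "\<And>x. \<bar>x - y\<bar> < e \<Longrightarrow> rightward S x" and yq: "y - e < q" "q < y - e / 2"
  shows "moving S q \<and> reach S q y \<and> (\<exists>z. reach S y z \<and> \<bar>z - y\<bar> \<ge> e / 2)"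
proof -
  have q: "rightward S q" using r yq \<open>e > 0\<close> by auto
  have "\<exists>t\<ge>0. S t q > y + e / 2"
  proof (rule ccontr)
    assume "\<not> ?thesis"
    then have le: "\<And>t. t \<ge> 0 \<Longrightarrow> S t q \<le> y + e / 2" by force
    \<comment> \<open>The limit b lies between q and y + e/2, so samples closer than m to b remain
      in the e-neighbourhood of y.\<close>
    define m where "m = min (e / 2) (q - (y - e))"
    have "m > 0" using yq \<open>e > 0\<close> by (simp add: m_def)
    then obtain b y1 y2 where b: "q \<le> b" "b \<le> y + e / 2" "\<bar>y1 - b\<bar> < m"
      "\<bar>y2 - b\<bar> < m" "f y1 \<le> m" "- m \<le> f y2"
      using endpoint_near0[OF q le] by blast
    then have "\<bar>y1 - y\<bar> < e" "\<bar>y2 - y\<bar> < e" "f y1 \<le> e" "- e \<le> f y2"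
      using yq \<open>e > 0\<close> by (auto simp: abs_less_iff m_def)
    then show False using n unfolding near0_def by blast
  qed
  then obtain t where t: "t \<ge> 0" "S t q > y + e / 2" by blast
  have "reach S q y" "reach S y (S t q)"
    using right_between[OF q reach_orbit[OF t(1)], of y] t yq \<open>e > 0\<close> by auto
  then show ?thesis using right_moving q t \<open>e > 0\<close> by force
qed

text \<open>The direction of motion is not known beforehand, so one candidate is offered on each
  side: q1 for rightward, q2 for leftward motion.\<close>

lemma plateau:
  assumes "\<not> near0 f y e" "e > 0" "y - e < q1" "q1 < y - e / 2" "y + e / 2 < q2" "q2 < y + e"
  shows "\<exists>q\<in>{q1, q2}. moving S q \<and> reach S q y \<and> (\<exists>z. reach S y z \<and> \<bar>z - y\<bar> \<ge> e / 2)"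
proof -
  show ?thesis using not_near0_right[OF assms(1,2)]
  proof
    assume "\<forall>x. \<bar>x - y\<bar> < e \<longrightarrow> rightward S x"
    then show ?thesis using plateau_rightward[OF assms(1,2) _ assms(3,4)] by blast
  next
    assume a: "\<forall>x. \<bar>x - y\<bar> < e \<longrightarrow> rightward (mirror S) (- x)"
    have "rightward (mirror S) x" if "\<bar>x - - y\<bar> < e" for x
      using a[rule_format, of "- x"] that by (simp add: abs_minus_commute)
    then have "moving (mirror S) (- q2) \<and> reach (mirror S) (- q2) (- y) \<and>
        (\<exists>z. reach (mirror S) (- y) z \<and> \<bar>z - - y\<bar> \<ge> e / 2)"
      by (intro flow.plateau_rightward[OF reflect]) (use assms in \<open>auto simp: near0_reflect\<close>)
    then have "moving S q2 \<and> reach S q2 y \<and> (\<exists>z. reach S y (- z) \<and> \<bar>z - - y\<bar> \<ge> e / 2)"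
      unfolding moving_reflect reach_reflect by simp
    moreover have "\<bar>- z - y\<bar> = \<bar>z - - y\<bar>" for z by simp
    ultimately show ?thesis by (metis insertCI)
  qed
qed

end

section \<open>Smoothing a trajectory in time\<close>

definition interp :: "(int \<Rightarrow> real) \<Rightarrow> real \<Rightarrow> real" where
  "interp c t = c \<lfloor>t\<rfloor> + (c (\<lfloor>t\<rfloor> + 1) - c \<lfloor>t\<rfloor>) * step (t - of_int \<lfloor>t\<rfloor>)"

lemma interp_cell:
  assumes "of_int k \<le> t" "t \<le> of_int k + 1"
  shows "interp c t = c k + (c (k + 1) - c k) * step (t - of_int k)"
proof (cases "t = of_int k + 1")
  case True
  then have "\<lfloor>t\<rfloor> = k + 1" by simp
  then show ?thesis using True by (simp add: interp_def step_0 step_1)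
next
  case False
  then have "\<lfloor>t\<rfloor> = k" using assms by linarith
  then show ?thesis by (simp add: interp_def)
qed

lemma cinf_interp: "cinf (interp c)"
proof (rule cinf_local)
  fix x :: real
  define k where "k = \<lfloor>x\<rfloor>"
  \<comment> \<open>One formula serves both cells around the node k: on the right cell the first
    step has already reached 1, on the left cell the second is still 0.\<close>
  define h where "h t = (c (k - 1) + (c k - c (k - 1)) * step ((1 - of_int k) + 1 * t))
    + (c (k + 1) - c k) * step (- of_int k + 1 * t)" for t
  have "cinf h" unfolding h_def
    by (rule cinf_add[OF cinf_add[OF cinf_const cinf_mult[OF cinf_const cinf_compose[OF cinf_step cinf_affine]]]
          cinf_mult[OF cinf_const cinf_compose[OF cinf_step cinf_affine]]])
  moreover have "\<forall>\<^sub>F y in nhds x. interp c y = h y"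
  proof -
    have "x \<in> {of_int k - 1<..<of_int k + 1}" by (simp add: k_def) linarith
    then have "\<forall>\<^sub>F y in nhds x. y \<in> {of_int k - 1<..<of_int k + 1}"
      by (intro eventually_nhds_in_open) auto
    then show ?thesis
    proof eventually_elim
      case (elim y)
      show ?case
      proof (cases "y \<ge> of_int k")
        case True
        then show ?thesis using elim interp_cell[of k y c]
          by (simp add: h_def step_1 algebra_simps)
      next
        case False
        then show ?thesis using elim interp_cell[of "k - 1" y c]
          by (simp add: h_def step_0 algebra_simps)
      qed
    qed
  qed
  ultimately show "\<exists>h. cinf h \<and> (\<forall>\<^sub>F y in nhds x. interp c y = h y)" by blast
qed

lemma interp_between:
  "min (c \<lfloor>t\<rfloor>) (c (\<lfloor>t\<rfloor> + 1)) \<le> interp c t" "interp c t \<le> max (c \<lfloor>t\<rfloor>) (c (\<lfloor>t\<rfloor> + 1))"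
proof -
  define a b s where "a = c \<lfloor>t\<rfloor>" and "b = c (\<lfloor>t\<rfloor> + 1)" and "s = step (t - of_int \<lfloor>t\<rfloor>)"
  have s: "0 \<le> s" "s \<le> 1" by (auto simp: s_def step_ge_0 step_le_1)
  have i: "interp c t = a + (b - a) * s" by (simp add: interp_def a_def b_def s_def)
  have "min a b \<le> a + (b - a) * s \<and> a + (b - a) * s \<le> max a b"
  proof (cases "a \<le> b")
    case True
    then have "0 \<le> (b - a) * s" "(b - a) * s \<le> (b - a) * 1"
      using s by (simp_all add: mult_left_le)
    then show ?thesis using True by simp
  next
    case False
    then have "0 \<le> (a - b) * s" "(a - b) * s \<le> (a - b) * 1"
      using s by (simp_all add: mult_left_le)
    then show ?thesis using False by (simp add: algebra_simps)
  qed
  then show "min (c \<lfloor>t\<rfloor>) (c (\<lfloor>t\<rfloor> + 1)) \<le> interp c t" "interp c t \<le> max (c \<lfloor>t\<rfloor>) (c (\<lfloor>t\<rfloor> + 1))"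
    unfolding i a_def b_def by auto
qed

text \<open>Mollifying a trajectory in time rather than the vector field in space keeps the error
  uniform in time: the speed of \<open>q\<close> interpolates the difference quotients of \<open>p\<close> of step \<open>h\<close>.\<close>

locale smoothing =
  fixes p :: "real \<Rightarrow> real" and L h :: real
  assumes inc: "0 \<le> s \<Longrightarrow> s < t \<Longrightarrow> p s < p t"
    and lip: "0 \<le> s \<Longrightarrow> s \<le> t \<Longrightarrow> p t - p s \<le> L * (t - s)"
    and unbounded: "\<exists>t\<ge>0. p t > B"
    and h: "h > 0"
begin

definition slope :: "real \<Rightarrow> real" where
  "slope u = (p (u + h) - p u) / h"

text \<open>The clamp \<open>max 0 k\<close> repeats the first quotient at negative times, so the
  curve continues as a straight line behind its start. The form \<open>0 + (1 / h) * t\<close>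
  matches \<open>cinf_affine\<close>.\<close>

definition speed :: "real \<Rightarrow> real" where
  "speed t = interp (\<lambda>k. slope (h * real_of_int (max 0 k))) (0 + (1 / h) * t)"

lemma slope_pos: "u \<ge> 0 \<Longrightarrow> slope u > 0"
  using inc[of u "u + h"] h by (simp add: slope_def)

lemma slope_le: "u \<ge> 0 \<Longrightarrow> slope u \<le> L"
  using lip[of u "u + h"] h by (simp add: slope_def divide_simps mult.commute)

lemma L_pos: "L > 0"
  using slope_pos[of 0] slope_le[of 0] by simp

lemma inc_le: "0 \<le> s \<Longrightarrow> s \<le> t \<Longrightarrow> p s \<le> p t"
  using inc[of s t] by (cases "s = t") auto

lemma cinf_speed: "cinf speed"
  unfolding speed_def[abs_def] by (rule cinf_compose[OF cinf_interp cinf_affine])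

lemma speed_between:
  "\<exists>u1 u2. {u1, u2} \<subseteq> {max 0 (t - h)..max 0 t + 2 * h} \<and> slope u1 \<le> speed t \<and> speed t \<le> slope u2"
proof -
  define k where "k = \<lfloor>0 + (1 / h) * t\<rfloor>"
  define u where "u j = h * real_of_int (max 0 j)" for j
  have "real_of_int k \<le> t / h" "t / h < real_of_int k + 1" by (simp_all add: k_def)
  then have k: "h * real_of_int k \<le> t" "t < h * real_of_int k + h"
    using h by (simp_all add: field_simps)
  have u: "u k \<in> {max 0 (t - h)..max 0 t + 2 * h}" "u (k + 1) \<in> {max 0 (t - h)..max 0 t + 2 * h}"
  proof -
    consider "k \<ge> 0" | "k < 0" by linarith
    then have "u k \<in> {max 0 (t - h)..max 0 t + 2 * h} \<and> u (k + 1) \<in> {max 0 (t - h)..max 0 t + 2 * h}"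
    proof cases
      case 1
      then have "u k = h * real_of_int k" "u (k + 1) = h * real_of_int k + h" "0 \<le> h * real_of_int k"
        using h by (simp_all add: u_def algebra_simps)
      then show ?thesis using k h by auto
    next
      case 2
      then have "real_of_int k + 1 \<le> 0" by linarith
      then have "h * (real_of_int k + 1) \<le> 0" using h by (simp add: mult_nonneg_nonpos)
      then have "t < 0" using k by (simp add: algebra_simps)
      moreover have "u k = 0" "u (k + 1) = 0" using 2 by (auto simp: u_def)
      ultimately show ?thesis using h by auto
    qed
    then show "u k \<in> {max 0 (t - h)..max 0 t + 2 * h}" "u (k + 1) \<in> {max 0 (t - h)..max 0 t + 2 * h}"
      by auto
  qed
  have "min (slope (u k)) (slope (u (k + 1))) \<le> speed t \<and> speed t \<le> max (slope (u k)) (slope (u (k + 1)))"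
    using interp_between[of "\<lambda>k. slope (u k)" "0 + (1 / h) * t"]
    by (simp add: speed_def u_def k_def)
  then show ?thesis using u by (auto simp: min_def max_def split: if_splits)
qed

lemma speed_pos: "speed t > 0" and speed_le: "speed t \<le> L"
proof -
  obtain u1 u2 where "{u1, u2} \<subseteq> {max 0 (t - h)..max 0 t + 2 * h}"
    "slope u1 \<le> speed t" "speed t \<le> slope u2" using speed_between by blast
  then show "speed t > 0" "speed t \<le> L"
    using slope_pos[of u1] slope_le[of u2] by auto
qed

definition q :: "real \<Rightarrow> real" where
  "q = (SOME q. q 0 = p 0 \<and> (\<forall>t. (q has_real_derivative speed t) (at t)))"

lemma q_0 [simp]: "q 0 = p 0" and q_deriv: "(q has_real_derivative speed t) (at t)"
proof -
  have "\<exists>q. q 0 = p 0 \<and> (\<forall>t. (q has_real_derivative speed t) (at t))"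
    using antiderivative[OF cinf_continuous[OF cinf_speed]] by metis
  from someI_ex[OF this] show "q 0 = p 0" "(q has_real_derivative speed t) (at t)"
    unfolding q_def by auto
qed

lemma q_less: "s < t \<Longrightarrow> q s < q t"
  by (rule DERIV_pos_imp_increasing) (use q_deriv speed_pos in auto)

lemma q_less_iff: "q s < q t \<longleftrightarrow> s < t"
  using q_less[of s t] q_less[of t s] by (cases s t rule: linorder_cases) auto

lemma q_le_iff: "q s \<le> q t \<longleftrightarrow> s \<le> t"
  using q_less_iff[of t s] by auto

lemma q_lip: "s \<le> t \<Longrightarrow> q t - q s \<le> L * (t - s)"
proof -
  assume "s \<le> t"
  then have "L * s - q s \<le> L * t - q t"
  proof (rule DERIV_nonneg_imp_nondecreasing)
    fix x
    show "\<exists>y. ((\<lambda>a. L * a - q a) has_real_derivative y) (at x) \<and> 0 \<le> y"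
      using speed_le[of x]
      by (intro exI[of _ "L - speed x"]) (auto intro!: derivative_eq_intros q_deriv)
  qed
  then show ?thesis by (simp add: algebra_simps)
qed

lemma q_cont: "continuous_on A q"
  using q_deriv by (meson DERIV_isCont continuous_at_imp_continuous_on)

text \<open>\<open>I\<close> is the integral of \<open>step\<close> over [0,1]. A cell contributes 1
  - I times the increment of p over it plus I times the increment over the next cell. Both sums
  telescope, hence the error does not grow with k.\<close>

lemma q_nodes:
  "\<exists>I. 0 \<le> I \<and> I \<le> 1 \<and> (\<forall>k. q (h * real k) =
    p 0 + (1 - I) * (p (h * real k) - p 0) + I * (p (h * real k + h) - p h))"
proof -
  obtain J where J: "J 0 = 0" "\<And>x. (J has_real_derivative step x) (at x)"
    using antiderivative[OF cinf_continuous[OF cinf_step]] by metis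
  have J1: "0 \<le> J 1"
    using DERIV_nonneg_imp_nondecreasing[of 0 1 J] J step_ge_0 by force
  have "0 - J 0 \<le> 1 - J 1"
  proof (rule DERIV_nonneg_imp_nondecreasing[of 0 1 "\<lambda>x. x - J x"])
    fix x :: real
    show "\<exists>y. ((\<lambda>x. x - J x) has_real_derivative y) (at x) \<and> 0 \<le> y"
      using step_le_1[of x]
      by (intro exI[of _ "1 - step x"]) (auto intro!: derivative_eq_intros J)
  qed simp
  then have J2: "J 1 \<le> 1" using J by simp
  have step: "q (h * real k + h) - q (h * real k) =
    (1 - J 1) * (p (h * real k + h) - p (h * real k)) + J 1 * (p (h * real k + h + h) - p (h * real k + h))" for k
  proof -
    define a where "a = h * real k"
    define c where "c j = slope (h * real_of_int (max 0 j))" for j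
    define F where "F t = q t - (c (int k) * t + (c (int k + 1) - c (int k)) * h * J ((t - a) / h))" for t
    have "F (a + h) = F a"
    proof (rule DERIV_isconst_end[of a "a + h" F])
      show "a < a + h" using h by simp
      have FD: "(F has_real_derivative speed t - (c (int k) + (c (int k + 1) - c (int k)) * step ((t - a) / h))) (at t)" for t
        unfolding F_def using h
        by (auto intro!: derivative_eq_intros q_deriv DERIV_chain2[OF J(2)])
      then show "continuous_on {a..a + h} F"
        by (meson DERIV_isCont continuous_at_imp_continuous_on)
      show "(F has_real_derivative 0) (at t)" if "a < t" "t < a + h" for t
      proof -
        have "speed t = c (int k) + (c (int k + 1) - c (int k)) * step (0 + 1 / h * t - of_int (int k))"
          unfolding speed_def c_def
          by (rule interp_cell) (use that h in \<open>auto simp: a_def field_simps\<close>)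
        also have "0 + 1 / h * t - of_int (int k) = (t - a) / h"
          using h by (simp add: a_def field_simps)
        finally show ?thesis using FD[of t] by simp
      qed
    qed
    moreover have "(a + h - a) / h = 1" using h by simp
    ultimately have "q (a + h) - q a = c (int k) * h + (c (int k + 1) - c (int k)) * h * J 1"
      unfolding F_def using J(1) by (simp add: algebra_simps)
    also have "\<dots> = (1 - J 1) * (c (int k) * h) + J 1 * (c (int k + 1) * h)"
      by (simp add: algebra_simps)
    also have "c (int k) * h = p (a + h) - p a"
      using h by (simp add: c_def slope_def a_def)
    also have "c (int k + 1) * h = p (a + h + h) - p (a + h)"
    proof -
      have "h * real_of_int (max 0 (int k + 1)) = a + h" by (simp add: a_def algebra_simps)
      then show ?thesis using h by (simp add: c_def slope_def)
    qed
    finally show ?thesis by (simp add: a_def)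
  qed
  have "q (h * real k) = p 0 + (1 - J 1) * (p (h * real k) - p 0) + J 1 * (p (h * real k + h) - p h)" for k
  proof (induction k)
    case (Suc k)
    have "h * real (Suc k) = h * real k + h" by (simp add: algebra_simps)
    then show ?case using Suc step[of k] by (simp add: algebra_simps)
  qed simp
  then show ?thesis using J1 J2 by blast
qed

text \<open>One L h is lost by rounding t to a node, the other is p h - p 0 from
  \<open>q_nodes\<close>. The upper bound is a shift in time rather than in space, so that q t stays
  below a position that p really attains.\<close>

lemma q_bounds:
  assumes "t \<ge> 0"
  shows "p t - 2 * L * h \<le> q t" and "q t \<le> p (t + 2 * h)"
proof -
  obtain I where I: "0 \<le> I" "I \<le> 1" "\<And>k. q (h * real k) =
    p 0 + (1 - I) * (p (h * real k) - p 0) + I * (p (h * real k + h) - p h)"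
    using q_nodes by blast
  define k where "k = nat \<lfloor>t / h\<rfloor>"
  have "real k = of_int \<lfloor>t / h\<rfloor>" using assms h by (simp add: k_def)
  then have "real k \<le> t / h" "t / h < real k + 1" by linarith+
  then have k: "h * real k \<le> t" "t \<le> h * real k + h" using h by (simp_all add: field_simps)
  have k0: "0 \<le> h * real k" using h by simp
  have up: "q (h * real k) \<le> p (h * real k + h)" for k
  proof -
    have "0 \<le> h * real k" using h by simp
    then have "p (h * real k) \<le> p (h * real k + h)" "p 0 \<le> p h" using h by (auto intro!: inc_le)
    then have "(1 - I) * (p (h * real k) - p 0) \<le> (1 - I) * (p (h * real k + h) - p 0)"
      "I * (p (h * real k + h) - p h) \<le> I * (p (h * real k + h) - p 0)"
      using I by (auto intro!: mult_left_mono)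
    then show ?thesis unfolding I(3) by (simp add: algebra_simps)
  qed
  have "q t \<le> q (h * real (Suc k))" using k by (simp add: q_le_iff algebra_simps)
  also have "\<dots> \<le> p (h * real (Suc k) + h)" by (rule up)
  also have "\<dots> \<le> p (t + 2 * h)" using k h k0 by (intro inc_le) (auto simp: algebra_simps)
  finally show "q t \<le> p (t + 2 * h)" .
  have "p t \<le> p (h * real k) + L * h"
  proof -
    have "L * (t - h * real k) \<le> L * h" using k L_pos by (intro mult_left_mono) auto
    then show ?thesis using lip[OF k0 k(1)] by linarith
  qed
  moreover have "p (h * real k) - L * h \<le> q (h * real k)"
  proof -
    have "p (h * real k) \<le> p (h * real k + h)" using h k0 by (intro inc_le) auto
    then have "I * (p (h * real k) - p h) \<le> I * (p (h * real k + h) - p h)"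
      using I by (intro mult_left_mono) auto
    moreover have "I * (p h - p 0) \<le> 1 * (p h - p 0)"
      using I inc_le[of 0 h] h by (intro mult_right_mono) auto
    ultimately have "p (h * real k) - (p h - p 0) \<le> q (h * real k)"
      unfolding I(3) by (simp add: algebra_simps)
    then show ?thesis using lip[of 0 h] h by simp
  qed
  moreover have "q (h * real k) \<le> q t" using k by (simp add: q_le_iff)
  ultimately show "p t - 2 * L * h \<le> q t" by simp
qed

text \<open>Behind the start the curve is a line of slope \<open>slope 0\<close> > 0; ahead, it
  inherits unboundedness from p.\<close>

lemma q_surj: "\<exists>t. q t = y"
proof -
  obtain b where b: "b \<ge> 0" "p b > y + 2 * L * h" using unbounded by blast
  then have up: "y \<le> q b" using q_bounds(1)[of b] by simp
  have low: "q t = p 0 + slope 0 * t" if "t \<le> 0" for t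
  proof (cases "t = 0")
    case False
    have "q t - slope 0 * t = q 0 - slope 0 * 0"
    proof (rule DERIV_isconst_end[of t 0 "\<lambda>t. q t - slope 0 * t", symmetric])
      have D: "((\<lambda>t. q t - slope 0 * t) has_real_derivative speed s - slope 0) (at s)" for s
        by (auto intro!: derivative_eq_intros q_deriv)
      then show "continuous_on {t..0} (\<lambda>t. q t - slope 0 * t)"
        by (meson DERIV_isCont continuous_at_imp_continuous_on)
      show "((\<lambda>t. q t - slope 0 * t) has_real_derivative 0) (at s)" if "t < s" "s < 0" for s
      proof -
        have "s / h < 0" using that h by (simp add: divide_neg_pos)
        then have "\<lfloor>s / h\<rfloor> < 0" by simp
        then have "max 0 \<lfloor>s / h\<rfloor> = 0" "max 0 (\<lfloor>s / h\<rfloor> + 1) = 0" by linarith+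
        then have "speed s = slope 0" by (simp add: speed_def interp_def)
        then show ?thesis using D[of s] by simp
      qed
    qed (use that False in simp)
    then show ?thesis by simp
  qed simp
  define a where "a = min 0 ((y - p 0) / slope 0)"
  have "slope 0 * a \<le> y - p 0"
    using slope_pos[of 0] by (simp add: a_def min_def field_simps)
  then have "q a \<le> y" using low[of a] by (simp add: a_def)
  moreover have "a \<le> b" using b by (simp add: a_def)
  ultimately show ?thesis using IVT'[of q a y b] up q_cont by blast
qed

definition Q :: "real \<Rightarrow> real" where
  "Q y = (THE t. q t = y)"

lemma Q_q [simp]: "Q (q t) = t"
  unfolding Q_def
proof (rule the_equality)
  show "s = t" if "q s = q t" for s
    using that q_le_iff[of s t] q_le_iff[of t s] by simp
qed simp

lemma q_Q [simp]: "q (Q y) = y"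
  using q_surj[of y] by auto

lemma Q_cont: "continuous_on UNIV Q"
proof (rule continuous_at_imp_continuous_on, rule ballI)
  fix y
  have "isCont Q (q (Q y))"
    by (rule isCont_inverse_function[of 1]) (use q_deriv DERIV_isCont in auto)
  then show "isCont Q y" by simp
qed

lemma cinf_Q: "cinf Q"
  unfolding cinf_def
proof
  show "ck k Q" for k
    by (rule ck_inv_fun[OF q_deriv speed_pos]) (use cinf_speed Q_cont in \<open>auto simp: cinf_def\<close>)
qed

end

section \<open>Cutoff in the time parameter, and the resulting change of time\<close>

lemma cutoff:
  fixes T h \<delta> :: real
  assumes "h > 0" "\<delta> > 0"
  obtains \<kappa> C where "cinf \<kappa>" "C > 0" "\<And>s t. \<bar>\<kappa> s - \<kappa> t\<bar> \<le> C * \<bar>s - t\<bar>" "\<And>t. 0 \<le> \<kappa> t" "\<And>t. \<kappa> t \<le> 1"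
    "\<And>t. t \<le> - \<delta> \<Longrightarrow> \<kappa> t = 0" "\<And>t. 0 \<le> t \<Longrightarrow> fin \<longrightarrow> t \<le> T \<Longrightarrow> \<kappa> t = 1"
    "\<And>t. fin \<Longrightarrow> T + h \<le> t \<Longrightarrow> \<kappa> t = 0"
proof -
  obtain L where L: "L \<ge> 0" "\<And>x y. \<bar>step x - step y\<bar> \<le> L * \<bar>x - y\<bar>"
    using step_lipschitz by blast
  \<comment> \<open>\<open>c + b * t\<close> is (T + h - t) / h if \<open>fin\<close> holds.
    Otherwise it is 1, so the right factor is constantly 1: an unbounded orbit has no end to be cut
    off.\<close>
  define b where "b = (if fin then - 1 / h else 0)"
  define c where "c = (if fin then (T + h) / h else 1)"
  define l where "l t = step (1 + (1 / \<delta>) * t)" for t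
  define r where "r t = step (c + b * t)" for t
  have lip: "\<bar>step (x + y * s) - step (x + y * t)\<bar> \<le> L * \<bar>y\<bar> * \<bar>s - t\<bar>" for x y s t
    using L(2)[of "x + y * s" "x + y * t"]
    by (simp add: right_diff_distrib[symmetric] abs_mult mult.assoc)
  show ?thesis
  \<comment> \<open>The summand 1 makes the constant positive, as \<open>time_change\<close>
    requires.\<close>
  proof (rule that[of "\<lambda>t. l t * r t" "L * (1 / \<delta>) + L * \<bar>b\<bar> + 1"])
    show "cinf (\<lambda>t. l t * r t)" unfolding l_def r_def
      by (rule cinf_mult[OF cinf_compose[OF cinf_step cinf_affine] cinf_compose[OF cinf_step cinf_affine]])
    show "L * (1 / \<delta>) + L * \<bar>b\<bar> + 1 > 0" using L assms by (simp add: add_nonneg_pos)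
    fix s t
    have lr: "0 \<le> l t" "l t \<le> 1" "0 \<le> r t" "r t \<le> 1" for t
      by (auto simp: l_def r_def step_ge_0 step_le_1)
    have "\<bar>l s * r s - l t * r t\<bar> = \<bar>(l s - l t) * r s + l t * (r s - r t)\<bar>" by (simp add: algebra_simps)
    also have "\<dots> \<le> \<bar>l s - l t\<bar> * r s + l t * \<bar>r s - r t\<bar>"
      using lr by (metis abs_mult abs_of_nonneg abs_triangle_ineq)
    also have "\<dots> \<le> \<bar>l s - l t\<bar> * 1 + 1 * \<bar>r s - r t\<bar>"
      using lr by (intro add_mono mult_mono) auto
    also have "\<dots> \<le> L * (1 / \<delta>) * \<bar>s - t\<bar> + L * \<bar>b\<bar> * \<bar>s - t\<bar>"
      using lip[of 1 "1 / \<delta>" s t] lip[of c b s t] assms by (simp add: l_def r_def)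
    also have "\<dots> \<le> (L * (1 / \<delta>) + L * \<bar>b\<bar> + 1) * \<bar>s - t\<bar>" by (simp add: algebra_simps)
    finally show "\<bar>l s * r s - l t * r t\<bar> \<le> (L * (1 / \<delta>) + L * \<bar>b\<bar> + 1) * \<bar>s - t\<bar>" .
    show "0 \<le> l t * r t" "l t * r t \<le> 1" using lr by (auto intro: mult_le_one)
    show "l t * r t = 0" if "t \<le> - \<delta>"
      using that assms by (simp add: l_def step_0 field_simps)
    show "l t * r t = 1" if "0 \<le> t" "fin \<longrightarrow> t \<le> T"
    proof -
      have "l t = 1" using that assms by (simp add: l_def step_1)
      moreover have "r t = 1" using that assms
        by (cases fin) (auto simp: r_def b_def c_def step_1 field_simps)
      ultimately show ?thesis by simp
    qed
    show "l t * r t = 0" if "fin" "T + h \<le> t"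
    proof -
      have "c + b * t = (T + h - t) / h"
        using that by (simp add: b_def c_def add_divide_distrib diff_divide_distrib)
      also have "\<dots> \<le> 0" using that assms by (simp add: divide_nonpos_pos)
      finally show ?thesis by (simp add: r_def step_0)
    qed
  qed
qed

text \<open>If \<theta> solves this scalar equation, then q \<circ> \<theta> solves the equation of
  the cut-off field. Since \<kappa> is bounded and Lipschitz, global existence never has to be shown
  for the field directly.\<close>

lemma time_change:
  fixes \<kappa> :: "real \<Rightarrow> real"
  assumes lip: "\<And>s t. \<bar>\<kappa> s - \<kappa> t\<bar> \<le> C * \<bar>s - t\<bar>" "C > 0" and k01: "\<And>t. 0 \<le> \<kappa> t" "\<And>t. \<kappa> t \<le> 1"
  obtains \<theta> where "\<theta> 0 = a" "\<And>t. 0 \<le> t \<Longrightarrow> (\<theta> has_real_derivative \<kappa> (\<theta> t)) (at t within {0..})"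
    "\<And>t. 0 \<le> t \<Longrightarrow> a \<le> \<theta> t" "\<And>t. 0 \<le> t \<Longrightarrow> \<theta> t \<le> a + t"
    "\<And>B t. 0 \<le> t \<Longrightarrow> a \<le> B \<Longrightarrow> (\<And>s. B \<le> s \<Longrightarrow> \<kappa> s = 0) \<Longrightarrow> \<theta> t \<le> B"
    "\<And>B t. 0 \<le> t \<Longrightarrow> (\<And>s. a \<le> s \<Longrightarrow> s \<le> B \<Longrightarrow> \<kappa> s = 1) \<Longrightarrow> \<theta> t \<le> B \<Longrightarrow> \<theta> t = a + t"
proof -
  have k1: "\<bar>\<kappa> t\<bar> \<le> 1" for t using k01[of t] by simp
  obtain \<theta> where \<theta>0: "\<theta> 0 = a"
    and "\<forall>t\<ge>0. (\<theta> has_real_derivative \<kappa> (\<theta> t)) (at t within {0..})"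
    using picard[OF lip k1, of a] by auto
  then have \<theta>: "(\<theta> has_real_derivative \<kappa> (\<theta> t)) (at t within {0..})" if "0 \<le> t" for t
    using that by auto
  have D: "(\<theta> has_real_derivative \<kappa> (\<theta> t)) (at t)" if "0 < t" for t
  proof -
    have "(\<theta> has_real_derivative \<kappa> (\<theta> t)) (at t within {0<..})"
      by (rule has_field_derivative_subset[OF \<theta>]) (use that in auto)
    then show ?thesis using that by (simp add: at_within_open[of t "{0<..}"])
  qed
  have c: "continuous_on {s..t} \<theta>" if "0 \<le> s" for s t
  proof -
    have "continuous_on {0..} \<theta>"
      unfolding continuous_on_eq_continuous_within using DERIV_continuous[OF \<theta>] by simp
    then show ?thesis by (rule continuous_on_subset) (use that in auto)
  qed
  have mono: "\<theta> s \<le> \<theta> t" if "0 \<le> s" "s \<le> t" for s t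
  proof (rule DERIV_nonneg_imp_increasing_open[OF that(2)])
    show "\<exists>y. (\<theta> has_real_derivative y) (at u) \<and> 0 \<le> y" if "s < u" "u < t" for u
      using D[of u] k01 that \<open>0 \<le> s\<close> by (intro exI[of _ "\<kappa> (\<theta> u)"]) auto
  qed (rule c[OF that(1)])
  have up: "\<theta> t \<le> a + t" if "0 \<le> t" for t
  proof -
    have "0 - \<theta> 0 \<le> t - \<theta> t"
    proof (rule DERIV_nonneg_imp_increasing_open[OF that, of "\<lambda>t. t - \<theta> t"])
      show "\<exists>y. ((\<lambda>t. t - \<theta> t) has_real_derivative y) (at u) \<and> 0 \<le> y" if "0 < u" "u < t" for u
        using DERIV_diff[OF DERIV_ident D[OF that(1)]] k01 by (intro exI[of _ "1 - \<kappa> (\<theta> u)"]) auto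
      show "continuous_on {0..t} (\<lambda>t. t - \<theta> t)" by (intro continuous_intros c) simp
    qed
    then show ?thesis using \<theta>0 by simp
  qed
  show ?thesis
  proof (rule that[of \<theta>])
    show "a \<le> \<theta> t" if "0 \<le> t" for t using mono[of 0 t] \<theta>0 that by simp
    show "\<theta> t \<le> B" if tB: "0 \<le> t" "a \<le> B" and z: "\<And>s. B \<le> s \<Longrightarrow> \<kappa> s = 0" for B t
    proof (rule ccontr)
      assume n: "\<not> \<theta> t \<le> B"
      then obtain u where u: "0 \<le> u" "u \<le> t" "\<theta> u = B"
        using IVT'[of \<theta> 0 B t] \<theta>0 tB c by auto
      then have "u < t" using n by (cases "u = t") auto
      then have "\<theta> t = \<theta> u"
      proof (rule DERIV_isconst_end)
        show "(\<theta> has_real_derivative 0) (at s)" if "u < s" "s < t" for s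
          using D[of s] z[of "\<theta> s"] mono[of u s] u that by simp
      qed (rule c[OF u(1)])
      then show False using n u by simp
    qed
    show "\<theta> t = a + t" if "0 \<le> t" and one: "\<And>s. a \<le> s \<Longrightarrow> s \<le> B \<Longrightarrow> \<kappa> s = 1" and B: "\<theta> t \<le> B" for B t
    proof (cases "t = 0")
      case False
      then have "\<theta> t - t = \<theta> 0 - 0"
      proof (intro DERIV_isconst_end[of 0 t "\<lambda>t. \<theta> t - t"])
        show "((\<lambda>t. \<theta> t - t) has_real_derivative 0) (at s)" if "0 < s" "s < t" for s
        proof -
          have "\<kappa> (\<theta> s) = 1" using one mono[of 0 s] mono[of s t] \<theta>0 B that by auto
          then show ?thesis using DERIV_diff[OF D[OF that(1)] DERIV_ident] by simp
        qed
        show "continuous_on {0..t} (\<lambda>t. \<theta> t - t)" by (intro continuous_intros c) simp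
      qed (use that False in simp)
      then show ?thesis using \<theta>0 by simp
    qed (use \<theta>0 in simp)
  qed (use \<theta>0 \<theta> up in auto)
qed

section \<open>A smooth field following one orbit\<close>

text \<open>Two one-sided bounds suffice, as the convexification contains all intermediate
  values.\<close>

definition near :: "(real \<Rightarrow> real) \<Rightarrow> real \<Rightarrow> real \<Rightarrow> real \<Rightarrow> bool" where
  "near f e y v \<longleftrightarrow>
     (\<exists>y1 y2. \<bar>y1 - y\<bar> < e \<and> \<bar>y2 - y\<bar> < e \<and> f y1 - e \<le> v \<and> v \<le> f y2 + e)"

text \<open>\<open>core S e x K\<close>: \<open>K\<close> is the part of the orbit of \<open>x\<close> that is followed with precision \<open>e\<close>. It is
  closed and stays away from the limit of the orbit, which may itself start another orbit. \<open>K\<close> has to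
  be known before the radius \<open>r\<close> of the cutoff behind \<open>x\<close>, as \<open>r\<close> depends on the distance to the cores
  of the other orbits.\<close>

definition core :: "(real \<Rightarrow> real \<Rightarrow> real) \<Rightarrow> real \<Rightarrow> real \<Rightarrow> real set \<Rightarrow> bool" where
  "core S e x K \<longleftrightarrow> closed K \<and> x \<in> K \<and> (\<forall>y\<in>K. reach S x y \<and> moving S y) \<and>
     (\<forall>y z. reach S x y \<longrightarrow> reach S y z \<longrightarrow> e \<le> \<bar>z - y\<bar> \<longrightarrow> y \<in> K)"

text \<open>The cutoff is the fraction k; where at least e of the orbit lies ahead, the value itself
  is admissible. Solutions have to remain in \<open>K \<union> ball x r\<close>, outside of which g
  vanishes, so that blocks with disjoint sets of this kind can be added. At time t1 the smoothed
  curve is at x0, and the orbit of x is only close to it.\<close>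

definition block ::
  "(real \<Rightarrow> real) \<Rightarrow> (real \<Rightarrow> real \<Rightarrow> real) \<Rightarrow> real \<Rightarrow> real \<Rightarrow> real set \<Rightarrow> real \<Rightarrow> (real \<Rightarrow> real) \<Rightarrow> bool" where
  "block f S e x K r g \<longleftrightarrow> cinf g \<and> (\<forall>y. y \<notin> K \<union> ball x r \<longrightarrow> g y = 0) \<and>
     (\<forall>y. \<exists>k v. 0 \<le> k \<and> k \<le> 1 \<and> near f e y v \<and> g y = k * v) \<and>
     (\<forall>y z. reach S x y \<longrightarrow> reach S y z \<longrightarrow> e \<le> \<bar>z - y\<bar> \<longrightarrow> near f e y (g y)) \<and>
     (\<forall>x0\<in>K \<union> ball x r. \<exists>X. caratheodory_solution g x0 X \<and> (\<forall>t\<ge>0. X t \<in> K \<union> ball x r) \<and>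
        (x0 \<in> K \<longrightarrow> (\<exists>t1\<ge>0. \<bar>S t1 x - x0\<bar> \<le> e \<and> (\<forall>t\<ge>0. \<bar>X t - S (t1 + t) x\<bar> \<le> e))))"

context flow
begin

lemma moving_strict:
  assumes "rightward S x" "0 \<le> s" "s < t" "S s x < S u x" "0 \<le> u"
  shows "S s x < S t x"
proof -
  have "s < u" using mono[OF assms(1,5), of s] assms(4) by force
  then have "S (u - s) (S s x) = S u x" using SS[of s "u - s" x] assms by simp
  then have "moving S (S s x)"
    unfolding moving_def using assms \<open>s < u\<close> by (intro exI[of _ "u - s"]) auto
  then show ?thesis using strict assms by blast
qed

text \<open>A bounded trajectory is followed until just before its end point and then continued with
  unit speed, so that the smoothed trajectory is a diffeomorphism of the line.\<close>

lemma prolongation: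
  assumes rx: "rightward S x" and e: "e > 0"
  obtains T T' p fin where "0 \<le> T" "T < T'" "\<And>h. h > 0 \<Longrightarrow> smoothing p (M + 1) h"
    "\<And>t. 0 \<le> t \<Longrightarrow> fin \<longrightarrow> t \<le> T' \<Longrightarrow> p t = S t x"
    "\<And>t. 0 \<le> t \<Longrightarrow> fin \<longrightarrow> t \<le> T' \<Longrightarrow> moving S (S t x)"
    "\<And>t u. fin \<Longrightarrow> T \<le> t \<Longrightarrow> T \<le> u \<Longrightarrow> \<bar>S t x - S u x\<bar> \<le> e"
proof (cases "\<forall>B. \<exists>t\<ge>0. S t x > B")
  case True
  have mv: "moving S (S t x)" if t: "0 \<le> t" for t
  proof -
    obtain u where "u \<ge> 0" "S u x > S t x" using True by blast
    then have "t < u" using mono[OF rx, of u t] by force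
    then have "S t x < S (t + 1) x" using moving_strict[OF rx t, of "t + 1" u] \<open>S u x > S t x\<close> \<open>u \<ge> 0\<close> by simp
    then show ?thesis unfolding moving_def using SS[of t 1 x] t by (intro exI[of _ 1]) auto
  qed
  have "smoothing (\<lambda>t. S t x) (M + 1) h" if "h > 0" for h
  proof
    fix s t :: real assume st: "0 \<le> s" "s \<le> t"
    have "M * (t - s) \<le> (M + 1) * (t - s)" using st by (intro mult_right_mono) auto
    then show "S t x - S s x \<le> (M + 1) * (t - s)" using lip[OF st, of x] by linarith
  qed (use True that mv strict[OF rx] in auto)
  then show ?thesis using that[of 0 1 "\<lambda>t. S t x" False] mv by auto
next
  case False
  then obtain B where B: "\<And>t. t \<ge> 0 \<Longrightarrow> S t x \<le> B" by (meson not_less)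
  define b where "b = (SUP t\<in>{0..}. S t x)"
  have bdd: "bdd_above ((\<lambda>t. S t x) ` {0..})" using B by (auto intro!: bdd_aboveI2)
  have le_b: "S t x \<le> b" if "t \<ge> 0" for t
    unfolding b_def by (rule cSUP_upper[OF _ bdd]) (use that in simp)
  have reach_v: "\<exists>t\<ge>0. S t x = v" if xv: "x \<le> v" "v < b" for v
  proof -
    obtain t where t: "t \<ge> 0" "v < S t x"
      using xv less_cSUP_iff[OF _ bdd, of v] by (auto simp: b_def)
    then show ?thesis using ivt_time[of 0 t x v] xv by auto
  qed
  have xb: "x < b" using rx le_b unfolding rightward_def by force
  \<comment> \<open>v is within e of the supremum b, so at most e of travel remains after T. The
    point w beyond v leaves time between T and T' for the cutoff, and a position
    \<open>S U x\<close> beyond w shows that the orbit still moves up to T'.\<close>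
  define v where "v = (max x (b - e) + b) / 2"
  have v: "x \<le> v" "b - e \<le> v" "v < b" using xb e by (auto simp: v_def)
  obtain T where T: "T \<ge> 0" "S T x = v" using reach_v v by blast
  define w where "w = (v + b) / 2"
  have w: "x \<le> w" "v < w" "w < b" using v by (auto simp: w_def)
  obtain T' where T': "T' \<ge> 0" "S T' x = w" using reach_v w by blast
  obtain U where U: "U \<ge> 0" "w < S U x"
    using w less_cSUP_iff[OF _ bdd, of w] by (auto simp: b_def)
  have TT: "T < T'" using mono[OF rx T'(1), of T] T T' w by force
  have less_U: "S t x < S U x" if "0 \<le> t" "t \<le> T'" for t
    using mono[OF rx that] T' U by simp
  have mv: "moving S (S t x)" if "0 \<le> t" "t \<le> T'" for t
  proof -
    have "S t x < S (t + 1) x" using moving_strict[OF rx that(1), of "t + 1" U] less_U[OF that] U by simp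
    then show ?thesis unfolding moving_def using SS[of t 1 x] that by (intro exI[of _ 1]) auto
  qed
  define p where "p t = S (min t T') x + max 0 (t - T')" for t
  have "smoothing p (M + 1) h" if "h > 0" for h
  proof
    fix s t :: real assume st: "0 \<le> s" "s < t"
    show "p s < p t"
    proof (cases "s < T'")
      case True
      then have "S s x < S (min t T') x" using strict[OF rx st(1)] mv[OF st(1)] st by simp
      then show ?thesis using True by (simp add: p_def)
    qed (use st in \<open>simp add: p_def\<close>)
  next
    fix s t :: real assume st: "0 \<le> s" "s \<le> t"
    have "S (min t T') x - S (min s T') x \<le> M * (min t T' - min s T')"
      using lip[of "min s T'" "min t T'" x] st T' by (auto simp: min_def split: if_splits)
    moreover have "M * (min t T' - min s T') \<le> M * (t - s)"
      using st M_ge_0 by (intro mult_left_mono) (auto simp: min_def)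
    moreover have "max 0 (t - T') - max 0 (s - T') \<le> t - s" using st by (auto simp: max_def)
    ultimately show "p t - p s \<le> (M + 1) * (t - s)" by (simp add: p_def algebra_simps)
  next
    fix B
    show "\<exists>t\<ge>0. B < p t"
      using T' by (intro exI[of _ "T' + \<bar>B - w\<bar> + 1"]) (auto simp: p_def)
  qed (rule that)
  moreover have "\<bar>S t x - S u x\<bar> \<le> e" if "T \<le> t" "T \<le> u" for t u
    using mono[OF rx T(1) that(1)] mono[OF rx T(1) that(2)] le_b[of t] le_b[of u] that T v
    by (auto simp: abs_le_iff)
  ultimately show ?thesis
    using that[of T T' p True] T(1) TT mv by (auto simp: p_def)
qed

lemma block_rightward:
  assumes rx: "rightward S x" and e: "e > 0"
  shows "\<exists>K. core S e x K \<and> (\<forall>r>0. \<exists>g. block f S e x K r g)"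
proof -
  have e4: "e / 4 > 0" using e by simp
  obtain T T' p fin where T: "0 \<le> T" "T < T'" and path: "\<And>h. h > 0 \<Longrightarrow> smoothing p (M + 1) h"
    and pS: "\<And>t. 0 \<le> t \<Longrightarrow> fin \<longrightarrow> t \<le> T' \<Longrightarrow> p t = S t x"
    and mv: "\<And>t. 0 \<le> t \<Longrightarrow> fin \<longrightarrow> t \<le> T' \<Longrightarrow> moving S (S t x)"
    and End: "\<And>t u. fin \<Longrightarrow> T \<le> t \<Longrightarrow> T \<le> u \<Longrightarrow> \<bar>S t x - S u x\<bar> \<le> e / 4"
  proof (rule prolongation[OF rx e4], goal_cases)
    case (1 T T' p fin)
    show ?case by (rule 1(1)[of T T' p fin]) (fact 1)+
  qed
  define L where "L = M + 1"
  have L: "L \<ge> 1" "M \<le> L" using M_ge_0 by (auto simp: L_def)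
  \<comment> \<open>The cutoff ends at T + h, and the estimates look a few more steps of length h
    ahead; five of them fit before T'. With 10 L h \<le> e, errors of a few L h stay below
    e.\<close>
  define h where "h = min ((T' - T) / 5) (e / (10 * L))"
  have h: "h > 0" using T e L by (simp add: h_def)
  have "h \<le> (T' - T) / 5" unfolding h_def by (rule min.cobounded1)
  then have h5: "T + 5 * h \<le> T'" by simp
  have Lh: "10 * (L * h) \<le> e"
  proof -
    have "L * h \<le> L * (e / (10 * L))" using L by (intro mult_left_mono) (auto simp: h_def)
    then show ?thesis using L by simp
  qed
  have Lh0: "L * h > 0" using L h by simp
  interpret P: smoothing p L h unfolding L_def by (rule path[OF h])
  have pS': "p t = S t x" if "0 \<le> t" "fin \<longrightarrow> t \<le> T + 5 * h" for t using pS that h5 by auto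
  have mv': "moving S (S t x)" if "0 \<le> t" "fin \<longrightarrow> t \<le> T + 5 * h" for t using mv that h5 by auto
  have lipS: "\<bar>S t x - S s x\<bar> \<le> L * \<bar>t - s\<bar>" if "0 \<le> s" "0 \<le> t" for s t
  proof -
    have "\<bar>S t x - S s x\<bar> \<le> M * \<bar>t - s\<bar>"
      using lip[of s t x] lip[of t s x] that by (cases "s \<le> t") (auto simp: abs_minus_commute)
    also have "\<dots> \<le> L * \<bar>t - s\<bar>" using L by (intro mult_right_mono) auto
    finally show ?thesis .
  qed
  have qS: "\<bar>P.q t - S t x\<bar> \<le> 2 * (L * h)" if t: "0 \<le> t" "fin \<longrightarrow> t \<le> T + 3 * h" for t
  proof -
    have "P.q t \<le> S (t + 2 * h) x"
      using P.q_bounds(2)[OF t(1)] pS'[of "t + 2 * h"] t h by auto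
    moreover have "S (t + 2 * h) x - S t x \<le> 2 * (L * h)"
      using lipS[of t "t + 2 * h"] t h by (simp add: algebra_simps)
    moreover have "S t x - 2 * (L * h) \<le> P.q t"
      using P.q_bounds(1)[OF t(1)] pS'[of t] t h by auto
    ultimately show ?thesis by (simp add: abs_le_iff)
  qed
  \<comment> \<open>Smoothed positions come before \<open>S (t + 2 * h) x\<close>, so they lie on
    the true orbit, at points that still move.\<close>
  have orbit: "reach S x y \<and> moving S y" if y: "x \<le> y" "y \<le> P.q t" "0 \<le> t" "fin \<longrightarrow> t \<le> T + h" for y t
  proof -
    have "y \<le> S (t + 2 * h) x"
      using P.q_bounds(2)[OF y(3)] pS'[of "t + 2 * h"] y h by auto
    then obtain u where u: "0 \<le> u" "u \<le> t + 2 * h" "S u x = y"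
      using ivt_time[of 0 "t + 2 * h" x y] y h by auto
    moreover have "moving S (S u x)" using mv'[of u] u y h by auto
    ultimately show ?thesis using reach_orbit[of u x] by blast
  qed
  define K where "K = P.q ` {t. 0 \<le> t \<and> (fin \<longrightarrow> t \<le> T + h)}"
  have px: "p 0 = x" using pS[of 0] T by auto
  have K_mem: "y \<in> K" if "x \<le> y" "fin \<longrightarrow> y \<le> P.q (T + h)" for y
  proof -
    have "0 \<le> P.Q y" using that px P.q_le_iff[of 0 "P.Q y"] by simp
    moreover have "fin \<longrightarrow> P.Q y \<le> T + h" using that P.q_le_iff[of "P.Q y" "T + h"] by simp
    ultimately show ?thesis unfolding K_def by (intro image_eqI[of _ _ "P.Q y"]) auto
  qed
  \<comment> \<open>After T only e/4 of travel is left, so a point with e still ahead comes before q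
    T by a margin larger than the smoothing error. There the cutoff will equal 1.\<close>
  have far: "0 \<le> P.Q y \<and> (fin \<longrightarrow> P.Q y \<le> T)" if y: "reach S x y" "reach S y z" "e \<le> \<bar>z - y\<bar>" for y z
  proof -
    have le: "x \<le> y" using right_reach_le[OF rx y(1)] .
    have "0 \<le> P.Q y" using le px P.q_le_iff[of 0 "P.Q y"] by simp
    moreover have "P.Q y \<le> T" if fin
    proof -
      have "reach S x z" using reach_trans y by blast
      then obtain t where st: "0 \<le> t" "S t x = z" unfolding reach_def by blast
      have "y \<le> z"
      proof (cases "moving S y")
        case True
        then show ?thesis using right_reach_le[OF right_reach_right[OF rx y(1)] y(2)] by blast
      qed (use reach_not_moving[OF y(2)] in simp)
      then have ye: "y + e \<le> z" using y(3) by simp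
      have "z \<le> S T x + e / 4"
      proof (cases "T \<le> t")
        case True
        then have "\<bar>z - S T x\<bar> \<le> e / 4" using End[OF that, of t T] st by simp
        then show ?thesis by linarith
      qed (use mono[OF rx st(1), of T] st e in simp)
      then have "y \<le> S T x - 2 * (L * h)" using ye e Lh by simp
      also have "\<dots> \<le> P.q T" using qS[of T] T h by (auto simp: abs_le_iff)
      finally show ?thesis using P.q_le_iff[of "P.Q y" T] by simp
    qed
    ultimately show ?thesis by blast
  qed
  have "core S e x K" unfolding core_def
  proof (intro conjI allI impI ballI)
    show "closed K"
    proof (cases fin)
      case True
      then have "{t. 0 \<le> t \<and> (fin \<longrightarrow> t \<le> T + h)} = {0..T + h}" by auto
      then have "compact K" unfolding K_def
        by (simp only:) (intro compact_continuous_image P.q_cont compact_Icc)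
      then show ?thesis by (rule compact_imp_closed)
    next
      case False
      then have "K = {x..}" using K_mem P.q_le_iff[of 0] px by (auto simp: K_def)
      then show ?thesis by simp
    qed
    show "x \<in> K" using T h px unfolding K_def by (intro image_eqI[of _ _ 0]) auto
    fix y assume "y \<in> K"
    then show "reach S x y" "moving S y"
      using orbit P.q_le_iff[of 0] px by (auto simp: K_def)
  next
    fix y z assume "reach S x y" "reach S y z" "e \<le> \<bar>z - y\<bar>"
    from far[OF this] show "y \<in> K"
      using h unfolding K_def by (intro image_eqI[of _ _ "P.Q y"]) auto
  qed
  moreover have "\<exists>g. block f S e x K r g" if r: "r > 0" for r
  proof -
    \<comment> \<open>In time \<delta> the curve q moves by at most L \<delta>, so the part of it
      behind x that carries the field stays in the ball and within e/4 of x.\<close>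
    define \<delta> where "\<delta> = min r (e / 4) / (2 * L)"
    have \<delta>: "\<delta> > 0" using r e L by (simp add: \<delta>_def)
    have L\<delta>: "L * \<delta> < r" "L * \<delta> \<le> e / 4"
    proof -
      have "L * \<delta> = min r (e / 4) / 2" using L by (simp add: \<delta>_def)
      then show "L * \<delta> < r" "L * \<delta> \<le> e / 4" using r e by linarith+
    qed
    obtain \<kappa> C where sk: "cinf \<kappa>" and C: "C > 0" "\<And>s t. \<bar>\<kappa> s - \<kappa> t\<bar> \<le> C * \<bar>s - t\<bar>"
      and k01: "\<And>t. 0 \<le> \<kappa> t" "\<And>t. \<kappa> t \<le> 1"
      and kl: "\<And>t. t \<le> - \<delta> \<Longrightarrow> \<kappa> t = 0"
      and k1: "\<And>t. 0 \<le> t \<Longrightarrow> fin \<longrightarrow> t \<le> T \<Longrightarrow> \<kappa> t = 1"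
      and kr: "\<And>t. fin \<Longrightarrow> T + h \<le> t \<Longrightarrow> \<kappa> t = 0"
    proof (rule cutoff[OF h \<delta>, where fin = fin and T = T], goal_cases)
      case (1 \<kappa> C)
      show ?case by (rule 1(1)[of \<kappa> C]) (fact 1)+
    qed
    \<comment> \<open>Cutoff and speed are read off at the time \<open>P.Q y\<close> at which q
      passes y.\<close>
    define g where "g y = \<kappa> (P.Q y) * P.speed (P.Q y)" for y
    have sg: "cinf g" unfolding g_def
      by (rule cinf_mult[OF cinf_compose[OF sk P.cinf_Q] cinf_compose[OF P.cinf_speed P.cinf_Q]])
    have inball: "P.q t \<in> ball x r" if "- \<delta> \<le> t" "t \<le> 0" for t
    proof -
      have "x - P.q t \<le> L * (0 - t)" using P.q_lip[OF that(2)] px by simp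
      also have "\<dots> \<le> L * \<delta>" using that L by (intro mult_left_mono) auto
      finally show ?thesis using L\<delta> P.q_le_iff[of t 0] px that by (simp add: dist_real_def)
    qed
    have supp: "P.q t \<in> K \<union> ball x r" if "- \<delta> \<le> t" "fin \<longrightarrow> t \<le> T + h" for t
      using inball[of t] that by (cases "0 \<le> t") (auto simp: K_def)
    \<comment> \<open>The speed lies between two difference quotients of the orbit. Each is an
      average of f over a stretch of time h, and the positions sampled there are within e of q
      t.\<close>
    have near_speed: "near f e (P.q t) (P.speed t)" if t: "- \<delta> \<le> t" "fin \<longrightarrow> t \<le> T + h" for t
    proof -
      define t' where "t' = max 0 t"
      have t': "0 \<le> t'" "fin \<longrightarrow> t' \<le> T + h" using t T h by (auto simp: t'_def)
      have q': "\<bar>P.q t - P.q t'\<bar> \<le> e / 4"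
      proof (cases "t \<ge> 0")
        case False
        have "P.q 0 - P.q t \<le> L * (0 - t)" using False by (intro P.q_lip) auto
        also have "\<dots> \<le> L * \<delta>" using t L by (intro mult_left_mono) auto
        finally show ?thesis using False P.q_le_iff[of t 0] L\<delta> by (simp add: t'_def abs_le_iff)
      qed (use e in \<open>simp add: t'_def\<close>)
      have pos: "\<bar>S u x - P.q t\<bar> < e" if u: "max 0 (t - h) \<le> u" "u \<le> t' + 3 * h" for u
      proof -
        have "\<bar>S u x - S t' x\<bar> \<le> L * \<bar>u - t'\<bar>" using lipS[of t' u] u t' by auto
        also have "\<dots> \<le> L * (3 * h)" using u L h by (intro mult_left_mono) (auto simp: t'_def)
        finally have "\<bar>S u x - S t' x\<bar> \<le> 3 * (L * h)" by simp
        moreover have "\<bar>P.q t' - S t' x\<bar> \<le> 2 * (L * h)" using qS[of t'] t' h by auto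
        ultimately show ?thesis using q' Lh e by linarith
      qed
      have slope: "P.slope u = (S (u + h) x - S u x) / (u + h - u)"
        if u: "max 0 (t - h) \<le> u" "u \<le> t' + 2 * h" for u
        using pS'[of u] pS'[of "u + h"] u h t' by (auto simp: P.slope_def)
      obtain u1 u2 where u: "{u1, u2} \<subseteq> {max 0 (t - h)..t' + 2 * h}"
        "P.slope u1 \<le> P.speed t" "P.speed t \<le> P.slope u2"
        using P.speed_between[of t] unfolding t'_def by blast
      obtain w1 where w1: "w1 \<in> {u1..u1 + h}" "f (S w1 x) - e \<le> P.slope u1"
        using avg_le[of u1 "u1 + h" e x] slope[of u1] u h e by auto
      obtain w2 where w2: "w2 \<in> {u2..u2 + h}" "P.slope u2 \<le> f (S w2 x) + e"
        using avg_ge[of u2 "u2 + h" e x] slope[of u2] u h e by auto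
      show ?thesis unfolding near_def
        using pos[of w1] pos[of w2] w1 w2 u
        by (intro exI[of _ "S w1 x"] exI[of _ "S w2 x"]) auto
    qed
    have k0: "- \<delta> \<le> t \<and> (fin \<longrightarrow> t \<le> T + h)" if "\<kappa> t \<noteq> 0" for t
      using kl[of t] kr[of t] that by linarith
    have "block f S e x K r g" unfolding block_def
    proof (intro conjI allI impI ballI sg)
      fix y assume "y \<notin> K \<union> ball x r"
      then show "g y = 0" using supp[of "P.Q y"] k0[of "P.Q y"] by (auto simp: g_def)
    next
      fix y
      show "\<exists>k v. 0 \<le> k \<and> k \<le> 1 \<and> near f e y v \<and> g y = k * v"
      proof (cases "\<kappa> (P.Q y) = 0")
        case True
        have "near f e y (f y)" unfolding near_def using e by (intro exI[of _ y]) auto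
        then show ?thesis using True by (intro exI[of _ 0] exI[of _ "f y"]) (auto simp: g_def)
      next
        case False
        then have "near f e y (P.speed (P.Q y))"
          using near_speed[of "P.Q y"] k0[OF False] by simp
        then show ?thesis using k01[of "P.Q y"]
          by (intro exI[of _ "\<kappa> (P.Q y)"] exI[of _ "P.speed (P.Q y)"]) (auto simp: g_def)
      qed
    next
      fix y z assume "reach S x y" "reach S y z" "e \<le> \<bar>z - y\<bar>"
      note far = far[OF this]
      then have "\<kappa> (P.Q y) = 1" using k1 by blast
      moreover have "fin \<longrightarrow> P.Q y \<le> T + h" "- \<delta> \<le> P.Q y" using far \<delta> h by auto
      ultimately show "near f e y (g y)" using near_speed[of "P.Q y"] by (simp add: g_def)
    next
      fix x0 assume x0: "x0 \<in> K \<union> ball x r"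
      define a where "a = P.Q x0"
      show "\<exists>X. caratheodory_solution g x0 X \<and> (\<forall>t\<ge>0. X t \<in> K \<union> ball x r) \<and>
        (x0 \<in> K \<longrightarrow> (\<exists>t1\<ge>0. \<bar>S t1 x - x0\<bar> \<le> e \<and> (\<forall>t\<ge>0. \<bar>X t - S (t1 + t) x\<bar> \<le> e)))"
      proof (cases "x0 \<notin> K \<and> \<kappa> a = 0")
        case True
        then have "g x0 = 0" by (simp add: g_def a_def)
        then show ?thesis using x0 True caratheodory_const[of g x0] by (intro exI[of _ "\<lambda>_. x0"]) auto
      next
        case False
        have x0K: "0 \<le> a \<and> (fin \<longrightarrow> a \<le> T + h)" if "x0 \<in> K" using that by (auto simp: K_def a_def)
        have a: "- \<delta> \<le> a" "fin \<longrightarrow> a \<le> T + h" using False x0K k0[of a] \<delta> by auto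
        obtain \<theta> where \<theta>: "\<theta> 0 = a"
          "\<And>t. 0 \<le> t \<Longrightarrow> (\<theta> has_real_derivative \<kappa> (\<theta> t)) (at t within {0..})"
          "\<And>t. 0 \<le> t \<Longrightarrow> a \<le> \<theta> t" "\<And>t. 0 \<le> t \<Longrightarrow> \<theta> t \<le> a + t"
          "\<And>B t. 0 \<le> t \<Longrightarrow> a \<le> B \<Longrightarrow> (\<And>s. B \<le> s \<Longrightarrow> \<kappa> s = 0) \<Longrightarrow> \<theta> t \<le> B"
          "\<And>B t. 0 \<le> t \<Longrightarrow> (\<And>s. a \<le> s \<Longrightarrow> s \<le> B \<Longrightarrow> \<kappa> s = 1) \<Longrightarrow> \<theta> t \<le> B \<Longrightarrow> \<theta> t = a + t"
        proof (rule time_change[OF C(2,1) k01, where a = a], goal_cases)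
          case (1 \<theta>)
          show ?case by (rule 1(1)[of \<theta>]) (fact 1)+
        qed
        have \<theta>r: "fin \<longrightarrow> \<theta> t \<le> T + h" if "0 \<le> t" for t
          using \<theta>(5)[OF that, of "T + h"] a kr by auto
        have "caratheodory_solution g ((\<lambda>t. P.q (\<theta> t)) 0) (\<lambda>t. P.q (\<theta> t))"
        proof (rule caratheodory_of_deriv)
          show "((\<lambda>t. P.q (\<theta> t)) has_real_derivative g (P.q (\<theta> t))) (at t within {0..})"
            if "0 \<le> t" for t
            using DERIV_chain2[OF P.q_deriv \<theta>(2)[OF that]] by (simp add: g_def mult.commute)
        qed (rule cinf_continuous[OF sg])
        then have car: "caratheodory_solution g x0 (\<lambda>t. P.q (\<theta> t))"
          by (simp add: \<theta>(1) a_def)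
        have inv: "P.q (\<theta> t) \<in> K \<union> ball x r" if "0 \<le> t" for t
          using supp[of "\<theta> t"] \<theta>(3)[OF that] a \<theta>r[OF that] by linarith
        \<comment> \<open>While \<theta> is at most T it advances at unit rate, in step with the
          orbit. Later both \<theta> t and a + t are beyond T, where the orbit varies by at most
          e/4.\<close>
        have shadow: "\<exists>t1\<ge>0. \<bar>S t1 x - x0\<bar> \<le> e \<and> (\<forall>t\<ge>0. \<bar>P.q (\<theta> t) - S (t1 + t) x\<bar> \<le> e)" if "x0 \<in> K"
        proof (intro exI[of _ a] conjI allI impI)
          show a0: "0 \<le> a" using x0K that by blast
          have "\<bar>P.q a - S a x\<bar> \<le> 2 * (L * h)" using qS[of a] a0 a h by auto
          then show "\<bar>S a x - x0\<bar> \<le> e" using Lh Lh0 by (simp add: a_def)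
          fix t :: real assume t: "0 \<le> t"
          show "\<bar>P.q (\<theta> t) - S (a + t) x\<bar> \<le> e"
          proof (cases "fin \<longrightarrow> \<theta> t \<le> T")
            case True
            have "\<theta> t = a + t"
              by (rule \<theta>(6)[OF t, of "\<theta> t"]) (use True a0 in \<open>auto intro!: k1\<close>)
            moreover have "\<bar>P.q (\<theta> t) - S (\<theta> t) x\<bar> \<le> 2 * (L * h)"
              using qS[of "\<theta> t"] True \<theta>(3)[OF t] a0 h by auto
            ultimately show ?thesis using Lh Lh0 by simp
          next
            case False
            then have "\<bar>S (\<theta> t) x - S (a + t) x\<bar> \<le> e / 4"
              using End[of "\<theta> t" "a + t"] \<theta>(4)[OF t] by auto
            moreover have "\<bar>P.q (\<theta> t) - S (\<theta> t) x\<bar> \<le> 2 * (L * h)"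
              using qS[of "\<theta> t"] \<theta>r[OF t] \<theta>(3)[OF t] a0 h by auto
            ultimately show ?thesis using Lh Lh0 by linarith
          qed
        qed
        show ?thesis using car inv shadow by blast
      qed
    qed
    then show ?thesis by blast
  qed
  ultimately show ?thesis by blast
qed

end

section \<open>Combining finitely many orbits\<close>

lemma near_reflect: "near (\<lambda>x. - f (- x)) e y v \<longleftrightarrow> near f e (- y) (- v)"
proof -
  have *: "near (\<lambda>x. - g (- x)) e y v" if n: "near g e (- y) (- v)" for g :: "real \<Rightarrow> real" and y v
  proof -
    obtain y1 y2 where "\<bar>y1 - - y\<bar> < e" "\<bar>y2 - - y\<bar> < e" "g y1 - e \<le> - v" "- v \<le> g y2 + e"
      using n by (auto simp: near_def)
    then show ?thesis unfolding near_def by (intro exI[of _ "- y2"] exI[of _ "- y1"]) auto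
  qed
  from *[of f y v] *[of "\<lambda>x. - f (- x)" "- y" "- v"] show ?thesis by auto
qed

lemma near_mono: "near f d y v \<Longrightarrow> d \<le> e \<Longrightarrow> near f e y v"
proof -
  assume "near f d y v" "d \<le> e"
  then obtain y1 y2 where "\<bar>y1 - y\<bar> < d" "\<bar>y2 - y\<bar> < d" "f y1 - d \<le> v" "v \<le> f y2 + d"
    by (auto simp: near_def)
  with \<open>d \<le> e\<close> show ?thesis unfolding near_def by (intro exI[of _ y1] exI[of _ y2]) linarith
qed

lemma near_self: "0 < e \<Longrightarrow> near f e y (f y)"
  unfolding near_def by (intro exI[of _ y]) auto

lemma near0_iff: "near0 f y e \<longleftrightarrow> near f e y 0"
proof -
  have "f a - e \<le> 0 \<longleftrightarrow> f a \<le> e" "0 \<le> f a + e \<longleftrightarrow> - e \<le> f a" for a by linarith+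
  then show ?thesis by (simp only: near0_def near_def)
qed

text \<open>k v lies between 0 and v, so it takes one of its two bounds from each
  hypothesis.\<close>

lemma near_scale:
  assumes "near f e y v" "near f e y 0" "0 \<le> k" "k \<le> 1"
  shows "near f e y (k * v)"
proof (cases "v \<ge> 0")
  case True
  then have "0 \<le> k * v" "k * v \<le> v" using assms by (simp_all add: mult_left_le_one_le)
  moreover obtain y1 where "\<bar>y1 - y\<bar> < e" "f y1 - e \<le> 0" using assms(2) by (auto simp: near_def)
  moreover obtain y2 where "\<bar>y2 - y\<bar> < e" "v \<le> f y2 + e" using assms(1) by (auto simp: near_def)
  ultimately show ?thesis unfolding near_def by (intro exI[of _ y1] exI[of _ y2]) linarith
next
  case False
  then have "k * v \<le> 0" using assms by (simp add: mult_nonneg_nonpos)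
  moreover have "v \<le> k * v" using False assms mult_right_mono_neg[of k 1 v] by simp
  moreover obtain y1 where "\<bar>y1 - y\<bar> < e" "f y1 - e \<le> v" using assms(1) by (auto simp: near_def)
  moreover obtain y2 where "\<bar>y2 - y\<bar> < e" "0 \<le> f y2 + e" using assms(2) by (auto simp: near_def)
  ultimately show ?thesis unfolding near_def by (intro exI[of _ y1] exI[of _ y2]) linarith
qed

lemma caratheodory_reflect:
  assumes "caratheodory_solution g x0 X"
  shows "caratheodory_solution (\<lambda>y. - g (- y)) (- x0) (\<lambda>t. - X t)"
  using assms
  by (auto simp: caratheodory_solution_def set_integrable_def set_lebesgue_integral_def)

lemma cinf_reflect: "cinf g \<Longrightarrow> cinf (\<lambda>y. - g (- y))"
  using cinf_mult[OF cinf_const[of "-1"] cinf_compose[OF _ cinf_affine[of 0 "-1"]], of g] by simp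

lemma mem_uminus_image: "(y::real) \<in> uminus ` K \<longleftrightarrow> - y \<in> K"
  by (metis image_iff minus_minus)

text \<open>Where at least e of a chosen orbit lies ahead, the value is admissible without reduction
  and solutions shadow the orbit up to the time shift t1. A stationary x0 may be dragged along only
  by a nearby source, and the solution then never gets away from that source and its orbit.\<close>

definition approximant ::
  "(real \<Rightarrow> real) \<Rightarrow> (real \<Rightarrow> real \<Rightarrow> real) \<Rightarrow> real \<Rightarrow> real set \<Rightarrow> (real \<Rightarrow> real) \<Rightarrow> bool" where
  "approximant f S e X F \<longleftrightarrow> cinf F \<and>
    (\<forall>y. \<exists>k v. 0 \<le> k \<and> k \<le> 1 \<and> near f e y v \<and> F y = k * v) \<and>
    (\<forall>x\<in>X. \<forall>y z. reach S x y \<longrightarrow> reach S y z \<longrightarrow> e \<le> \<bar>z - y\<bar> \<longrightarrow> near f e y (F y)) \<and>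
    (\<forall>x\<in>X. \<forall>x0 z. reach S x x0 \<longrightarrow> reach S x0 z \<longrightarrow> e \<le> \<bar>z - x0\<bar> \<longrightarrow>
      (\<exists>Y t1. caratheodory_solution F x0 Y \<and> 0 \<le> t1 \<and> \<bar>S t1 x - x0\<bar> \<le> e \<and>
        (\<forall>t\<ge>0. \<bar>Y t - S (t1 + t) x\<bar> \<le> e))) \<and>
    (\<forall>x0. \<not> moving S x0 \<longrightarrow> (\<exists>Y. caratheodory_solution F x0 Y \<and> ((\<forall>t\<ge>0. Y t = x0) \<or>
      (\<exists>x. source S x \<and> \<bar>x - x0\<bar> < e \<and> (\<forall>t\<ge>0. \<bar>Y t - x\<bar> < e \<or> reach S x (Y t)))))) \<and>
    (\<forall>x0. \<exists>Y. caratheodory_solution F x0 Y)"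

context flow
begin

lemma block_reflect:
  assumes "block (\<lambda>x. - f (- x)) (mirror S) e (- x) K r g"
  shows "block f S e x (uminus ` K) r (\<lambda>y. - g (- y))"
proof -
  have b: "- y \<in> ball (- x) r \<longleftrightarrow> y \<in> ball x r" for y
    by (simp add: dist_real_def abs_minus_commute)
  have "cinf g" and z: "\<And>y. y \<notin> K \<union> ball (- x) r \<Longrightarrow> g y = 0"
    and n: "\<And>y. \<exists>k v. 0 \<le> k \<and> k \<le> 1 \<and> near (\<lambda>x. - f (- x)) e y v \<and> g y = k * v"
    and p: "\<And>y z. reach (mirror S) (- x) y \<Longrightarrow> reach (mirror S) y z \<Longrightarrow> e \<le> \<bar>z - y\<bar> \<Longrightarrow>
      near (\<lambda>x. - f (- x)) e y (g y)"
    and c: "\<And>x0. x0 \<in> K \<union> ball (- x) r \<Longrightarrow>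
      \<exists>X. caratheodory_solution g x0 X \<and> (\<forall>t\<ge>0. X t \<in> K \<union> ball (- x) r) \<and>
        (x0 \<in> K \<longrightarrow> (\<exists>t1\<ge>0. \<bar>- S t1 (- (- x)) - x0\<bar> \<le> e \<and> (\<forall>t\<ge>0. \<bar>X t - - S (t1 + t) (- (- x))\<bar> \<le> e)))"
    using assms unfolding block_def by blast+
  show ?thesis unfolding block_def
  proof (intro conjI allI impI ballI)
    show "cinf (\<lambda>y. - g (- y))" by (rule cinf_reflect) fact
    fix y assume "y \<notin> uminus ` K \<union> ball x r"
    then show "- g (- y) = 0" using z[of "- y"] b[of y] by (simp add: mem_uminus_image)
  next
    fix y
    obtain k v where "0 \<le> k" "k \<le> 1" "near f e y (- v)" "g (- y) = k * v"
      using n[of "- y"] by (auto simp: near_reflect)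
    then show "\<exists>k v. 0 \<le> k \<and> k \<le> 1 \<and> near f e y v \<and> - g (- y) = k * v"
      by (intro exI[of _ k] exI[of _ "- v"]) auto
  next
    fix y z assume "reach S x y" "reach S y z" "e \<le> \<bar>z - y\<bar>"
    then show "near f e y (- g (- y))"
      using p[of "- y" "- z"] by (simp add: reach_reflect near_reflect abs_minus_commute)
  next
    fix x0 assume x0: "x0 \<in> uminus ` K \<union> ball x r"
    then have "- x0 \<in> K \<union> ball (- x) r" using b[of x0] by (auto simp: mem_uminus_image)
    from c[OF this] obtain X where X: "caratheodory_solution g (- x0) X"
      "\<And>t. t \<ge> 0 \<Longrightarrow> X t \<in> K \<union> ball (- x) r"
      "- x0 \<in> K \<Longrightarrow> \<exists>t1\<ge>0. \<bar>- S t1 x - - x0\<bar> \<le> e \<and> (\<forall>t\<ge>0. \<bar>X t - - S (t1 + t) x\<bar> \<le> e)"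
      by auto
    show "\<exists>X. caratheodory_solution (\<lambda>y. - g (- y)) x0 X \<and> (\<forall>t\<ge>0. X t \<in> uminus ` K \<union> ball x r) \<and>
        (x0 \<in> uminus ` K \<longrightarrow> (\<exists>t1\<ge>0. \<bar>S t1 x - x0\<bar> \<le> e \<and> (\<forall>t\<ge>0. \<bar>X t - S (t1 + t) x\<bar> \<le> e)))"
    proof (intro exI[of _ "\<lambda>t. - X t"] conjI allI impI)
      show "caratheodory_solution (\<lambda>y. - g (- y)) x0 (\<lambda>t. - X t)"
        using caratheodory_reflect[OF X(1)] by simp
      show "- X t \<in> uminus ` K \<union> ball x r" if "0 \<le> t" for t
        using X(2)[OF that] b[of "- X t"] by (auto simp: mem_uminus_image)
      show "\<exists>t1\<ge>0. \<bar>S t1 x - x0\<bar> \<le> e \<and> (\<forall>t\<ge>0. \<bar>- X t - S (t1 + t) x\<bar> \<le> e)" if x0K: "x0 \<in> uminus ` K"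
      proof -
        obtain t1 where t1: "t1 \<ge> 0" "\<bar>- S t1 x - - x0\<bar> \<le> e"
          "\<And>t. t \<ge> 0 \<Longrightarrow> \<bar>X t - - S (t1 + t) x\<bar> \<le> e"
          using X(3) x0K unfolding mem_uminus_image by blast
        have "\<bar>S t1 x - x0\<bar> \<le> e" using t1(2) by linarith
        moreover have "\<bar>- X t - S (t1 + t) x\<bar> \<le> e" if "t \<ge> 0" for t
          using t1(3)[OF that] by linarith
        ultimately show ?thesis using t1(1) by blast
      qed
    qed
  qed
qed

lemma core_reflect:
  assumes "core (mirror S) e (- x) K"
  shows "core S e x (uminus ` K)"
proof -
  have c: "closed K" "- x \<in> K" and r: "\<And>y. y \<in> K \<Longrightarrow> reach S x (- y) \<and> moving S (- y)"
    and f: "\<And>y z. reach S x (- y) \<Longrightarrow> reach S (- y) (- z) \<Longrightarrow> e \<le> \<bar>z - y\<bar> \<Longrightarrow> y \<in> K"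
    using assms unfolding core_def reach_reflect moving_reflect by simp_all
  show ?thesis unfolding core_def mem_uminus_image
  proof (intro conjI ballI allI impI)
    show "closed (uminus ` K)" by (rule closed_negations[OF c(1)])
    show "- x \<in> K" by (rule c)
    fix y assume "y \<in> uminus ` K"
    then have "- y \<in> K" by (simp add: mem_uminus_image)
    from r[OF this] show "reach S x y" "moving S y" by simp_all
  next
    fix y z assume a: "reach S x y" "reach S y z" "e \<le> \<bar>z - y\<bar>"
    then have "e \<le> \<bar>- z - - y\<bar>" by linarith
    then show "- y \<in> K" using f[of "- y" "- z"] a by simp
  qed
qed

lemma block_exists:
  assumes "moving S x" "e > 0"
  shows "\<exists>K. core S e x K \<and> (\<forall>r>0. \<exists>g. block f S e x K r g)"
  using assms(1)
proof (cases rule: moving_cases)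
  case 1
  then show ?thesis by (rule block_rightward[OF _ assms(2)])
next
  case 2
  from flow.block_rightward[OF reflect 2 assms(2)]
  obtain K where K: "core (mirror S) e (- x) K"
    and g: "\<forall>r>0. \<exists>g. block (\<lambda>x. - f (- x)) (mirror S) e (- x) K r g" by (elim exE conjE)
  show ?thesis
  proof (intro exI[of _ "uminus ` K"] conjI allI impI core_reflect[OF K])
    fix r :: real assume "r > 0"
    with g obtain g where "block (\<lambda>x. - f (- x)) (mirror S) e (- x) K r g" by blast
    from block_reflect[OF this] show "\<exists>g. block f S e x (uminus ` K) r g" by blast
  qed
qed

text \<open>The starting points are pairwise unreachable from each other, so each lies outside the
  closed cores of the others, and a common small r separates the balls from those cores and from
  each other. Two cores cannot meet: a common point moves, which by \<open>reach_merge\<close> would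
  make the starting points comparable. On these disjoint invariant sets the sum of the blocks agrees
  with a single block.\<close>

lemma stage:
  assumes fin: "finite X" and mv: "\<And>x. x \<in> X \<Longrightarrow> moving S x"
    and anti: "\<And>x y. x \<in> X \<Longrightarrow> y \<in> X \<Longrightarrow> reach S x y \<Longrightarrow> x = y" and e: "e > 0"
  shows "\<exists>F. approximant f S e X F"
proof -
  have "\<forall>x\<in>X. \<exists>K. core S e x K \<and> (\<forall>r>0. \<exists>g. block f S e x K r g)"
    using block_exists[OF mv e] by blast
  then obtain K where K: "\<And>x. x \<in> X \<Longrightarrow> core S e x (K x)"
    and bl: "\<And>x r. x \<in> X \<Longrightarrow> r > 0 \<Longrightarrow> \<exists>g. block f S e x (K x) r g" by metis
  have Kr: "reach S x y" "moving S y" if "x \<in> X" "y \<in> K x" for x y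
    using K[OF that(1)] that(2) by (auto simp: core_def)
  \<comment> \<open>The finitely many conditions on r are collected as eventual properties at 0 from
    the right.\<close>
  have pos: "\<forall>\<^sub>F r in at_right (0::real). P r"
    if "d > 0" "\<And>r. 0 < r \<Longrightarrow> r < d \<Longrightarrow> P r" for P d
    using that by (auto simp: eventually_at_right_field)
  have ev1: "\<forall>\<^sub>F r in at_right (0::real). r < e" by (rule pos[OF e])
  \<comment> \<open>Only a source may drag along stationary points lying just behind it.\<close>
  have ev2: "\<forall>\<^sub>F r in at_right (0::real). \<forall>x\<in>X. source S x \<or> (\<forall>z\<in>ball x r. moving S z)"
  proof (rule eventually_ball_finite[OF fin], rule ballI)
    fix x assume x: "x \<in> X"
    show "\<forall>\<^sub>F r in at_right (0::real). source S x \<or> (\<forall>z\<in>ball x r. moving S z)"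
    proof (cases "source S x")
      case False
      obtain d where d: "d > 0" "\<And>z. \<bar>z - x\<bar> < d \<Longrightarrow> moving S z"
        using moving_ball[OF mv[OF x] False] by blast
      show ?thesis
        by (rule pos[OF d(1)]) (auto simp: dist_real_def abs_minus_commute intro!: d(2))
    qed simp
  qed
  have ev3: "\<forall>\<^sub>F r in at_right (0::real). \<forall>x\<in>X. \<forall>y\<in>X. x \<noteq> y \<longrightarrow>
      ball x r \<inter> K y = {} \<and> ball x r \<inter> ball y r = {}"
  proof (rule eventually_ball_finite[OF fin], rule ballI, rule eventually_ball_finite[OF fin], rule ballI)
    fix x y assume xy: "x \<in> X" "y \<in> X"
    show "\<forall>\<^sub>F r in at_right (0::real). x \<noteq> y \<longrightarrow> ball x r \<inter> K y = {} \<and> ball x r \<inter> ball y r = {}"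
    proof (cases "x = y")
      case False
      then have "x \<notin> K y" using Kr(1)[OF xy(2)] anti[OF xy(2,1)] by blast
      moreover have "open (- K y)" using K[OF xy(2)] by (simp add: core_def open_Compl)
      ultimately obtain d where d: "d > 0" "ball x d \<subseteq> - K y"
        by (metis ComplI open_contains_ball)
      show ?thesis
      proof (rule pos[of "min d (\<bar>x - y\<bar> / 2)"])
        fix r assume r: "0 < r" "r < min d (\<bar>x - y\<bar> / 2)"
        then have "ball x r \<subseteq> ball x d" by auto
        then have "ball x r \<inter> K y = {}" using d by blast
        moreover have "ball x r \<inter> ball y r = {}"
          using r by (auto simp: dist_real_def abs_if split: if_splits)
        ultimately show "x \<noteq> y \<longrightarrow> ball x r \<inter> K y = {} \<and> ball x r \<inter> ball y r = {}" by blast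
      qed (use d False in auto)
    qed simp
  qed
  have "\<forall>\<^sub>F r in at_right (0::real). r > 0" by (rule pos[of 1]) auto
  from eventually_conj[OF this eventually_conj[OF ev1 eventually_conj[OF ev2 ev3]]]
  have "\<exists>r. 0 < r \<and> r < e \<and> (\<forall>x\<in>X. source S x \<or> (\<forall>z\<in>ball x r. moving S z)) \<and>
      (\<forall>x\<in>X. \<forall>y\<in>X. x \<noteq> y \<longrightarrow> ball x r \<inter> K y = {} \<and> ball x r \<inter> ball y r = {})"
    by (rule eventually_happens'[OF trivial_limit_at_right_real])
  then obtain r where r: "r > 0" "r < e"
    and ball_moving: "\<forall>x\<in>X. source S x \<or> (\<forall>z\<in>ball x r. moving S z)"
    and ball_disj: "\<forall>x\<in>X. \<forall>y\<in>X. x \<noteq> y \<longrightarrow> ball x r \<inter> K y = {} \<and> ball x r \<inter> ball y r = {}"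
    by (elim exE conjE)
  have "\<forall>x\<in>X. \<exists>g. block f S e x (K x) r g" using bl r(1) by simp
  from bchoice[OF this] obtain g where g: "\<And>x. x \<in> X \<Longrightarrow> block f S e x (K x) r (g x)"
    by blast
  define U where "U x = K x \<union> ball x r" for x
  have KU: "y \<in> K x \<Longrightarrow> y \<in> U x" for x y by (simp add: U_def)
  have disj: "x = y" if "x \<in> X" "y \<in> X" "z \<in> U x" "z \<in> U y" for x y z
  proof (rule ccontr)
    assume "x \<noteq> y"
    then have "ball x r \<inter> K y = {}" "ball x r \<inter> ball y r = {}" "ball y r \<inter> K x = {}"
      using ball_disj that(1,2) by metis+
    then have "z \<in> K x" "z \<in> K y" using that(3,4) unfolding U_def by blast+
    then have "reach S x y \<or> reach S y x"
      using reach_merge[of x z y] Kr[OF that(1)] Kr[OF that(2)] by blast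
    then show False using anti that(1,2) \<open>x \<noteq> y\<close> by blast
  qed
  define F where "F y = (\<Sum>x\<in>X. g x y)" for y
  have g0: "g x y = 0" if "x \<in> X" "y \<notin> U x" for x y
    using g[OF that(1)] that(2) by (simp add: block_def U_def)
  have FU: "F y = g x y" if "x \<in> X" "y \<in> U x" for x y
  proof -
    have "g i y = 0" if "i \<in> X - {x}" for i
      using g0[of i y] disj[of i x y] that \<open>x \<in> X\<close> \<open>y \<in> U x\<close> by blast
    then have "F y = (\<Sum>x'\<in>{x}. g x' y)" unfolding F_def
      by (intro sum.mono_neutral_right[OF fin]) (use that in auto)
    then show ?thesis by simp
  qed
  have F0: "F y = 0" if "\<And>x. x \<in> X \<Longrightarrow> y \<notin> U x" for y
    unfolding F_def by (rule sum.neutral) (use g0 that in blast)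
  have sol: "\<exists>Y. caratheodory_solution F x0 Y \<and> (\<forall>t\<ge>0. Y t \<in> U x) \<and>
        (x0 \<in> K x \<longrightarrow> (\<exists>t1\<ge>0. \<bar>S t1 x - x0\<bar> \<le> e \<and> (\<forall>t\<ge>0. \<bar>Y t - S (t1 + t) x\<bar> \<le> e)))"
    if xx: "x \<in> X" "x0 \<in> U x" for x x0
  proof -
    obtain Y where Y: "caratheodory_solution (g x) x0 Y" "\<And>t. t \<ge> 0 \<Longrightarrow> Y t \<in> U x"
      "x0 \<in> K x \<longrightarrow> (\<exists>t1\<ge>0. \<bar>S t1 x - x0\<bar> \<le> e \<and> (\<forall>t\<ge>0. \<bar>Y t - S (t1 + t) x\<bar> \<le> e))"
    proof -
      have "\<forall>x0\<in>U x. \<exists>X. caratheodory_solution (g x) x0 X \<and> (\<forall>t\<ge>0. X t \<in> U x) \<and>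
        (x0 \<in> K x \<longrightarrow> (\<exists>t1\<ge>0. \<bar>S t1 x - x0\<bar> \<le> e \<and> (\<forall>t\<ge>0. \<bar>X t - S (t1 + t) x\<bar> \<le> e)))"
        using g[OF xx(1)] unfolding block_def U_def by (elim conjE)
      from bspec[OF this xx(2)] show thesis using that by blast
    qed
    have "caratheodory_solution F x0 Y"
      by (rule caratheodory_cong[OF Y(1)]) (use FU[OF xx(1)] Y(2) in auto)
    then show ?thesis using Y(2,3) by blast
  qed
  have const: "caratheodory_solution F x0 (\<lambda>_. x0)" if "\<And>x. x \<in> X \<Longrightarrow> x0 \<notin> U x" for x0
    by (rule caratheodory_const, rule F0, rule that)
  have far: "y \<in> K x" if "x \<in> X" "reach S x y" "reach S y z" "e \<le> \<bar>z - y\<bar>" for x y z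
    using K[OF that(1)] that unfolding core_def by blast
  show ?thesis unfolding approximant_def
  proof (rule exI[of _ F], intro conjI allI impI ballI)
    show "cinf F" unfolding F_def using g by (intro cinf_sum) (auto simp: block_def)
    fix y
    show "\<exists>k v. 0 \<le> k \<and> k \<le> 1 \<and> near f e y v \<and> F y = k * v"
    proof (cases "\<exists>x\<in>X. y \<in> U x")
      case True
      then obtain x where x: "x \<in> X" "y \<in> U x" by blast
      have "\<exists>k v. 0 \<le> k \<and> k \<le> 1 \<and> near f e y v \<and> g x y = k * v"
        using g[OF x(1)] unfolding block_def by blast
      then show ?thesis using FU[OF x] by simp
    next
      case False
      then have "F y = 0" using F0[of y] by blast
      then show ?thesis using near_self[OF e, of f y] by (intro exI[of _ 0] exI[of _ "f y"]) simp
    qed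
  next
    fix x y z assume a: "x \<in> X" "reach S x y" "reach S y z" "e \<le> \<bar>z - y\<bar>"
    then have "near f e y (g x y)" using g[OF a(1)] unfolding block_def by blast
    then show "near f e y (F y)" using FU[OF a(1)] KU far[OF a] by simp
  next
    fix x x0 z assume a: "x \<in> X" "reach S x x0" "reach S x0 z" "e \<le> \<bar>z - x0\<bar>"
    show "\<exists>Y t1. caratheodory_solution F x0 Y \<and> 0 \<le> t1 \<and> \<bar>S t1 x - x0\<bar> \<le> e \<and>
        (\<forall>t\<ge>0. \<bar>Y t - S (t1 + t) x\<bar> \<le> e)"
      using sol[OF a(1) KU[OF far[OF a]]] far[OF a] by blast
  next
    fix x0 assume n: "\<not> moving S x0"
    show "\<exists>Y. caratheodory_solution F x0 Y \<and> ((\<forall>t\<ge>0. Y t = x0) \<or>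
      (\<exists>x. source S x \<and> \<bar>x - x0\<bar> < e \<and> (\<forall>t\<ge>0. \<bar>Y t - x\<bar> < e \<or> reach S x (Y t))))"
    proof (cases "\<exists>x\<in>X. x0 \<in> U x")
      case True
      then obtain x where x: "x \<in> X" "x0 \<in> U x" by blast
      \<comment> \<open>Cores consist of moving points, so a stationary x0 can only lie in the ball
        around the starting point.\<close>
      then have b: "x0 \<in> ball x r" using Kr[OF x(1), of x0] n by (auto simp: U_def)
      then have "source S x" using ball_moving x(1) n by blast
      moreover have "\<bar>x - x0\<bar> < e" using b r(2) by (simp add: dist_real_def)
      moreover obtain Y where Y: "caratheodory_solution F x0 Y" "\<And>t. t \<ge> 0 \<Longrightarrow> Y t \<in> U x"
        using sol[OF x] by blast
      moreover have "\<bar>Y t - x\<bar> < e \<or> reach S x (Y t)" if "t \<ge> 0" for t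
        using Y(2)[OF that] Kr(1)[OF x(1)] r(2) by (auto simp: U_def dist_real_def abs_minus_commute)
      ultimately show ?thesis by blast
    next
      case False
      then show ?thesis using const[of x0] by blast
    qed
  next
    fix x0 show "\<exists>Y. caratheodory_solution F x0 Y"
      using sol const by (cases "\<exists>x\<in>X. x0 \<in> U x") blast+
  qed
qed

end

section \<open>Convergence\<close>

lemma regulated_near:
  assumes "regulated f" and "\<eta> > 0"
  shows "\<exists>\<delta>>0. \<forall>y. \<bar>y - x\<bar> < \<delta> \<longrightarrow>
    \<bar>f y - f x\<bar> < \<eta> \<or> \<bar>f y - rlim f x\<bar> < \<eta> \<or> \<bar>f y - llim f x\<bar> < \<eta>"
proof -
  obtain l r where lr: "(f \<longlongrightarrow> l) (at_left x)" "(f \<longlongrightarrow> r) (at_right x)"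
    using assms(1) unfolding regulated_def by blast
  have eq: "llim f x = l" "rlim f x = r"
    unfolding llim_def rlim_def
    using lr by (auto intro!: tendsto_Lim trivial_limit_at_left_real trivial_limit_at_right_real)
  obtain a where a: "a < x" "\<And>y. a < y \<Longrightarrow> y < x \<Longrightarrow> dist (f y) l < \<eta>"
    using tendstoD[OF lr(1) assms(2)] unfolding eventually_at_left_field by blast
  obtain b where b: "x < b" "\<And>y. x < y \<Longrightarrow> y < b \<Longrightarrow> dist (f y) r < \<eta>"
    using tendstoD[OF lr(2) assms(2)] unfolding eventually_at_right_field by blast
  show ?thesis
  proof (intro exI[of _ "min (x - a) (b - x)"] conjI allI impI)
    fix y assume y: "\<bar>y - x\<bar> < min (x - a) (b - x)"
    consider "y < x" | "y = x" | "y > x" by linarith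
    then show "\<bar>f y - f x\<bar> < \<eta> \<or> \<bar>f y - rlim f x\<bar> < \<eta> \<or> \<bar>f y - llim f x\<bar> < \<eta>"
    proof cases
      case 1
      then have "a < y" using y by linarith
      then show ?thesis using a(2)[of y] 1 eq by (simp add: dist_real_def)
    next
      case 3
      then have "y < b" using y by linarith
      then show ?thesis using b(2)[of y] 3 eq by (simp add: dist_real_def)
    qed (use assms(2) in simp)
  qed (use a b in simp)
qed

text \<open>Near \<open>x\<close>, all values of \<open>f\<close> are close to the hull of \<open>f x\<close>, \<open>rlim f x\<close>, \<open>llim f x\<close>; compactness
  makes the size of the neighbourhood uniform.\<close>

lemma graph_converges_near:
  assumes reg: "regulated f"
    and near: "\<And>e N. e > 0 \<Longrightarrow> N > 0 \<Longrightarrow> \<forall>\<^sub>F n in sequentially. \<forall>y\<in>{-N..N}. near f e y (F n y)"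
  shows "graph_converges F f"
  unfolding graph_converges_def
proof (intro allI impI)
  fix \<epsilon> N :: real assume \<epsilon>: "\<epsilon> > 0" and N: "N > 0"
  have e4: "\<epsilon> / 4 > 0" using \<epsilon> by simp
  have "\<forall>x. \<exists>\<delta>>0. \<forall>y. \<bar>y - x\<bar> < \<delta> \<longrightarrow> \<bar>f y - f x\<bar> < \<epsilon> / 4 \<or>
      \<bar>f y - rlim f x\<bar> < \<epsilon> / 4 \<or> \<bar>f y - llim f x\<bar> < \<epsilon> / 4"
    using regulated_near[OF reg e4] by blast
  then obtain \<delta> where \<delta>: "\<And>x. \<delta> x > 0" "\<And>x y. \<bar>y - x\<bar> < \<delta> x \<Longrightarrow> \<bar>f y - f x\<bar> < \<epsilon> / 4 \<or>
      \<bar>f y - rlim f x\<bar> < \<epsilon> / 4 \<or> \<bar>f y - llim f x\<bar> < \<epsilon> / 4" by metis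
  define d where "d x = min (\<delta> x) (\<epsilon> / 4)" for x
  have d: "d x > 0" for x using \<delta>(1) e4 by (simp add: d_def)
  obtain r where r: "r > 0" "\<And>y. y \<in> {-N..N} \<Longrightarrow> \<exists>G\<in>range (\<lambda>x. ball x (d x)). ball y r \<subseteq> G"
  proof (rule Heine_Borel_lemma[of "{-N..N}" "range (\<lambda>x. ball x (d x))"])
    show "{-N..N} \<subseteq> \<Union> (range (\<lambda>x. ball x (d x)))"
    proof
      show "x \<in> \<Union> (range (\<lambda>x. ball x (d x)))" for x using d[of x] by (intro UnionI[of "ball x (d x)"]) auto
    qed
  qed auto
  define e where "e = min r (\<epsilon> / 4)"
  have e: "e > 0" using r e4 by (simp add: e_def)
  from near[OF e N] show "\<forall>\<^sub>F n in sequentially.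
      (\<lambda>x. (x, F n x)) ` {-N..N} \<subseteq> nbhd (multigraph (convexification f)) \<epsilon>"
  proof eventually_elim
    case (elim n)
    show ?case
    proof (rule image_subsetI)
      fix y assume y: "y \<in> {-N..N}"
      obtain x where x: "ball y r \<subseteq> ball x (d x)" using r(2)[OF y] by blast
      define A where "A = {f x, rlim f x, llim f x}"
      define lo hi where "lo = min (f x) (min (rlim f x) (llim f x))"
        and "hi = max (f x) (max (rlim f x) (llim f x))"
      have bounds: "lo - \<epsilon> / 4 \<le> f z" "f z \<le> hi + \<epsilon> / 4" if "\<bar>z - y\<bar> < e" for z
      proof -
        have "z \<in> ball y r" using that by (simp add: e_def dist_real_def abs_minus_commute)
        then have "z \<in> ball x (d x)" using x by blast
        then have "\<bar>z - x\<bar> < \<delta> x" by (simp add: d_def dist_real_def abs_minus_commute)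
        from \<delta>(2)[OF this] show "lo - \<epsilon> / 4 \<le> f z" "f z \<le> hi + \<epsilon> / 4"
          unfolding lo_def hi_def by linarith+
      qed
      obtain y1 y2 where "\<bar>y1 - y\<bar> < e" "\<bar>y2 - y\<bar> < e" "f y1 - e \<le> F n y" "F n y \<le> f y2 + e"
        using elim y unfolding near_def by blast
      then have v: "lo - \<epsilon> / 2 \<le> F n y" "F n y \<le> hi + \<epsilon> / 2"
        using bounds[of y1] bounds[of y2] by (auto simp: e_def)
      \<comment> \<open>The projection of the value to the interval spanned by f x and its one-sided
        limits.\<close>
      define w where "w = max lo (min hi (F n y))"
      have lohi: "lo \<le> hi" by (auto simp: lo_def hi_def)
      have w: "\<bar>F n y - w\<bar> \<le> \<epsilon> / 2" "lo \<le> w" "w \<le> hi"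
        using v lohi \<epsilon> unfolding w_def by linarith+
      have "lo \<in> A" "hi \<in> A" by (auto simp: lo_def hi_def A_def min_def max_def)
      then have "closed_segment lo hi \<subseteq> convex hull A"
        by (intro closed_segment_subset convex_convex_hull hull_inc)
      moreover have "w \<in> closed_segment lo hi" using w lohi by (simp add: closed_segment_eq_real_ivl)
      \<comment> \<open>The comparison point sits over the centre x of the covering ball, not over
        y: the values of f around y are controlled by the three numbers at x.\<close>
      ultimately have "(x, w) \<in> multigraph (convexification f)"
        by (auto simp: multigraph_def convexification_def A_def)
      then have "infdist (y, F n y) (multigraph (convexification f)) \<le> dist (y, F n y) (x, w)"
        by (rule infdist_le)
      also have "\<dots> \<le> \<bar>y - x\<bar> + \<bar>F n y - w\<bar>"
        unfolding dist_Pair_Pair dist_real_def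
        using sqrt_sum_squares_le_sum_abs[of "\<bar>y - x\<bar>" "\<bar>F n y - w\<bar>"] by simp
      also have "\<dots> < \<epsilon>"
      proof -
        have "y \<in> ball x (d x)" using x r(1) centre_in_ball[of y r] by blast
        then have "\<bar>y - x\<bar> < \<epsilon> / 4" by (simp add: d_def dist_real_def abs_minus_commute)
        then show ?thesis using w \<epsilon> by linarith
      qed
      finally show "(y, F n y) \<in> nbhd (multigraph (convexification f)) \<epsilon>" by (simp add: nbhd_def)
    qed
  qed
qed

text \<open>A single finite set of rationals serves all y in [-N, N], so from some stage on all its
  moving members are available at once.\<close>

lemma finite_rational_net:
  fixes d N :: real
  assumes "d > 0"
  shows "\<exists>R. finite R \<and> R \<subseteq> \<rat> \<and> (\<forall>y\<in>{-N..N}. \<exists>q\<in>R. y < q \<and> q < y + d)"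
proof -
  obtain m :: nat where m: "m > 0" "1 / real m < d"
    using assms by (metis nat_approx_posE One_nat_def of_nat_Suc zero_less_Suc)
  define B where "B = \<lfloor>real m * \<bar>N\<bar>\<rfloor> + 2"
  define R where "R = (\<lambda>j. of_int j / real m) ` {-B..B}"
  have "\<exists>q\<in>R. y < q \<and> q < y + d" if y: "y \<in> {-N..N}" for y
  proof -
    define j where "j = \<lfloor>real m * y\<rfloor> + 1"
    have j: "real m * y < of_int j" "of_int j \<le> real m * y + 1" unfolding j_def by linarith+
    have "\<bar>real m * y\<bar> \<le> real m * \<bar>N\<bar>" using y by (simp add: abs_mult) (intro mult_left_mono, auto)
    then have "j \<in> {-B..B}" unfolding j_def B_def by (auto simp: abs_le_iff) linarith+
    moreover have "y < of_int j / real m" using j m by (simp add: field_simps)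
    moreover have "of_int j / real m \<le> y + 1 / real m" using j m by (simp add: field_simps)
    ultimately show ?thesis using m unfolding R_def by force
  qed
  moreover have "R \<subseteq> \<rat>" "finite R" by (auto simp: R_def)
  ultimately show ?thesis by blast
qed

text \<open>Among the members of A below e, one with the fewest predecessors in A is
  minimal.\<close>

lemma finite_minimal_below:
  assumes "finite A" "e \<in> A" and refl: "\<And>x. P x x"
    and trans: "\<And>x y z. P x y \<Longrightarrow> P y z \<Longrightarrow> P x z" and anti: "\<And>x y. P x y \<Longrightarrow> P y x \<Longrightarrow> x = y"
  shows "\<exists>x\<in>A. P x e \<and> (\<forall>y\<in>A. P y x \<longrightarrow> y = x)"
proof -
  define c where "c x = card {y \<in> A. P y x}" for x
  obtain x where x: "x \<in> A" "P x e" "\<And>y. y \<in> A \<Longrightarrow> P y e \<Longrightarrow> c x \<le> c y"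
    using ex_has_least_nat[of "\<lambda>x. x \<in> A \<and> P x e" e c] assms(2) refl by blast
  have "y = x" if y: "y \<in> A" "P y x" for y
  proof (rule ccontr)
    assume "y \<noteq> x"
    have "{z \<in> A. P z y} \<subset> {z \<in> A. P z x}"
      using trans[OF _ y(2)] anti[OF y(2)] \<open>y \<noteq> x\<close> x(1) refl by blast
    then have "c y < c x" unfolding c_def using assms(1) by (intro psubset_card_mono) auto
    then show False using x(3)[OF y(1) trans[OF y(2) x(2)]] by simp
  qed
  then show ?thesis using x by blast
qed

context flow
begin

lemma approximation:
  obtains F where "\<And>n. cinf (F n)"
    "\<And>e N. e > 0 \<Longrightarrow> N > 0 \<Longrightarrow> \<forall>\<^sub>F n in sequentially. \<forall>y\<in>{-N..N}. near f e y (F n y)"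
    "\<And>n x0. \<exists>Y. caratheodory_solution (F n) x0 Y"
    "\<And>x0 e. e > 0 \<Longrightarrow> \<forall>\<^sub>F n in sequentially. \<exists>Y. caratheodory_solution (F n) x0 Y \<and>
       (\<forall>t\<ge>0. \<bar>Y t - S t x0\<bar> \<le> e)"
proof -
  \<comment> \<open>A moving point is reached from a moving rational unless it is itself a source.\<close>
  define E where "E = {x \<in> \<rat>. moving S x} \<union> {x. source S x}"
  have "countable E" unfolding E_def
    by (intro countable_Un countable_source countable_subset[OF _ countable_rat]) auto
  define En where "En n = {x \<in> E. to_nat_on E x < n}" for n
  have finE: "finite (En n)" for n
  proof (rule finite_imageD)
    show "finite (to_nat_on E ` En n)" by (rule finite_subset[of _ "{..<n}"]) (auto simp: En_def)
    show "inj_on (to_nat_on E) (En n)"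
      using inj_on_subset[OF inj_on_to_nat_on[OF \<open>countable E\<close>]] by (auto simp: En_def)
  qed
  have evE: "\<forall>\<^sub>F n in sequentially. z \<in> En n" if "z \<in> E" for z
    using eventually_gt_at_top[of "to_nat_on E z"] by eventually_elim (simp add: En_def that)
  \<comment> \<open>Keeping only the earliest starting points makes them incomparable, as
    \<open>stage\<close> demands, while every point of \<open>En n\<close> still lies on a chosen
    orbit.\<close>
  define X where "X n = {x \<in> En n. \<forall>y\<in>En n. reach S y x \<longrightarrow> y = x}" for n
  have XE: "\<exists>x\<in>X n. reach S x z" if "z \<in> En n" for z n
    using finite_minimal_below[OF finE that, of "reach S"] reach_trans reach_antisym
    by (auto simp: X_def)
  define e where "e n = 1 / real (Suc n)" for n
  have e0: "e n > 0" for n by (simp add: e_def)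
  have ev_e: "\<forall>\<^sub>F n in sequentially. e n < d" if "d > 0" for d
  proof -
    have "e \<longlonglongrightarrow> 0" unfolding e_def by (rule LIMSEQ_Suc[OF lim_1_over_n])
    then show ?thesis by (rule order_tendstoD(2)) (rule that)
  qed
  have "\<forall>n. \<exists>F. approximant f S (e n) (X n) F"
  proof (intro allI stage)
    fix n
    show "finite (X n)" using finE by (simp add: X_def)
    show "0 < e n" by (rule e0)
    show "moving S x" if "x \<in> X n" for x using that by (auto simp: X_def En_def E_def source_def)
    show "x = y" if "x \<in> X n" "y \<in> X n" "reach S x y" for x y using that by (auto simp: X_def)
  qed
  from choice[OF this] obtain F where F: "\<And>n. approximant f S (e n) (X n) (F n)" by blast
  have smF: "cinf (F n)" and scaled: "\<exists>k v. 0 \<le> k \<and> k \<le> 1 \<and> near f (e n) y v \<and> F n y = k * v"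
    and sol: "\<exists>Y. caratheodory_solution (F n) x0 Y" for n y x0
    using F[of n] unfolding approximant_def by simp_all
  have full: "near f (e n) y (F n y)"
    if "x \<in> X n" "reach S x y" "reach S y z" "e n \<le> \<bar>z - y\<bar>" for n x y z
    using F[of n] that unfolding approximant_def by blast
  have shadow: "\<exists>Y t1. caratheodory_solution (F n) x0 Y \<and> 0 \<le> t1 \<and> \<bar>S t1 x - x0\<bar> \<le> e n \<and>
        (\<forall>t\<ge>0. \<bar>Y t - S (t1 + t) x\<bar> \<le> e n)"
    if "x \<in> X n" "reach S x x0" "reach S x0 z" "e n \<le> \<bar>z - x0\<bar>" for n x x0 z
  proof -
    have "\<forall>x\<in>X n. \<forall>x0 z. reach S x x0 \<longrightarrow> reach S x0 z \<longrightarrow> e n \<le> \<bar>z - x0\<bar> \<longrightarrow>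
      (\<exists>Y t1. caratheodory_solution (F n) x0 Y \<and> 0 \<le> t1 \<and> \<bar>S t1 x - x0\<bar> \<le> e n \<and>
        (\<forall>t\<ge>0. \<bar>Y t - S (t1 + t) x\<bar> \<le> e n))"
      using F[of n] unfolding approximant_def by (elim conjE)
    with that show ?thesis by simp
  qed
  have rest: "\<exists>Y. caratheodory_solution (F n) x0 Y \<and> ((\<forall>t\<ge>0. Y t = x0) \<or>
      (\<exists>x. source S x \<and> \<bar>x - x0\<bar> < e n \<and> (\<forall>t\<ge>0. \<bar>Y t - x\<bar> < e n \<or> reach S x (Y t))))"
    if "\<not> moving S x0" for n x0
  proof -
    have "\<forall>x0. \<not> moving S x0 \<longrightarrow> (\<exists>Y. caratheodory_solution (F n) x0 Y \<and> ((\<forall>t\<ge>0. Y t = x0) \<or>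
      (\<exists>x. source S x \<and> \<bar>x - x0\<bar> < e n \<and> (\<forall>t\<ge>0. \<bar>Y t - x\<bar> < e n \<or> reach S x (Y t)))))"
      using F[of n] unfolding approximant_def by (elim conjE)
    with that show ?thesis by simp
  qed
  show ?thesis
  proof (rule that[OF smF _ sol])
    fix \<epsilon> N :: real assume \<epsilon>: "\<epsilon> > 0" and N: "N > 0"
    \<comment> \<open>The margin \<epsilon> is there because the net is applied at y - \<epsilon>
      and y + \<epsilon> / 2, which yields the two candidates for \<open>plateau\<close>.\<close>
    obtain R where R: "finite R" "R \<subseteq> \<rat>"
      "\<And>y. y \<in> {-(N + \<epsilon>)..N + \<epsilon>} \<Longrightarrow> \<exists>q\<in>R. y < q \<and> q < y + \<epsilon> / 2"
      using finite_rational_net[of "\<epsilon> / 2" "N + \<epsilon>"] \<epsilon> by auto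
    have "\<forall>\<^sub>F n in sequentially. \<forall>q\<in>R. moving S q \<longrightarrow> q \<in> En n"
    proof (rule eventually_ball_finite[OF R(1)], rule ballI)
      fix q assume "q \<in> R"
      then show "\<forall>\<^sub>F n in sequentially. moving S q \<longrightarrow> q \<in> En n"
        using evE[of q] R(2) by (cases "moving S q") (auto simp: E_def)
    qed
    moreover have "\<forall>\<^sub>F n in sequentially. e n < \<epsilon> / 2" by (rule ev_e) (use \<epsilon> in simp)
    ultimately show "\<forall>\<^sub>F n in sequentially. \<forall>y\<in>{-N..N}. near f \<epsilon> y (F n y)"
    proof eventually_elim
      case (elim n)
      then have en: "e n \<le> \<epsilon>" using \<epsilon> by simp
      show ?case
      proof
        fix y assume y: "y \<in> {-N..N}"
        show "near f \<epsilon> y (F n y)"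
        \<comment> \<open>Where 0 is admissible, so is the reduced value k v. Elsewhere a chosen
          orbit passes y with more than \<open>e n\<close> ahead, and nothing is cut off.\<close>
        proof (cases "near f \<epsilon> y 0")
          case True
          obtain k v where "0 \<le> k" "k \<le> 1" "near f (e n) y v" "F n y = k * v"
            using scaled by blast
          then show ?thesis using near_scale[OF near_mono[OF _ en] True] by simp
        next
          case False
          obtain q1 where q1: "q1 \<in> R" "y - \<epsilon> < q1" "q1 < y - \<epsilon> + \<epsilon> / 2"
            using R(3)[of "y - \<epsilon>"] y \<epsilon> by auto
          obtain q2 where q2: "q2 \<in> R" "y + \<epsilon> / 2 < q2" "q2 < y + \<epsilon> / 2 + \<epsilon> / 2"
            using R(3)[of "y + \<epsilon> / 2"] y \<epsilon> by auto
          have "\<not> near0 f y \<epsilon>" using False by (simp add: near0_iff)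
          then obtain q z where q: "q \<in> {q1, q2}" "moving S q" "reach S q y"
            and z: "reach S y z" "\<bar>z - y\<bar> \<ge> \<epsilon> / 2"
            using plateau[of y \<epsilon> q1 q2] q1 q2 \<epsilon> by auto
          then have "q \<in> En n" using elim(1) q1 q2 by auto
          then obtain x where x: "x \<in> X n" "reach S x q" using XE by blast
          have "near f (e n) y (F n y)"
            by (rule full[OF x(1) reach_trans[OF x(2) q(3)] z(1)]) (use z elim in simp)
          then show ?thesis by (rule near_mono[OF _ en])
        qed
      qed
    qed
  next
    fix x0 \<epsilon> :: real assume \<epsilon>: "\<epsilon> > 0"
    have \<epsilon>2: "\<epsilon> / 2 > 0" using \<epsilon> by simp
    show "\<forall>\<^sub>F n in sequentially. \<exists>Y. caratheodory_solution (F n) x0 Y \<and>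
       (\<forall>t\<ge>0. \<bar>Y t - S t x0\<bar> \<le> \<epsilon>)"
    proof (cases "moving S x0")
      case True
      have "\<exists>z\<in>E. reach S z x0 \<and> (z = x0 \<longrightarrow> source S x0)"
      proof (cases "source S x0")
        case False
        then obtain q where "q \<in> \<rat>" "reach S q x0" "q \<noteq> x0"
          using not_source_rational[OF True] by blast
        then show ?thesis using reach_neq_moving[of q x0] by (auto simp: E_def)
      qed (auto simp: E_def intro!: bexI[of _ x0])
      then obtain z where z: "z \<in> E" "reach S z x0" "z = x0 \<longrightarrow> source S x0" by blast
      \<comment> \<open>Half of \<epsilon> pays for the synchronisation, M \<delta> \<le> \<epsilon>
        / 2, the other half for the shadowing error \<open>e n\<close>.\<close>
      define \<delta> where "\<delta> = \<epsilon> / (2 * (M + 1))"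
      have \<delta>: "\<delta> > 0" using \<epsilon> M_ge_0 by (simp add: \<delta>_def)
      have "M * \<delta> \<le> (M + 1) * \<delta>" using \<delta> by simp
      also have "\<dots> = \<epsilon> / 2" using M_ge_0 by (simp add: \<delta>_def field_simps)
      finally have M\<delta>: "M * \<delta> \<le> \<epsilon> / 2" .
      obtain \<rho> where \<rho>: "\<rho> > 0" "\<And>x t1 t. reach S x z \<Longrightarrow> 0 \<le> t1 \<Longrightarrow> \<bar>S t1 x - x0\<bar> < \<rho> \<Longrightarrow>
          0 \<le> t \<Longrightarrow> \<bar>S (t1 + t) x - S t x0\<bar> \<le> M * \<delta>"
        using orbit_sync[OF True z(2,3) \<delta>] by blast
      \<comment> \<open>A second point on the orbit of x0: once \<open>e n\<close> is below its
        distance from x0, enough of the orbit lies ahead for shadowing.\<close>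
      obtain u where u: "u \<ge> 0" "S u x0 \<noteq> x0" using True by (auto simp: moving_def)
      define w where "w = S u x0"
      have w: "reach S x0 w" "\<bar>w - x0\<bar> > 0" using u by (auto simp: w_def)
      from evE[OF z(1)] ev_e[OF w(2)] ev_e[OF \<rho>(1)] ev_e[OF \<epsilon>2] show ?thesis
      proof eventually_elim
        case (elim n)
        obtain x where x: "x \<in> X n" "reach S x z" using XE elim(1) by blast
        obtain Y t1 where Y: "caratheodory_solution (F n) x0 Y" "0 \<le> t1" "\<bar>S t1 x - x0\<bar> \<le> e n"
          "\<And>t. t \<ge> 0 \<Longrightarrow> \<bar>Y t - S (t1 + t) x\<bar> \<le> e n"
          using shadow[OF x(1) reach_trans[OF x(2) z(2)] w(1)] elim(2) by auto
        have "\<bar>Y t - S t x0\<bar> \<le> \<epsilon>" if t: "t \<ge> 0" for t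
        proof -
          have "\<bar>S (t1 + t) x - S t x0\<bar> \<le> M * \<delta>"
            by (rule \<rho>(2)[OF x(2) Y(2) _ t]) (use Y(3) elim(3) in simp)
          then show ?thesis using Y(4)[OF t] M\<delta> elim(4) by linarith
        qed
        then show ?case using Y(1) by blast
      qed
    next
      case False
      obtain r where r: "r > 0"
        "\<And>x y. source S x \<Longrightarrow> \<bar>x - x0\<bar> < r \<Longrightarrow> reach S x y \<Longrightarrow> \<bar>y - x\<bar> \<le> \<epsilon> / 2"
        using short_source_orbits[OF False \<epsilon>2] by blast
      \<comment> \<open>Once \<open>e n\<close> < r, a source that drags x0 along has an orbit of
        length at most \<epsilon> / 2, so the solution cannot go far.\<close>
      from ev_e[OF r(1)] ev_e[OF \<epsilon>2] show ?thesis
      proof eventually_elim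
        case (elim n)
        obtain Y where Y: "caratheodory_solution (F n) x0 Y"
          and dich: "(\<forall>t\<ge>0. Y t = x0) \<or> (\<exists>x. source S x \<and> \<bar>x - x0\<bar> < e n \<and>
            (\<forall>t\<ge>0. \<bar>Y t - x\<bar> < e n \<or> reach S x (Y t)))"
          using rest[OF False] by blast
        have "\<bar>Y t - S t x0\<bar> \<le> \<epsilon>" if t: "t \<ge> 0" for t
          using dich
        proof
          assume "\<forall>t\<ge>0. Y t = x0"
          then show ?thesis using not_moving[OF False t] t \<epsilon> by simp
        next
          assume "\<exists>x. source S x \<and> \<bar>x - x0\<bar> < e n \<and>
            (\<forall>t\<ge>0. \<bar>Y t - x\<bar> < e n \<or> reach S x (Y t))"
          then obtain x where x: "source S x" "\<bar>x - x0\<bar> < e n"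
            "\<bar>Y t - x\<bar> < e n \<or> reach S x (Y t)" using t by blast
          have "\<bar>Y t - x\<bar> \<le> \<epsilon> / 2" using x r(2)[of x "Y t"] elim by auto
          then show ?thesis using x(2) elim(2) not_moving[OF False t] by linarith
        qed
        then show ?case using Y by blast
      qed
    qed
  qed
qed

end

lemma flow_of_semigroup:
  assumes "assumption_A1 f" "deterministic_semigroup f S"
  shows "\<exists>M. flow f S M"
proof -
  obtain M where M: "\<And>y. \<bar>f y\<bar> \<le> M"
    using assms(1) by (auto simp: assumption_A1_def bounded_iff)
  have car: "caratheodory_solution f x (\<lambda>t. S t x)" for x
    using assms(2) by (auto simp: deterministic_semigroup_def)
  have "flow f S M"
  proof
    show "S 0 x = x" for x using assms(2) by (auto simp: deterministic_semigroup_def)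
    show "S t (S s x) = S (s + t) x" if "0 \<le> s" "0 \<le> t" for s t x
      using assms(2) that by (auto simp: deterministic_semigroup_def add.commute)
    show "\<bar>S t x - S s x\<bar> \<le> M * (t - s)" if "0 \<le> s" "s \<le> t" for s t x
      by (rule caratheodory_lipschitz[OF car M that])
    show "\<exists>u\<in>{s..t}. f (S u x) - e \<le> (S t x - S s x) / (t - s)"
      "\<exists>u\<in>{s..t}. (S t x - S s x) / (t - s) \<le> f (S u x) + e"
      if "0 \<le> s" "s < t" "0 < e" for s t e x
      using caratheodory_average[OF car that] by auto
  qed
  then show ?thesis ..
qed

theorem theorem1p1:
  fixes f :: "real \<Rightarrow> real" and S :: "real \<Rightarrow> real \<Rightarrow> real"
  assumes "assumption_A1 f" and "assumption_A2 f"
    and "deterministic_semigroup f S"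
  shows "\<exists>(fn :: nat \<Rightarrow> real \<Rightarrow> real) (Sn :: nat \<Rightarrow> real \<Rightarrow> real \<Rightarrow> real).
           (\<forall>n. smooth (fn n)) \<and>
           graph_converges fn f \<and>
           (\<forall>x0. (\<forall>n. unique_solution (fn n) x0 (\<lambda>t. Sn n t x0)) \<and>
                 (\<lambda>n. SUP t\<in>{0..}. ereal \<bar>Sn n t x0 - S t x0\<bar>) \<longlonglongrightarrow> 0)"
proof -
  obtain M where "flow f S M" using flow_of_semigroup[OF assms(1,3)] by blast
  then interpret flow f S M .
  obtain F where cinf: "\<And>n. cinf (F n)"
    and near: "\<And>e N. e > 0 \<Longrightarrow> N > 0 \<Longrightarrow> \<forall>\<^sub>F n in sequentially. \<forall>y\<in>{-N..N}. near f e y (F n y)"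
    and ex: "\<And>n x0. \<exists>Y. caratheodory_solution (F n) x0 Y"
    and conv: "\<And>x0 e. e > 0 \<Longrightarrow> \<forall>\<^sub>F n in sequentially. \<exists>Y. caratheodory_solution (F n) x0 Y \<and>
       (\<forall>t\<ge>0. \<bar>Y t - S t x0\<bar> \<le> e)"
  proof (rule approximation, goal_cases)
    case (1 F)
    show ?case by (rule 1(1)[of F]) (fact 1)+
  qed
  \<comment> \<open>An arbitrary choice of solutions; by uniqueness they agree with those for which
    the estimate holds.\<close>
  define Sn where "Sn n t x0 = (SOME Y. caratheodory_solution (F n) x0 Y) t" for n t x0
  have Sn: "caratheodory_solution (F n) x0 (\<lambda>t. Sn n t x0)" for n x0
    unfolding Sn_def using someI_ex[OF ex] by simp
  show ?thesis
  proof (intro exI[of _ F] exI[of _ Sn] conjI allI)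
    show "smooth (F n)" for n by (rule cinf_imp_smooth[OF cinf])
    show "graph_converges F f"
      by (rule graph_converges_near[OF _ near]) (use assms(1) in \<open>auto simp: assumption_A1_def\<close>)
    fix x0
    show "unique_solution (F n) x0 (\<lambda>t. Sn n t x0)" for n
      unfolding unique_solution_def using Sn caratheodory_unique[OF cinf _ Sn] by blast
    show "(\<lambda>n. SUP t\<in>{0..}. ereal \<bar>Sn n t x0 - S t x0\<bar>) \<longlonglongrightarrow> 0"
    proof (rule order_tendstoI)
      fix a :: ereal assume "a < 0"
      have "(0::ereal) \<le> (SUP t\<in>{0..}. ereal \<bar>Sn n t x0 - S t x0\<bar>)" for n
        by (rule SUP_upper2[of 0]) auto
      with \<open>a < 0\<close> show "\<forall>\<^sub>F n in sequentially. a < (SUP t\<in>{0..}. ereal \<bar>Sn n t x0 - S t x0\<bar>)"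
        by (intro always_eventually allI) (rule less_le_trans)
    next
      fix a :: ereal assume "0 < a"
      then obtain e where e: "0 < ereal e" "ereal e < a" using ereal_dense2 by blast
      then have "e > 0" by simp
      from conv[OF this, of x0]
      show "\<forall>\<^sub>F n in sequentially. (SUP t\<in>{0..}. ereal \<bar>Sn n t x0 - S t x0\<bar>) < a"
      proof eventually_elim
        case (elim n)
        then obtain Y where Y: "caratheodory_solution (F n) x0 Y" "\<And>t. t \<ge> 0 \<Longrightarrow> \<bar>Y t - S t x0\<bar> \<le> e"
          by blast
        have "(SUP t\<in>{0..}. ereal \<bar>Sn n t x0 - S t x0\<bar>) \<le> ereal e"
          by (rule SUP_least) (use Y(2) caratheodory_unique[OF cinf Sn Y(1)] in auto)
        then show ?case using e(2) by (rule le_less_trans)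
      qed
    qed
  qed
qed

end
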